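(* Let $T,c,\sigma>0$ and let $R:\mathbb{R}\times[0,1]\to\mathbb{R}$ be bounded, continuous, and non-decreasing in both arguments. Assume there exist constants $L>0$ and $\alpha\in(0,1]$ such that $|R(x,r_1)-R(x,r_2)|\le L|r_1-r_2|^\alpha$ for all $r_1,r_2\in[0,1]$ and $x\in\mathbb{R}$. Let $\mu\in\mathcal{P}(\mathbb{R})$ be any fixed point of $\Phi$ (defined in the context). Then the controls $$\bar a_{i,t}:=(2c)^{-1}v_x(t,X^{\bar a_i}_{i,t};\mu),\qquad i=1,\dots,N,$$ where $dX^{\bar a_i}_{i,t}=(2c)^{-1}v_x(t,X^{\bar a_i}_{i,t};\mu)\,dt+\sigma\,dB_{i,t}$, $X^{\bar a_i}_{i,0}=0$, form an $O(N^{-\alpha/2})$-Nash equilibrium of the $N$-player game (without common noise) as $N\to\infty$; that is, there exist constants $M>0$ and $N_0$, independent of $N$, such that for all $N\ge N_0$ the vector $(\bar a_1,\dots,\bar a_N)$ is an $\epsilon_N$-Nash equilibrium with $\epsilon_N=MN^{-\alpha/2}$.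
   Context: $\mathcal{P}(\mathbb{R})$ is the set of Borel probability measures on $\mathbb{R}$; for $\mu\in\mathcal{P}(\mathbb{R})$, $F_\mu(x)=\mu(-\infty,x]$ and $R_\mu(x):=R(x,F_\mu(x))$. Mean field game. For $\mu\in\mathcal{P}(\mathbb{R})$ let $$v(t,x;\mu):=\sup_a \mathbb{E}_{t,x}\Big[R_\mu(X_T)-\int_t^T c\,a_s^2\,ds\Big],\qquad dX_s=a_s\,ds+\sigma\,dB_s,\ X_t=x,$$ where $B$ is a Brownian motion and $a$ ranges over progressively measurable processes with $\mathbb{E}\int_0^T|a_s|ds<\infty$. Explicitly, $v=2c\sigma^2\log u$ with $u(t,x;\mu)=\mathbb{E}\big[\exp\big(\tfrac{1}{2c\sigma^2}R_\mu(x+\sigma\sqrt{T-t}\,Z)\big)\big]$, $Z$ standard normal; $v$ is smooth in $x$ for $t<T$, and $v_x$ is its $x$-derivative. Let $X^\mu$ be the strong solution of $dX_t=\frac{v_x(t,X_t;\mu)}{2c}dt+\sigma dB_t$, $X_0=0$, on $[0,T)$, extended to $t=T$ by its (existing) limit, and let $\Phi(\mu):=\mathcal{L}(X^\mu_T)$ be the law of $X^\mu_T$. $N$-player game (no common noise). $B_1,\dots,B_N$ are independent standard Brownian motions on a filtered probability space $(\Omega,\mathcal{F},\{\mathcal{F}_t\}_{t\in[0,T]},\mathbb{P})$ (Brownian with respect to the filtration). If player $i$ uses control process $a_i$, her state is $X^{a_i}_{i,t}=\int_0^t a_{i,s}ds+\sigma B_{i,t}$. For $\mathbf a=(a_1,\dots,a_N)$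 let $\bar\mu^{N,\mathbf a}=\frac1N\sum_{j=1}^N\delta_{X^{a_j}_{j,T}}$. A progressively measurable vector $\mathbf a=(a_1,\dots,a_N)$ is an $\epsilon$-Nash equilibrium if (i) $\mathbb{E}\int_0^T|a_{i,t}|dt<\infty$ for all $i$; and (ii) for every $i\in\{1,\dots,N\}$ and every progressively measurable $\beta$ with $\mathbb{E}\int_0^T|\beta_t|dt<\infty$, $$\mathbb{E}\Big[R_{\bar\mu^{N,\mathbf a}}(X^{a_i}_{i,T})-\int_0^T c\,a_{i,t}^2dt\Big]+\epsilon\ \ge\ \mathbb{E}\Big[R_{\bar\mu^{N,\mathbf a^i_\beta}}(X^{\beta}_{i,T})-\int_0^T c\,\beta_t^2dt\Big],$$ where $\mathbf a^i_\beta=(a_1,\dots,a_{i-1},\beta,a_{i+1},\dots,a_N)$ and $X^\beta_{i,T}=\int_0^T\beta_t\,dt+\sigma B_{i,T}$. *)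

theory Defs
  imports "HOL-Probability.Probability"
begin

section \<open>Filtered probability spaces, Brownian motion, admissible controls\<close>

text \<open>
  Processes are functions of time (a real number, only the values on \<open>[0, T]\<close> matter) and of the
  sample point.  A filtration on \<open>[0, T]\<close> can always be extended to all real times by constants,
  so that the library's locale \<open>filtration\<close> is applicable.  The usual conditions are not required.
\<close>

definition filtered_prob_space :: "'a measure \<Rightarrow> (real \<Rightarrow> 'a measure) \<Rightarrow> bool" where
  "filtered_prob_space M F \<longleftrightarrow>
     prob_space M \<and> filtration (space M) F \<and> (\<forall>t. subalgebra M (F t))"

definition adapted :: "(real \<Rightarrow> 'a measure) \<Rightarrow> real \<Rightarrow> (real \<Rightarrow> 'a \<Rightarrow> real) \<Rightarrow> bool" where
  "adapted F T X \<longleftrightarrow> (\<forall>t\<in>{0..T}. X t \<in> borel_measurable (F t))"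

definition brownian_motion ::
  "'a measure \<Rightarrow> (real \<Rightarrow> 'a measure) \<Rightarrow> real \<Rightarrow> (real \<Rightarrow> 'a \<Rightarrow> real) \<Rightarrow> bool" where
  "brownian_motion M F T B \<longleftrightarrow>
     adapted F T B \<and>
     (\<forall>\<omega>\<in>space M. continuous_on {0..T} (\<lambda>t. B t \<omega>)) \<and>
     (AE \<omega> in M. B 0 \<omega> = 0) \<and>
     (\<forall>s t. 0 \<le> s \<and> s < t \<and> t \<le> T \<longrightarrow>
        distributed M lborel (\<lambda>\<omega>. B t \<omega> - B s \<omega>) (normal_density 0 (sqrt (t - s))) \<and>
        prob_space.indep_set M (sets (F s))
          {(\<lambda>\<omega>. B t \<omega> - B s \<omega>) -` A \<inter> space M |A. A \<in> sets borel})"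

definition progressively_measurable ::
  "(real \<Rightarrow> 'a measure) \<Rightarrow> real \<Rightarrow> (real \<Rightarrow> 'a \<Rightarrow> real) \<Rightarrow> bool" where
  "progressively_measurable F T a \<longleftrightarrow>
     (\<forall>t\<in>{0..T}. (\<lambda>(s, \<omega>). a s \<omega>) \<in> borel_measurable (restrict_space borel {0..t} \<Otimes>\<^sub>M F t))"

definition admissible ::
  "'a measure \<Rightarrow> (real \<Rightarrow> 'a measure) \<Rightarrow> real \<Rightarrow> (real \<Rightarrow> 'a \<Rightarrow> real) \<Rightarrow> bool" where
  "admissible M F T a \<longleftrightarrow>
     progressively_measurable F T a \<and>
     (\<integral>\<^sup>+ \<omega>. (\<integral>\<^sup>+ s\<in>{0..T}. ennreal \<bar>a s \<omega>\<bar> \<partial>lborel) \<partial>M) < \<infinity>"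

text \<open>
  The expectation of \<open>g - (\<integral> s = t..T. c * (a s)\<^sup>2)\<close> for a bounded reward \<open>g\<close>.  Admissible controls
  may have infinite quadratic cost, in which case the value is \<open>-\<infinity>\<close>; hence the type \<^typ>\<open>ereal\<close>.
\<close>

definition expected_payoff ::
  "'a measure \<Rightarrow> real \<Rightarrow> real \<Rightarrow> real \<Rightarrow> ('a \<Rightarrow> real) \<Rightarrow> (real \<Rightarrow> 'a \<Rightarrow> real) \<Rightarrow> ereal" where
  "expected_payoff M c t T g a =
     ereal (\<integral>\<omega>. g \<omega> \<partial>M)
     - enn2ereal (\<integral>\<^sup>+ \<omega>. (\<integral>\<^sup>+ s\<in>{t..T}. ennreal (c * (a s \<omega>)\<^sup>2) \<partial>lborel) \<partial>M)"

text \<open>The function \<open>R\<^sub>\<mu>(x) = R(x, F\<^sub>\<mu>(x))\<close>.\<close>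

definition rank_reward :: "(real \<Rightarrow> real \<Rightarrow> real) \<Rightarrow> real measure \<Rightarrow> real \<Rightarrow> real" where
  "rank_reward R \<mu> x = R x (cdf \<mu> x)"


section \<open>The mean field game\<close>

definition mfg_value ::
  "'a measure \<Rightarrow> (real \<Rightarrow> 'a measure) \<Rightarrow> (real \<Rightarrow> 'a \<Rightarrow> real) \<Rightarrow> real \<Rightarrow> real \<Rightarrow> real \<Rightarrow>
   (real \<Rightarrow> real \<Rightarrow> real) \<Rightarrow> real measure \<Rightarrow> real \<Rightarrow> real \<Rightarrow> real" where
  "mfg_value M F B T c \<sigma> R \<mu> t x =
     real_of_ereal (SUP a\<in>{a. admissible M F T a}.
       expected_payoff M c t T
         (\<lambda>\<omega>. rank_reward R \<mu> (x + (LINT s:{t..T}|lborel. a s \<omega>) + \<sigma> * (B T \<omega> - B t \<omega>))) a)"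

text \<open>
  The feedback drift \<open>v\<^sub>x / (2 c)\<close>.  It is used for \<open>t < T\<close> only, where \<open>v\<close> is smooth in \<open>x\<close>;
  at \<open>t = T\<close>, where \<open>v(T, \<cdot>) = R\<^sub>\<mu>\<close> need not be differentiable, it is set to \<open>0\<close>.
\<close>

definition mfg_drift ::
  "'a measure \<Rightarrow> (real \<Rightarrow> 'a measure) \<Rightarrow> (real \<Rightarrow> 'a \<Rightarrow> real) \<Rightarrow> real \<Rightarrow> real \<Rightarrow> real \<Rightarrow>
   (real \<Rightarrow> real \<Rightarrow> real) \<Rightarrow> real measure \<Rightarrow> real \<Rightarrow> real \<Rightarrow> real" where
  "mfg_drift M F B T c \<sigma> R \<mu> t x =
     (if t < T then deriv (mfg_value M F B T c \<sigma> R \<mu> t) x / (2 * c) else 0)"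

text \<open>
  \<open>X\<close> solves \<open>dX\<^sub>t = b(t, X\<^sub>t) dt + \<sigma> dB\<^sub>t\<close>, \<open>X\<^sub>0 = 0\<close> on \<open>[0, T)\<close>, on the given space and for the given
  Brownian motion.  Continuity on the closed interval \<open>[0, T]\<close> says that \<open>X\<^sub>T\<close> is the limit of \<open>X\<^sub>t\<close>
  as \<open>t\<close> increases to \<open>T\<close>.
\<close>

definition strong_solution ::
  "'a measure \<Rightarrow> (real \<Rightarrow> 'a measure) \<Rightarrow> (real \<Rightarrow> 'a \<Rightarrow> real) \<Rightarrow> real \<Rightarrow> real \<Rightarrow>
   (real \<Rightarrow> real \<Rightarrow> real) \<Rightarrow> (real \<Rightarrow> 'a \<Rightarrow> real) \<Rightarrow> bool" where
  "strong_solution M F B T \<sigma> b X \<longleftrightarrow>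
     adapted F T X \<and>
     (\<forall>\<omega>\<in>space M. continuous_on {0..T} (\<lambda>t. X t \<omega>)) \<and>
     (AE \<omega> in M. \<forall>t\<in>{0..<T}.
        set_integrable lborel {0..t} (\<lambda>s. b s (X s \<omega>)) \<and>
        X t \<omega> = (LINT s:{0..t}|lborel. b s (X s \<omega>)) + \<sigma> * B t \<omega>)"

text \<open>
  The process \<open>X\<^sup>\<mu>\<close>.  For bounded \<open>R\<close> the drift is locally Lipschitz in \<open>x\<close> on \<open>[0, T)\<close> and of size
  \<open>O((T - t) powr (-1/2))\<close>, so the solution exists and is unique up to indistinguishability; in
  particular the law of \<open>X\<^sup>\<mu>\<^sub>T\<close> does not depend on the choice made here.
\<close>

definition mfg_state ::
  "'a measure \<Rightarrow> (real \<Rightarrow> 'a measure) \<Rightarrow> (real \<Rightarrow> 'a \<Rightarrow> real) \<Rightarrow> real \<Rightarrow> real \<Rightarrow> real \<Rightarrow>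
   (real \<Rightarrow> real \<Rightarrow> real) \<Rightarrow> real measure \<Rightarrow> real \<Rightarrow> 'a \<Rightarrow> real" where
  "mfg_state M F B T c \<sigma> R \<mu> =
     (SOME X. strong_solution M F B T \<sigma> (mfg_drift M F B T c \<sigma> R \<mu>) X)"

definition mfg_Phi ::
  "'a measure \<Rightarrow> (real \<Rightarrow> 'a measure) \<Rightarrow> (real \<Rightarrow> 'a \<Rightarrow> real) \<Rightarrow> real \<Rightarrow> real \<Rightarrow> real \<Rightarrow>
   (real \<Rightarrow> real \<Rightarrow> real) \<Rightarrow> real measure \<Rightarrow> real measure" where
  "mfg_Phi M F B T c \<sigma> R \<mu> = distr M borel (mfg_state M F B T c \<sigma> R \<mu> T)"


section \<open>The game with \<open>N\<close> players\<close>

definition independent_brownian_motions ::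
  "'a measure \<Rightarrow> (real \<Rightarrow> 'a measure) \<Rightarrow> real \<Rightarrow> nat \<Rightarrow> (nat \<Rightarrow> real \<Rightarrow> 'a \<Rightarrow> real) \<Rightarrow> bool" where
  "independent_brownian_motions M F T N B \<longleftrightarrow>
     (\<forall>i\<in>{1..N}. brownian_motion M F T (B i)) \<and>
     prob_space.indep_vars M (\<lambda>_. PiM {0..T} (\<lambda>_. borel)) (\<lambda>i \<omega>. \<lambda>t\<in>{0..T}. B i t \<omega>) {1..N}"

text \<open>The measure \<open>(1/N) (\<delta>\<^bsub>x 1\<^esub> + \<dots> + \<delta>\<^bsub>x N\<^esub>)\<close>, as the image of the uniform distribution
  on the indices.\<close>

definition empirical_measure :: "nat \<Rightarrow> (nat \<Rightarrow> real) \<Rightarrow> real measure" where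
  "empirical_measure N x = distr (uniform_count_measure {1..N}) borel x"

lemma cdf_empirical_measure:
  "cdf (empirical_measure N x) y = real (card {j\<in>{1..N}. x j \<le> y}) / real N"
proof -
  have "x -` {..y} \<inter> {1..N} = {j\<in>{1..N}. x j \<le> y}"
    by auto
  then show ?thesis
    by (simp add: cdf_def empirical_measure_def measure_distr measurable_def
        space_uniform_count_measure sets_uniform_count_measure measure_uniform_count_measure)
qed

definition terminal_state ::
  "real \<Rightarrow> real \<Rightarrow> (nat \<Rightarrow> real \<Rightarrow> 'a \<Rightarrow> real) \<Rightarrow> (nat \<Rightarrow> real \<Rightarrow> 'a \<Rightarrow> real) \<Rightarrow> nat \<Rightarrow> 'a \<Rightarrow> real" where
  "terminal_state T \<sigma> B a i \<omega> = (LINT s:{0..T}|lborel. a i s \<omega>) + \<sigma> * B i T \<omega>"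

definition game_payoff ::
  "'a measure \<Rightarrow> real \<Rightarrow> real \<Rightarrow> real \<Rightarrow> (real \<Rightarrow> real \<Rightarrow> real) \<Rightarrow> nat \<Rightarrow>
   (nat \<Rightarrow> real \<Rightarrow> 'a \<Rightarrow> real) \<Rightarrow> (nat \<Rightarrow> real \<Rightarrow> 'a \<Rightarrow> real) \<Rightarrow> nat \<Rightarrow> ereal" where
  "game_payoff M T c \<sigma> R N B a i =
     expected_payoff M c 0 T
       (\<lambda>\<omega>. rank_reward R (empirical_measure N (\<lambda>j. terminal_state T \<sigma> B a j \<omega>))
              (terminal_state T \<sigma> B a i \<omega>)) (a i)"

definition eps_nash ::
  "'a measure \<Rightarrow> (real \<Rightarrow> 'a measure) \<Rightarrow> real \<Rightarrow> real \<Rightarrow> real \<Rightarrow> (real \<Rightarrow> real \<Rightarrow> real) \<Rightarrow> nat \<Rightarrow>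
   (nat \<Rightarrow> real \<Rightarrow> 'a \<Rightarrow> real) \<Rightarrow> (nat \<Rightarrow> real \<Rightarrow> 'a \<Rightarrow> real) \<Rightarrow> real \<Rightarrow> bool" where
  "eps_nash M F T c \<sigma> R N B a \<epsilon> \<longleftrightarrow>
     (\<forall>i\<in>{1..N}. admissible M F T (a i)) \<and>
     (\<forall>i\<in>{1..N}. \<forall>\<beta>. admissible M F T \<beta> \<longrightarrow>
        game_payoff M T c \<sigma> R N B a i + ereal \<epsilon> \<ge> game_payoff M T c \<sigma> R N B (a(i := \<beta>)) i)"

end

theory Submission
  imports Defs
begin

text \<open>
  For a fixed \<open>\<mu>\<close> the reward \<open>g = R\<^sub>\<mu>\<close> is bounded, non-decreasing and right-continuous. The value function
  is \<open>v = 2 c \<sigma>\<^sup>2 log u\<close> with \<open>u\<close> the heat flow of \<open>exp (g / (2 c \<sigma>\<^sup>2))\<close>. Instead of Ito's formula, both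
  halves of the verification theorem use a one-step Gaussian variational inequality, i.e. Jensen's inequality
  after a translation of the Gaussian measure. It is exact for controls frozen at the start of a time step, which
  gives the upper bound for every admissible control, and it is sharp up to the square of the step for the shift
  \<open>v\<^sub>x / (2 c)\<close>, which gives the lower bound along a solution of the state equation.

  The Euler scheme converges pathwise to that solution. Hence the terminal state is a measurable functional of
  the Brownian path, the same one on every probability space: the terminal states of the players are independent
  with law \<open>\<mu>\<close>. The expected distance in the supremum norm between their empirical distribution
  function and that of \<open>\<mu>\<close> is \<open>O(N powr (-1/2))\<close>. Replacing one control moves the empirical distribution
  function by at most \<open>1/N\<close>, so by the Hoelder condition every deviation pays at most the mean field value
  up to \<open>O(N powr (-\<alpha>/2))\<close>, while the feedback control attains it up to the same error.
\<close>

section \<open>Gaussian integrals\<close>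

text \<open>Two obstacles shape the proof. First, the reward may jump at atoms of \<mu>, so v_x is
  only O((T - t)^(-1/2)), and this bound is not square integrable up to T. The lower bound for the
  feedback is therefore proved on [t0, u] with u < T, where all constants are finite, and the
  finiteness of the cost is a result of it, because V stays bounded as u tends to T. In both limits
  at T monotonicity replaces continuity of the reward: a small shift of the state dominates the
  error and is removed at the end.

  Second, a deviating player may react to the noise of all others. Her terminal state is then not
  independent of the sample, so a variance bound at fixed x is insufficient and the empirical
  distribution function has to be controlled uniformly in x. Second moments of its increments would
  leave a logarithm in N. Fourth moments are bounded by the square of the mass, up to a correction
  of order 1 / N, and halving the mass halves the sum of the squares; this yields a maximal
  inequality without logarithm.\<close>

abbreviation gauss :: "real measure" where
  "gauss \<equiv> density lborel std_normal_density"

lemma sets_gauss [measurable_cong]: "sets gauss = sets borel"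
  by simp

interpretation gauss: prob_space gauss
  by (rule prob_space_normal_density) simp

lemma prob_gauss_UNIV [simp]: "measure gauss UNIV = 1"
  using gauss.prob_space by simp

text \<open>Cameron-Martin for a constant shift: the density of N(m, 1) relative to N(0, 1) is exp
  (m z - m^2 / 2). Integrability is part of the statement because the formula is applied to
  unbounded functions.\<close>

lemma integrable_gauss_shift_iff:
  fixes f :: "real \<Rightarrow> real"
  assumes [measurable]: "f \<in> borel_measurable borel"
  shows "integrable gauss (\<lambda>z. f (z + m)) \<longleftrightarrow> integrable gauss (\<lambda>z. exp (m * z - m\<^sup>2 / 2) * f z)"
    and "(LINT z|gauss. f (z + m)) = (LINT z|gauss. exp (m * z - m\<^sup>2 / 2) * f z)"
proof -
  have *: "std_normal_density (- m + z) = std_normal_density z * exp (m * z - m\<^sup>2 / 2)" for z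
    by (simp add: std_normal_density_def mult_exp_exp[symmetric] field_simps power2_eq_square
        flip: exp_add)
  have **: "std_normal_density (z - m) = std_normal_density z * exp (m * z - m\<^sup>2 / 2)" for z
    using *[of z] by simp
  have "integrable gauss (\<lambda>z. f (z + m)) \<longleftrightarrow> integrable lborel (\<lambda>z. std_normal_density z * f (z + m))"
    by (subst integrable_density) auto
  also have "\<dots> \<longleftrightarrow> integrable lborel (\<lambda>z. std_normal_density (- m + 1 * z) * f ((- m + 1 * z) + m))"
    using lborel_integrable_real_affine_iff[of 1 "\<lambda>z. std_normal_density z * f (z + m)" "-m"] by simp
  also have "\<dots> \<longleftrightarrow> integrable gauss (\<lambda>z. exp (m * z - m\<^sup>2 / 2) * f z)"
    by (subst integrable_density) (auto simp: * ** ac_simps)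
  finally show "integrable gauss (\<lambda>z. f (z + m)) \<longleftrightarrow> integrable gauss (\<lambda>z. exp (m * z - m\<^sup>2 / 2) * f z)" .
  have "(LINT z|gauss. f (z + m)) = (LINT z|lborel. std_normal_density z * f (z + m))"
    by (subst integral_density) auto
  also have "\<dots> = (LINT z|lborel. std_normal_density (- m + 1 * z) * f ((- m + 1 * z) + m))"
    using lborel_integral_real_affine[of 1 "\<lambda>z. std_normal_density z * f (z + m)" "-m"] by simp
  also have "\<dots> = (LINT z|gauss. exp (m * z - m\<^sup>2 / 2) * f z)"
    by (subst integral_density) (auto simp: * ** ac_simps)
  finally show "(LINT z|gauss. f (z + m)) = (LINT z|gauss. exp (m * z - m\<^sup>2 / 2) * f z)" .
qed

lemma integrable_gauss_bounded:
  fixes f :: "real \<Rightarrow> real"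
  assumes "f \<in> borel_measurable borel" "\<And>z. \<bar>f z\<bar> \<le> K"
  shows "integrable gauss f"
  by (rule gauss.integrable_const_bound[where B=K]) (use assms in auto)

text \<open>The case f = 1 of the shift formula, so no integral has to be computed.\<close>

lemma integrable_gauss_exp: "integrable gauss (\<lambda>z. exp (a * z))"
proof -
  have "integrable gauss (\<lambda>z. exp (a * z - a\<^sup>2 / 2) * 1)"
    using integrable_gauss_shift_iff(1)[of "\<lambda>_. 1" a] by simp
  then have "integrable gauss (\<lambda>z. exp (a\<^sup>2 / 2) * (exp (a * z - a\<^sup>2 / 2) * 1))"
    by (rule integrable_mult_right)
  then show ?thesis
    by (simp flip: exp_add)
qed

lemma integrable_gauss_exp_abs: "integrable gauss (\<lambda>z. exp (a * \<bar>z\<bar>))"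
proof (rule Bochner_Integration.integrable_bound)
  show "integrable gauss (\<lambda>z. exp (a * z) + exp (- a * z))"
    by (intro Bochner_Integration.integrable_add integrable_gauss_exp)
  show "AE z in gauss. norm (exp (a * \<bar>z\<bar>)) \<le> norm (exp (a * z) + exp (- a * z))"
    by (intro always_eventually) (auto simp: abs_real_def add_pos_pos less_le_not_le[symmetric]
        simp flip: not_le)
qed simp

lemma integrable_gauss_dominated:
  fixes f :: "real \<Rightarrow> real"
  assumes "f \<in> borel_measurable borel" "\<And>z. \<bar>f z\<bar> \<le> K * exp (a * \<bar>z\<bar>)"
  shows "integrable gauss f"
proof (rule Bochner_Integration.integrable_bound)
  show "integrable gauss (\<lambda>z. K * exp (a * \<bar>z\<bar>))"
    by (intro integrable_mult_right integrable_gauss_exp_abs)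
  show "AE z in gauss. norm (f z) \<le> norm (K * exp (a * \<bar>z\<bar>))"
    using assms(2) by (intro always_eventually) (smt (verit) real_norm_def)
qed (use assms in simp)

lemma integrable_gauss_ident: "integrable gauss (\<lambda>z. z)"
  and integral_gauss_ident: "(LINT z|gauss. z) = 0"
proof -
  show "integrable gauss (\<lambda>z. z)"
  proof (rule integrable_gauss_dominated[where K=1 and a=1])
    show "\<bar>z\<bar> \<le> 1 * exp (1 * \<bar>z\<bar>)" for z :: real
      using exp_ge_add_one_self[of "\<bar>z\<bar>"] by (simp del: exp_ge_add_one_self)
  qed simp
  show "(LINT z|gauss. z) = 0"
    using integral_std_normal_moment_odd[of 0] by (subst integral_density) auto
qed

text \<open>Lagrange form of the remainder. The bound is global in q; the factor exp |q| is
  affordable because all exponential moments of a Gaussian are finite.\<close>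

lemma exp_second_order_bound: "\<bar>exp q - 1 - q\<bar> \<le> q\<^sup>2 * exp \<bar>q\<bar>" for q :: real
proof -
  have "\<exists>t. \<bar>t\<bar> \<le> \<bar>q\<bar> \<and> exp q = (\<Sum>m<2. (q ^ m) / fact m) + exp t / fact 2 * q ^ 2"
    by (rule Maclaurin_exp_le)
  then obtain t where t: "\<bar>t\<bar> \<le> \<bar>q\<bar>" "exp q = (\<Sum>m<2. (q ^ m) / fact m) + exp t / fact 2 * q ^ 2"
    by blast
  then have "exp q - 1 - q = exp t / 2 * q\<^sup>2"
    by (simp add: numeral_2_eq_2)
  moreover have "exp t / 2 \<le> exp \<bar>q\<bar>"
    using t(1) by (smt (verit) exp_le_cancel_iff exp_gt_zero field_sum_of_halves)
  ultimately have "\<bar>exp q - 1 - q\<bar> = exp t / 2 * q\<^sup>2" "exp t / 2 * q\<^sup>2 \<le> exp \<bar>q\<bar> * q\<^sup>2"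
    by (simp_all only: abs_mult abs_power2 abs_exp_cancel mult_right_mono zero_le_power2)
      (simp add: abs_mult)
  then show ?thesis
    by (simp add: mult.commute)
qed

text \<open>The heat semigroup, indexed by the standard deviation.\<close>

definition heat :: "real \<Rightarrow> (real \<Rightarrow> real) \<Rightarrow> real \<Rightarrow> real" where
  "heat s f x = (LINT z|gauss. f (x + s * z))"

lemma heat_0 [simp]: "heat 0 f x = f x"
  by (simp add: heat_def)

lemma heat_measurable [measurable]:
  assumes [measurable]: "f \<in> borel_measurable borel"
  shows "heat s f \<in> borel_measurable borel"
  unfolding heat_def[abs_def] by measurable

lemma heat_bounds:
  assumes [measurable]: "f \<in> borel_measurable borel" and "\<And>x. l \<le> f x" "\<And>x. f x \<le> u"
  shows "l \<le> heat s f x" "heat s f x \<le> u"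
proof -
  have i: "integrable gauss (\<lambda>z. f (x + s * z))"
    by (rule integrable_gauss_bounded[where K="\<bar>l\<bar> + \<bar>u\<bar>"], measurable)
      (smt (verit) assms(2,3))
  show "l \<le> heat s f x" "heat s f x \<le> u"
    unfolding heat_def using i assms(2,3)
    by (auto intro!: gauss.integral_ge_const gauss.integral_le_const)
qed

text \<open>Independent normal variables with standard deviations s and r add up to one with
  standard deviation sqrt (s^2 + r^2). The two projections on the product space serve as the
  variables.\<close>

lemma heat_heat:
  assumes [measurable]: "f \<in> borel_measurable borel" and bd: "\<And>x. \<bar>f x\<bar> \<le> K"
    and "0 \<le> s" "0 \<le> r"
  shows "heat s (heat r f) x = heat (sqrt (s\<^sup>2 + r\<^sup>2)) f x"
\<comment> \<open>A vanishing standard deviation has no normal density and is treated apart.\<close>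
proof (cases "s = 0 \<or> r = 0")
  case True
  then show ?thesis
    using assms(3,4) by (auto simp: real_sqrt_abs abs_of_nonneg heat_def)
next
  case False
  then have pos: "s > 0" "r > 0"
    using assms by auto
  interpret P: pair_prob_space gauss gauss ..
  have d1: "distr (gauss \<Otimes>\<^sub>M gauss) gauss fst = gauss"
    by (rule gauss.distr_pair_fst)
  have d2: "distr (gauss \<Otimes>\<^sub>M gauss) gauss snd = gauss"
  proof (rule measure_eqI)
    fix A assume "A \<in> sets (distr (gauss \<Otimes>\<^sub>M gauss) gauss snd)"
    then have A: "A \<in> sets gauss" by simp
    have "snd -` A \<inter> space (gauss \<Otimes>\<^sub>M gauss) = UNIV \<times> A"
      by (auto simp: space_pair_measure)
    then show "emeasure (distr (gauss \<Otimes>\<^sub>M gauss) gauss snd) A = emeasure gauss A"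
      using A gauss.emeasure_space_1 by (simp add: emeasure_distr gauss.emeasure_pair_measure_Times)
  qed simp
  have ind: "P.indep_var gauss fst gauss snd"
    unfolding P.indep_var_distribution_eq d1 d2 by (auto intro: distr_id2)
  have n: "distributed (gauss \<Otimes>\<^sub>M gauss) lborel fst std_normal_density"
    "distributed (gauss \<Otimes>\<^sub>M gauss) lborel snd std_normal_density"
    using d1 d2 by (auto simp: distributed_def cong: distr_cong)
  have n1: "distributed (gauss \<Otimes>\<^sub>M gauss) lborel (\<lambda>p. s * fst p) (normal_density 0 s)"
    "distributed (gauss \<Otimes>\<^sub>M gauss) lborel (\<lambda>p. r * snd p) (normal_density 0 r)"
    using P.normal_density_affine[OF n(1), of s 0] P.normal_density_affine[OF n(2), of r 0] pos by auto
  have ind1: "P.indep_var borel (\<lambda>p. s * fst p) borel (\<lambda>p. r * snd p)"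
    using P.indep_var_compose[OF ind, of "\<lambda>z. s * z" borel "\<lambda>z. r * z" borel] by (simp add: comp_def)
  define q where "q = sqrt (s\<^sup>2 + r\<^sup>2)"
  have q: "q > 0"
    using pos by (simp add: q_def add_pos_pos)
  have n2: "distributed (gauss \<Otimes>\<^sub>M gauss) lborel (\<lambda>p. s * fst p + r * snd p) (normal_density 0 q)"
    using P.add_indep_normal[OF ind1 pos n1] by (simp add: q_def)
  have "distributed (gauss \<Otimes>\<^sub>M gauss) lborel (\<lambda>p. (s * fst p + r * snd p - 0) / q) std_normal_density"
    using P.normal_standard_normal_convert[OF q, of "\<lambda>p. s * fst p + r * snd p" 0] n2 by blast
  then have "(LINT z|lborel. std_normal_density z * f (x + q * z)) =
    (\<integral>p. f (x + q * ((s * fst p + r * snd p - 0) / q)) \<partial>(gauss \<Otimes>\<^sub>M gauss))"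
    by (rule distributed_integral) auto
  also have "\<dots> = (\<integral>p. f (x + (s * fst p + r * snd p)) \<partial>(gauss \<Otimes>\<^sub>M gauss))"
    using q by (simp only: diff_zero times_divide_eq_right nonzero_mult_div_cancel_left[OF less_imp_neq[OF q, symmetric]])
  also have "\<dots> = (LINT z|gauss. LINT w|gauss. f (x + (s * z + r * w)))"
  proof -
    have "integrable (gauss \<Otimes>\<^sub>M gauss) (\<lambda>p. f (x + (s * fst p + r * snd p)))"
    proof (rule P.integrable_const_bound)
      show "AE p in gauss \<Otimes>\<^sub>M gauss. norm (f (x + (s * fst p + r * snd p))) \<le> K"
        using bd by (intro always_eventually allI) (simp only: real_norm_def)
    qed measurable
    from P.integral_fst'[OF this] show ?thesis
      by (simp only: fst_conv snd_conv)
  qed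
  also have "\<dots> = heat s (heat r f) x"
    by (simp add: heat_def add.assoc)
  also have "(LINT z|lborel. std_normal_density z * f (x + q * z)) = heat q f x"
    unfolding heat_def by (subst integral_density) auto
  finally show ?thesis
    by (simp add: q_def)
qed

text \<open>The shift formula for exp (f z - m z + m^2 / 2), in which the Cameron-Martin density
  cancels. The shifted exponent has mean E f(Z + m) - m^2 / 2, the reward minus the cost of the
  shift, which is what Jensen's inequality needs.\<close>

lemma gauss_exp_tilt:
  fixes f :: "real \<Rightarrow> real"
  assumes [measurable]: "f \<in> borel_measurable borel" and bd: "\<And>z. \<bar>f z\<bar> \<le> K"
  shows "integrable gauss (\<lambda>z. exp (f (z + m) - m * z - m\<^sup>2 / 2))" (is ?I)
    and "(LINT z|gauss. exp (f (z + m) - m * z - m\<^sup>2 / 2)) = (LINT z|gauss. exp (f z))" (is ?E)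
proof -
  let ?F = "\<lambda>z. exp (f z - m * z + m\<^sup>2 / 2)"
  have 1: "?F (z + m) = exp (f (z + m) - m * z - m\<^sup>2 / 2)" for z
    by (simp add: algebra_simps power2_eq_square)
  have 2: "exp (m * z - m\<^sup>2 / 2) * ?F z = exp (f z)" for z
    by (simp flip: exp_add)
  have "integrable gauss (\<lambda>z. exp (f z))"
    by (rule integrable_gauss_bounded[where K="exp K"])
      (use bd in \<open>auto simp: abs_le_iff\<close>)
  then show ?I ?E
    using integrable_gauss_shift_iff[of ?F m] unfolding 1 2 by simp_all
qed

text \<open>Jensen's inequality after translating \<open>Z\<close> by a constant: the Gaussian variational principle
  for a deterministic control.\<close>

lemma gauss_variational:
  fixes f :: "real \<Rightarrow> real"
  assumes [measurable]: "f \<in> borel_measurable borel" and bd: "\<And>z. \<bar>f z\<bar> \<le> K"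
  shows "(LINT z|gauss. f (z + m)) - m\<^sup>2 / 2 \<le> ln (LINT z|gauss. exp (f z))"
proof -
  let ?\<psi> = "\<lambda>z. f (z + m) - m * z - m\<^sup>2 / 2"
  define a where "a = (LINT z|gauss. f (z + m)) - m\<^sup>2 / 2"
  have i: "integrable gauss (\<lambda>z. f (z + m))"
    by (rule integrable_gauss_bounded[where K=K]) (use bd in auto)
  have i\<psi>: "integrable gauss ?\<psi>"
    by (intro Bochner_Integration.integrable_diff integrable_mult_right i integrable_gauss_ident) simp
  have "(LINT z|gauss. ?\<psi> z) = a"
    unfolding a_def using i integrable_gauss_ident integral_gauss_ident by simp
  \<comment> \<open>Jensen's inequality by hand: exp lies above its tangent at the mean
    \<open>a\<close>, and this tangent integrates to exp a.\<close>
  then have "exp a = (LINT z|gauss. exp a * (1 + (?\<psi> z - a)))"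
    using i\<psi> by simp
  also have "\<dots> \<le> (LINT z|gauss. exp (?\<psi> z))"
  proof (rule integral_mono)
    show "integrable gauss (\<lambda>z. exp a * (1 + (?\<psi> z - a)))"
      using i\<psi> by simp
    show "integrable gauss (\<lambda>z. exp (?\<psi> z))"
      using bd by (rule gauss_exp_tilt(1)[rotated]) simp
    show "exp a * (1 + (?\<psi> z - a)) \<le> exp (?\<psi> z)" for z
    proof -
      have "exp a * (1 + (?\<psi> z - a)) \<le> exp a * exp (?\<psi> z - a)"
        by (intro mult_left_mono exp_ge_add_one_self) simp
      then show ?thesis
        by (simp only: exp_add[symmetric]) (simp add: add_diff_eq)
    qed
  qed
  also have "\<dots> = (LINT z|gauss. exp (f z))"
    using bd by (rule gauss_exp_tilt(2)[rotated]) simp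
  finally have "exp a \<le> (LINT z|gauss. exp (f z))" .
  then show ?thesis
    unfolding a_def[symmetric] by (metis exp_gt_zero ln_exp ln_le_cancel_iff order_less_le_trans)
qed

text \<open>The loss in the variational principle when the shift \<open>m = s d\<close> is the optimal one to first
  order.  It is of fourth order in \<open>s\<close>, hence summable over a partition with \<open>s\<^sup>2\<close> the mesh.\<close>

lemma gauss_variational_gap:
  fixes w :: "real \<Rightarrow> real"
  assumes [measurable]: "w \<in> borel_measurable borel" and bd: "\<And>z. \<bar>w z\<bar> \<le> C"
    and taylor: "\<And>y. \<bar>w y - w x - d * (y - x)\<bar> \<le> A * (y - x)\<^sup>2"
    and sd: "\<bar>s * d\<bar> \<le> 1"
  shows "ln (LINT z|gauss. exp (w (x + s * z)))
    \<le> (LINT z|gauss. w (x + s * (z + s * d))) - (s * d)\<^sup>2 / 2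
       + A\<^sup>2 * exp (1 + 2 * C) * (LINT z|gauss. exp (5 * \<bar>z\<bar>)) * s ^ 4"
proof -
  define m where "m = s * d"
  define f where "f z = w (x + s * z)" for z
  have [measurable]: "f \<in> borel_measurable borel"
    unfolding f_def by measurable
  have bdf: "\<bar>f z\<bar> \<le> C" for z
    using bd by (simp add: f_def)
  have A: "A \<ge> 0"
    using order_trans[OF abs_ge_zero taylor[of "x + 1"]] by simp
  \<comment> \<open>The value of f (z + m) - m z - m^2 / 2 when \<open>w\<close> is replaced by its
    first-order expansion at x. It is constant in z exactly because m = s * d, which is the
    optimality of the shift; \<open>y\<close> below is the Taylor remainder.\<close>
  define \<psi>0 where "\<psi>0 = w x + m\<^sup>2 / 2"
  define y where "y z = f (z + m) - m * z - m\<^sup>2 / 2 - \<psi>0" for z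
  have [measurable]: "y \<in> borel_measurable borel"
    unfolding y_def by measurable
  have "y z = w (x + s * (z + m)) - w x - d * ((x + s * (z + m)) - x)" for z
    by (simp add: y_def f_def \<psi>0_def m_def algebra_simps power2_eq_square)
  then have y1: "\<bar>y z\<bar> \<le> A * s\<^sup>2 * (z + m)\<^sup>2" for z
    using taylor[of "x + s * (z + m)"] by (simp add: power_mult_distrib mult.assoc)
  have m1: "\<bar>m\<bar> \<le> 1"
    using sd by (simp add: m_def)
  have zm: "\<bar>z + m\<bar> \<le> \<bar>z\<bar> + 1" for z
    using m1 by linarith
  \<comment> \<open>\<open>y1\<close> supplies the smallness; the present bound, free of
    \<open>s\<close>, keeps exp |y z| integrable.\<close>
  have y2: "\<bar>y z\<bar> \<le> 2 * C + (\<bar>z\<bar> + 1)" for z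
  proof -
    have "y z = f (z + m) - w x - m * (z + m)"
      by (simp add: y_def \<psi>0_def algebra_simps power2_eq_square)
    moreover have "\<bar>m * (z + m)\<bar> \<le> 1 * (\<bar>z\<bar> + 1)"
      unfolding abs_mult using m1 zm by (intro mult_mono) auto
    moreover have "\<bar>a - b - u\<bar> \<le> 2 * C + v" if "\<bar>a\<bar> \<le> C" "\<bar>b\<bar> \<le> C" "\<bar>u\<bar> \<le> 1 * v" for a b u v
      using that by (simp add: abs_le_iff)
    ultimately show ?thesis
      using bdf[of "z + m"] bd[of x] by simp
  qed
  have e1: "1 + \<bar>z\<bar> \<le> exp \<bar>z\<bar>" for z :: real
    using exp_ge_add_one_self[of "\<bar>z\<bar>"] by (simp del: exp_ge_add_one_self)
  \<comment> \<open>In exp (5 |z|) four units come from (z + m)^4, by |z + m| <= exp |z|, and one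
    from exp |y z|.\<close>
  have key: "(y z)\<^sup>2 * exp \<bar>y z\<bar> \<le> A\<^sup>2 * exp (1 + 2 * C) * s ^ 4 * exp (5 * \<bar>z\<bar>)" for z
  proof -
    have "\<bar>z + m\<bar> \<le> exp \<bar>z\<bar>"
      using zm[of z] e1[of z] by linarith
    then have "(z + m)\<^sup>2 \<le> (exp \<bar>z\<bar>)\<^sup>2"
      by (metis abs_exp_cancel abs_le_square_iff)
    then have "A * s\<^sup>2 * (z + m)\<^sup>2 \<le> A * s\<^sup>2 * (exp \<bar>z\<bar>)\<^sup>2"
      using A by (intro mult_left_mono) auto
    then have "(y z)\<^sup>2 \<le> (A * s\<^sup>2 * (exp \<bar>z\<bar>)\<^sup>2)\<^sup>2"
      using y1[of z] by (intro abs_le_square_iff[THEN iffD1]) linarith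
    moreover have "exp \<bar>y z\<bar> \<le> exp (2 * C + (\<bar>z\<bar> + 1))"
      using y2 by simp
    ultimately have "(y z)\<^sup>2 * exp \<bar>y z\<bar> \<le> (A * s\<^sup>2 * (exp \<bar>z\<bar>)\<^sup>2)\<^sup>2 * exp (2 * C + (\<bar>z\<bar> + 1))"
      by (intro mult_mono) auto
    also have "\<dots> = A\<^sup>2 * exp (1 + 2 * C) * s ^ 4 * exp (5 * \<bar>z\<bar>)"
      by (simp add: power_mult_distrib power2_eq_square power4_eq_xxxx flip: exp_add)
    finally show ?thesis .
  qed
  have iy: "integrable gauss y"
    unfolding y_def
    by (intro Bochner_Integration.integrable_diff integrable_mult_right
        integrable_gauss_bounded[where f="\<lambda>z. f (z + m)" and K=C] integrable_gauss_ident) (use bdf in auto)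
  define I where "I = (LINT z|gauss. exp (5 * \<bar>z\<bar>))"
  have "exp (f (z + m) - m * z - m\<^sup>2 / 2) = exp \<psi>0 * exp (y z)" for z
    by (simp add: y_def flip: exp_add)
  then have tilt: "integrable gauss (\<lambda>z. exp \<psi>0 * exp (y z))"
    "(LINT z|gauss. exp \<psi>0 * exp (y z)) = (LINT z|gauss. exp (f z))"
    using gauss_exp_tilt[of f C m] bdf by auto
  then have iexp: "integrable gauss (\<lambda>z. exp (y z))"
    by simp
  have pos: "(LINT z|gauss. exp (y z)) > 0"
  proof -
    have "exp (- C) \<le> (LINT z|gauss. exp (f z))"
      using bdf by (intro gauss.integral_ge_const integrable_gauss_bounded[where K="exp C"])
        (auto simp: abs_le_iff minus_le_iff)
    then have "0 < exp \<psi>0 * (LINT z|gauss. exp (y z))"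
      using tilt(2) by (simp add: less_le_trans[OF exp_gt_zero])
    then show ?thesis
      by (simp add: zero_less_mult_iff)
  qed
  have "(LINT z|gauss. exp (y z)) \<le>
      (LINT z|gauss. 1 + y z + A\<^sup>2 * exp (1 + 2 * C) * s ^ 4 * exp (5 * \<bar>z\<bar>))"
  proof (rule integral_mono[OF iexp])
    show "integrable gauss (\<lambda>z. 1 + y z + A\<^sup>2 * exp (1 + 2 * C) * s ^ 4 * exp (5 * \<bar>z\<bar>))"
      by (intro Bochner_Integration.integrable_add integrable_mult_right integrable_gauss_exp_abs iy) simp
    show "exp (y z) \<le> 1 + y z + A\<^sup>2 * exp (1 + 2 * C) * s ^ 4 * exp (5 * \<bar>z\<bar>)" for z
      using exp_second_order_bound[of "y z"] key[of z] by linarith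
  qed
  also have "\<dots> = 1 + (LINT z|gauss. y z) + A\<^sup>2 * exp (1 + 2 * C) * s ^ 4 * I"
  proof -
    have 1: "integrable gauss (\<lambda>z. 1 + y z)"
      by (intro Bochner_Integration.integrable_add iy) simp
    have 2: "integrable gauss (\<lambda>z. B * exp (5 * \<bar>z\<bar>))" for B
      by (intro integrable_mult_right integrable_gauss_exp_abs)
    have 3: "(LINT z|gauss. 1 + y z) = 1 + (LINT z|gauss. y z)"
      using iy by (subst Bochner_Integration.integral_add) simp_all
    show ?thesis
      unfolding I_def by (subst Bochner_Integration.integral_add[OF 1 2], subst 3, subst integral_mult_right_zero, rule refl)
  qed
  finally have "(LINT z|gauss. exp (y z)) - 1 \<le> (LINT z|gauss. y z) + A\<^sup>2 * exp (1 + 2 * C) * s ^ 4 * I"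
    by simp
  \<comment> \<open>Only the mean of \<open>y\<close> and the fourth-order term survive the
    logarithm; adding \<open>\<psi>0\<close> turns that mean into the shifted reward minus the cost
    of the shift.\<close>
  moreover have "ln (LINT z|gauss. exp (y z)) \<le> (LINT z|gauss. exp (y z)) - 1"
    using pos by (rule ln_le_minus_one)
  moreover have "ln (LINT z|gauss. exp (f z)) = \<psi>0 + ln (LINT z|gauss. exp (y z))"
    unfolding tilt(2)[symmetric] using pos by (simp add: ln_mult)
  moreover have "(LINT z|gauss. y z) = (LINT z|gauss. f (z + m)) - m\<^sup>2 / 2 - \<psi>0"
  proof -
    have "integrable gauss (\<lambda>z. f (z + m))"
      by (rule integrable_gauss_bounded[where K=C]) (use bdf in auto)
    then show ?thesis
      unfolding y_def using integrable_gauss_ident integral_gauss_ident by simp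
  qed
  ultimately show ?thesis
    by (simp add: f_def m_def I_def mult_ac)
qed

text \<open>Gaussian integration by parts: the derivative falls on the kernel, so the formula makes
  sense for a merely measurable \<open>f\<close>, such as a reward with jumps.\<close>

definition heat_deriv :: "real \<Rightarrow> (real \<Rightarrow> real) \<Rightarrow> real \<Rightarrow> real" where
  "heat_deriv s f x = (LINT z|gauss. f (x + s * z) * z) / s"

text \<open>One constant for both regimes of \<open>heat_taylor\<close>: the integral dominates E
  |Z| and the second-order remainder of the Cameron-Martin density, and the summand 3 covers the two
  values of the semigroup when the displacement is large.\<close>

definition taylor_const :: real where
  "taylor_const = 3 + (LINT z|gauss. exp (1 + 3 * \<bar>z\<bar>))"

lemma integrable_gauss_exp3: "integrable gauss (\<lambda>z. exp (1 + 3 * \<bar>z\<bar>))"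
  using integrable_gauss_exp_abs[of 3] by (simp add: exp_add)

lemma integrable_gauss_mult_ident:
  assumes [measurable]: "f \<in> borel_measurable borel" and bd: "\<And>z. \<bar>f z\<bar> \<le> K"
  shows "integrable gauss (\<lambda>z. f z * z)"
proof (rule Bochner_Integration.integrable_bound)
  show "integrable gauss (\<lambda>z. K * z)"
    using integrable_gauss_ident by simp
  show "AE z in gauss. norm (f z * z) \<le> norm (K * z)"
    using bd by (intro always_eventually) (auto simp: abs_mult intro!: mult_right_mono order_trans[OF bd])
qed simp

lemma heat_deriv_bound:
  assumes [measurable]: "f \<in> borel_measurable borel" and bd: "\<And>x. \<bar>f x\<bar> \<le> K" and "s > 0"
  shows "\<bar>heat_deriv s f x\<bar> \<le> K * (taylor_const - 3) / s"
proof -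
  have K: "K \<ge> 0"
    using bd[of 0] by linarith
  have "\<bar>LINT z|gauss. f (x + s * z) * z\<bar> \<le> (LINT z|gauss. K * exp (1 + 3 * \<bar>z\<bar>))"
  proof (rule integral_abs_bound_integral)
    show "integrable gauss (\<lambda>z. f (x + s * z) * z)"
      by (rule integrable_gauss_mult_ident[where K=K]) (use bd in auto)
    show "integrable gauss (\<lambda>z. K * exp (1 + 3 * \<bar>z\<bar>))"
      using integrable_gauss_exp3 by simp
    show "\<bar>f (x + s * z) * z\<bar> \<le> K * exp (1 + 3 * \<bar>z\<bar>)" for z
      unfolding abs_mult using bd exp_ge_add_one_self[of "1 + 3 * \<bar>z\<bar>"] K
      by (intro mult_mono) (auto simp del: exp_ge_add_one_self)
  qed
  also have "\<dots> = K * (taylor_const - 3)"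
    by (simp add: taylor_const_def)
  finally show ?thesis
    using \<open>s > 0\<close> by (simp add: heat_deriv_def divide_right_mono)
qed

text \<open>The displacement is moved from the argument of \<open>f\<close> to the Cameron-Martin
  density with shift \<delta> = (y - x) / s, and the density, not \<open>f\<close>, is expanded to
  second order. For |\<delta>| > 1 crude bounds suffice, since then 1 and |\<delta>| are at most
  \<delta>^2.\<close>

lemma heat_taylor:
  assumes [measurable]: "f \<in> borel_measurable borel" and bd: "\<And>x. \<bar>f x\<bar> \<le> K" and s: "s > 0"
  shows "\<bar>heat s f y - heat s f x - heat_deriv s f x * (y - x)\<bar> \<le> K * taylor_const / s\<^sup>2 * (y - x)\<^sup>2"
proof -
  define \<delta> where "\<delta> = (y - x) / s"
  have y: "y = x + s * \<delta>"
    using s by (simp add: \<delta>_def)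
  have K: "K \<ge> 0"
    using bd[of 0] by linarith
  define I where "I = (LINT z|gauss. exp (1 + 3 * \<bar>z\<bar>))"
  have I: "I \<ge> 0"
    unfolding I_def by simp
  have D: "heat_deriv s f x * (y - x) = \<delta> * (LINT z|gauss. f (x + s * z) * z)"
    using s by (simp add: heat_deriv_def \<delta>_def)
  have "\<bar>heat s f y - heat s f x - heat_deriv s f x * (y - x)\<bar> \<le> K * taylor_const * \<delta>\<^sup>2"
  proof (cases "\<bar>\<delta>\<bar> \<le> 1")
    case False
    have "\<bar>heat s f y\<bar> \<le> K" "\<bar>heat s f x\<bar> \<le> K"
      using heat_bounds[of f "-K" K s] bd by (auto simp: abs_le_iff minus_le_iff)
    moreover have "\<bar>heat_deriv s f x * (y - x)\<bar> \<le> K * (taylor_const - 3) / s * \<bar>y - x\<bar>"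
      unfolding abs_mult using heat_deriv_bound[of f K s x] bd s by (intro mult_right_mono) auto
    moreover have "K * (taylor_const - 3) / s * \<bar>y - x\<bar> = K * I * \<bar>\<delta>\<bar>"
      using s by (simp add: \<delta>_def taylor_const_def I_def)
    ultimately have "\<bar>heat s f y - heat s f x - heat_deriv s f x * (y - x)\<bar> \<le> 2 * K * 1 + K * I * \<bar>\<delta>\<bar>"
      by (simp add: abs_le_iff)
    also have "\<dots> \<le> 2 * K * \<delta>\<^sup>2 + K * I * \<delta>\<^sup>2"
    proof (intro add_mono mult_left_mono)
      show "1 \<le> \<delta>\<^sup>2" "\<bar>\<delta>\<bar> \<le> \<delta>\<^sup>2"
        using False mult_mono[of 1 "\<bar>\<delta>\<bar>" 1 "\<bar>\<delta>\<bar>"] mult_right_mono[of 1 "\<bar>\<delta>\<bar>" "\<bar>\<delta>\<bar>"]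
        by (simp_all add: power2_eq_square)
    qed (use K I in auto)
    also have "\<dots> \<le> K * taylor_const * \<delta>\<^sup>2"
      using K by (simp add: taylor_const_def I_def algebra_simps)
    finally show ?thesis .
  next
    case True
    have "heat s f y = (LINT z|gauss. f (x + s * (z + \<delta>)))"
      unfolding heat_def y by (simp add: distrib_left add.assoc add.left_commute add.commute)
    moreover have "integrable gauss (\<lambda>z. f (x + s * (z + \<delta>)))"
      by (rule integrable_gauss_bounded[where K=K]) (use bd in auto)
    ultimately have sh: "heat s f y = (LINT z|gauss. exp (\<delta> * z - \<delta>\<^sup>2 / 2) * f (x + s * z))"
      and shi: "integrable gauss (\<lambda>z. exp (\<delta> * z - \<delta>\<^sup>2 / 2) * f (x + s * z))"
      using integrable_gauss_shift_iff[of "\<lambda>z. f (x + s * z)" \<delta>] by simp_all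
    have i1: "integrable gauss (\<lambda>z. f (x + s * z))"
      by (rule integrable_gauss_bounded[where K=K]) (use bd in auto)
    have i2: "integrable gauss (\<lambda>z. f (x + s * z) * z)"
      by (rule integrable_gauss_mult_ident[where K=K]) (use bd in auto)
    have eq: "heat s f y - heat s f x - heat_deriv s f x * (y - x) =
      (LINT z|gauss. exp (\<delta> * z - \<delta>\<^sup>2 / 2) * f (x + s * z) - f (x + s * z) - \<delta> * (f (x + s * z) * z))"
      unfolding D unfolding sh unfolding heat_def using shi i1 i2 by simp
    have "\<bar>heat s f y - heat s f x - heat_deriv s f x * (y - x)\<bar> \<le> (LINT z|gauss. K * \<delta>\<^sup>2 * (1 + exp (1 + 3 * \<bar>z\<bar>)))"
      unfolding eq
    proof (rule integral_abs_bound_integral)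
      fix z
      let ?q = "\<delta> * z - \<delta>\<^sup>2 / 2"
      have d2: "\<delta>\<^sup>2 \<le> \<bar>\<delta>\<bar>"
        using True by (metis abs_ge_zero mult_left_le power2_abs power2_eq_square)
      have "\<bar>?q\<bar> \<le> \<bar>\<delta>\<bar> * \<bar>z\<bar> + \<delta>\<^sup>2 / 2"
        by (metis abs_mult abs_of_nonneg abs_triangle_ineq4 divide_nonneg_nonneg zero_le_numeral zero_le_power2)
      also have "\<dots> \<le> \<bar>\<delta>\<bar> * (1 + \<bar>z\<bar>)"
        using d2 by (simp add: algebra_simps)
      finally have q1: "\<bar>?q\<bar> \<le> \<bar>\<delta>\<bar> * (1 + \<bar>z\<bar>)" .
      also have "\<dots> \<le> 1 * (1 + \<bar>z\<bar>)"
        using True by (intro mult_right_mono) auto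
      finally have q2: "\<bar>?q\<bar> \<le> 1 + \<bar>z\<bar>" by simp
      have e: "1 + \<bar>z\<bar> \<le> exp \<bar>z\<bar>"
        using exp_ge_add_one_self[of "\<bar>z\<bar>"] by (simp del: exp_ge_add_one_self)
      have "\<bar>\<delta>\<bar> * (1 + \<bar>z\<bar>) \<le> \<bar>\<delta>\<bar> * exp \<bar>z\<bar>"
        using e by (intro mult_left_mono) auto
      with q1 have "?q\<^sup>2 \<le> (\<bar>\<delta>\<bar> * exp \<bar>z\<bar>)\<^sup>2"
        by (intro abs_le_square_iff[THEN iffD1]) (simp add: abs_mult)
      then have "?q\<^sup>2 * exp \<bar>?q\<bar> \<le> (\<bar>\<delta>\<bar> * exp \<bar>z\<bar>)\<^sup>2 * exp (1 + \<bar>z\<bar>)"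
        using q2 by (intro mult_mono) auto
      also have "\<dots> = \<delta>\<^sup>2 * exp (1 + 3 * \<bar>z\<bar>)"
        by (simp add: power_mult_distrib power2_eq_square[of "exp _"] algebra_simps flip: exp_add)
      finally have "\<bar>exp ?q - 1 - ?q\<bar> \<le> \<delta>\<^sup>2 * exp (1 + 3 * \<bar>z\<bar>)"
        using exp_second_order_bound[of ?q] by linarith
      have "\<bar>exp ?q - 1 - \<delta> * z\<bar> \<le> \<delta>\<^sup>2 * (1 + exp (1 + 3 * \<bar>z\<bar>))"
      proof -
        have "\<bar>e - 1 - u\<bar> \<le> v * (1 + w)" if "\<bar>e - 1 - (u - v / 2)\<bar> \<le> v * w" "0 \<le> v" for e u v w :: real
          using that by (simp add: abs_le_iff distrib_left)
        then show ?thesis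
          using \<open>\<bar>exp ?q - 1 - ?q\<bar> \<le> \<delta>\<^sup>2 * exp (1 + 3 * \<bar>z\<bar>)\<close> zero_le_power2 by blast
      qed
      then have "\<bar>f (x + s * z)\<bar> * \<bar>exp ?q - 1 - \<delta> * z\<bar> \<le> K * (\<delta>\<^sup>2 * (1 + exp (1 + 3 * \<bar>z\<bar>)))"
        using bd K by (intro mult_mono) auto
      then show "\<bar>exp ?q * f (x + s * z) - f (x + s * z) - \<delta> * (f (x + s * z) * z)\<bar>
          \<le> K * \<delta>\<^sup>2 * (1 + exp (1 + 3 * \<bar>z\<bar>))"
        unfolding abs_mult[symmetric] by (simp add: algebra_simps)
    next
      show "integrable gauss (\<lambda>z. K * \<delta>\<^sup>2 * (1 + exp (1 + 3 * \<bar>z\<bar>)))"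
        by (intro integrable_mult_right Bochner_Integration.integrable_add integrable_gauss_exp3) simp
    qed (use shi i1 i2 in simp)
    also have "\<dots> = K * \<delta>\<^sup>2 * (1 + I)"
      unfolding I_def using integrable_gauss_exp3 by simp
    also have "\<dots> \<le> K * taylor_const * \<delta>\<^sup>2"
      unfolding taylor_const_def I_def[symmetric] using K I by (simp add: mult_left_mono mult.assoc mult.commute[of _ "\<delta>\<^sup>2"])
    finally show ?thesis .
  qed
  then show ?thesis
    by (simp add: \<delta>_def power_divide)
qed

text \<open>A monotone function has countably many jumps, and an injective affine map pulls them
  back to a null set.\<close>

lemma AE_isCont_affine:
  fixes f :: "real \<Rightarrow> real"
  assumes "mono f" and "s \<noteq> 0"
  shows "AE z in gauss. isCont f (x + s * z)"
proof -
  have "countable ((\<lambda>y. (y - x) / s) ` {a. \<not> isCont f a})"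
    using mono_ctble_discont[OF assms(1)] by (rule countable_image)
  moreover have "{z. \<not> isCont f (x + s * z)} \<subseteq> (\<lambda>y. (y - x) / s) ` {a. \<not> isCont f a}"
    using assms(2) by (auto intro!: image_eqI[where x="x + s * _"])
  ultimately have "countable {z. \<not> isCont f (x + s * z)}"
    using countable_subset by blast
  then have "AE z in lborel. z \<notin> {z. \<not> isCont f (x + s * z)}"
    by (intro AE_not_in countable_imp_null_set_lborel)
  then have "AE z in lborel. isCont f (x + s * z)"
    by simp
  then show ?thesis
    by (subst AE_density) auto
qed

text \<open>Dominated convergence, with continuity at almost every point in place of continuity. The
  weight p = 1 gives the semigroup and p = z its derivative.\<close>

lemma heat_weighted_tendsto:
  fixes f p :: "real \<Rightarrow> real"
  assumes f: "mono f" and bd: "\<And>x. \<bar>f x\<bar> \<le> K" and p: "integrable gauss p"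
    and s: "s \<noteq> 0" and lim: "S \<longlonglongrightarrow> s" "X \<longlonglongrightarrow> x"
  shows "(\<lambda>n. LINT z|gauss. f (X n + S n * z) * p z) \<longlonglongrightarrow> (LINT z|gauss. f (x + s * z) * p z)"
proof (rule integral_dominated_convergence)
  have [measurable]: "f \<in> borel_measurable borel"
    using f by (rule borel_measurable_mono)
  have [measurable]: "p \<in> borel_measurable borel"
    using borel_measurable_integrable[OF p] by simp
  show "(\<lambda>z. f (x + s * z) * p z) \<in> borel_measurable gauss"
    "\<And>n. (\<lambda>z. f (X n + S n * z) * p z) \<in> borel_measurable gauss"
    by simp_all
  show "integrable gauss (\<lambda>z. K * norm (p z))"
    using p by simp
  show "AE z in gauss. (\<lambda>n. f (X n + S n * z) * p z) \<longlonglongrightarrow> f (x + s * z) * p z"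
    using AE_isCont_affine[OF f s, of x]
  proof eventually_elim
    case (elim z)
    have "(\<lambda>n. X n + S n * z) \<longlonglongrightarrow> x + s * z"
      using lim by (intro tendsto_intros)
    then show ?case
      by (intro tendsto_mult[OF isCont_tendsto_compose[OF elim]] tendsto_const)
  qed
  show "\<And>n. AE z in gauss. norm (f (X n + S n * z) * p z) \<le> K * norm (p z)"
    using bd by (intro always_eventually) (auto simp: abs_mult intro!: mult_right_mono)
qed

section \<open>Derivatives from quadratic bounds, and a quantitative logarithm\<close>

lemma DERIV_of_quadratic_bound:
  fixes f :: "real \<Rightarrow> real"
  assumes "\<And>y. \<bar>f y - f x - d * (y - x)\<bar> \<le> A * (y - x)\<^sup>2"
  shows "(f has_field_derivative d) (at x)"
  unfolding has_field_derivative_iff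
proof (rule Lim_transform_bound[of "\<lambda>y. (f y - f x) / (y - x) - d" "\<lambda>y. A * (y - x)", THEN LIM_zero_cancel])
  show "\<forall>\<^sub>F y in at x. norm ((f y - f x) / (y - x) - d) \<le> norm (A * (y - x))"
  proof (rule eventually_mono[OF eventually_neq_at_within[of x]])
    fix y assume n: "y \<noteq> x"
    then have "\<bar>(f y - f x) / (y - x) - d\<bar> = \<bar>f y - f x - d * (y - x)\<bar> / \<bar>y - x\<bar>"
      by (simp add: abs_divide[symmetric] diff_divide_distrib)
    also have "\<dots> \<le> A * (y - x)\<^sup>2 / \<bar>y - x\<bar>"
      using assms by (intro divide_right_mono) auto
    also have "\<dots> = A * \<bar>y - x\<bar>"
      using n by (simp add: power2_eq_square abs_mult_self_eq[symmetric, of "y - x"] del: abs_mult_self_eq)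
    also have "\<dots> \<le> \<bar>A * (y - x)\<bar>"
      by (simp add: abs_mult mult_right_mono)
    finally show "norm ((f y - f x) / (y - x) - d) \<le> norm (A * (y - x))"
      by simp
  qed
  show "((\<lambda>y. A * (y - x)) \<longlongrightarrow> 0) (at x)"
    by (rule tendsto_eq_intros refl | simp)+
qed

text \<open>Adding the expansions at x and at y cancels the function values and leaves (d y - d x)
  (y - x). The gradient is thus Lipschitz without any second derivative being formed.\<close>

lemma Lipschitz_deriv_of_quadratic_bound:
  fixes f :: "real \<Rightarrow> real"
  assumes "\<And>x y. \<bar>f y - f x - d x * (y - x)\<bar> \<le> A * (y - x)\<^sup>2"
  shows "\<bar>d y - d x\<bar> \<le> 2 * A * \<bar>y - x\<bar>"
proof (cases "x = y")
  case False
  have "\<bar>d y - d x\<bar> * \<bar>y - x\<bar> = \<bar>(f y - f x - d x * (y - x)) + (f x - f y - d y * (x - y))\<bar>"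
    unfolding abs_mult[symmetric] by (simp add: algebra_simps)
  also have "\<dots> \<le> A * (y - x)\<^sup>2 + A * (x - y)\<^sup>2"
    using assms[where x=x and y=y] assms[where x=y and y=x] by linarith
  also have "\<dots> = 2 * A * \<bar>y - x\<bar> * \<bar>y - x\<bar>"
    by (simp add: power2_eq_square mult.assoc) (simp add: algebra_simps)
  finally show ?thesis
    using False by simp
qed simp

text \<open>With r = (v - u) / u, ln (1 + r) lies between r / (1 + r) and r, whose distance is r^2 /
  (1 + r); the lower bound \<open>l\<close> for 1 + r = v / u controls the denominator.\<close>

lemma ln_Taylor_bound:
  fixes u v l :: real
  assumes "0 < l" "l \<le> v / u" "0 < u" "l \<le> 1"
  shows "\<bar>ln v - ln u - (v - u) / u\<bar> \<le> ((v - u) / u)\<^sup>2 / l"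
proof -
  define r where "r = (v - u) / u"
  have r: "1 + r = v / u"
    using assms by (simp add: r_def field_simps)
  have r0: "1 + r > 0"
    using r assms by linarith
  have ln: "ln v - ln u = ln (1 + r)"
    unfolding r using assms r0 r by (subst ln_div) (auto simp: zero_less_divide_iff)
  have "ln (1 + r) \<le> r"
    using ln_add_one_self_le_self2[of r] r0 by simp
  moreover have "r / (1 + r) \<le> ln (1 + r)"
    using ln_le_minus_one[of "1 / (1 + r)"] r0 by (simp add: ln_div field_simps)
  moreover have "r - r / (1 + r) = r\<^sup>2 / (1 + r)"
    using r0 by (simp add: field_simps power2_eq_square)
  moreover have "r\<^sup>2 / (1 + r) \<le> r\<^sup>2 / l"
    using assms r by (intro divide_left_mono mult_pos_pos) auto
  ultimately have "\<bar>ln (1 + r) - r\<bar> \<le> r\<^sup>2 / l"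
    by linarith
  then show ?thesis
    unfolding ln r_def .
qed

section \<open>The Cole--Hopf transform of a monotone reward\<close>

text \<open>No probability space occurs here, so the drift \<open>b\<close> and its bounds are
  shared by the space that carries the fixed point and by every space on which the game is
  played.\<close>

locale monotone_reward =
  fixes T c \<sigma> C :: real and g :: "real \<Rightarrow> real"
  assumes T: "T > 0" and c: "c > 0" and \<sigma>: "\<sigma> > 0"
    and g_mono: "mono g" and g_right: "\<And>x. continuous (at_right x) g"
    and g_bound: "\<And>x. \<bar>g x\<bar> \<le> C"
begin

definition \<kappa> :: real where "\<kappa> = 2 * c * \<sigma>\<^sup>2"
definition G :: "real \<Rightarrow> real" where "G x = exp (g x / \<kappa>)"
definition bd :: real where "bd = exp (C / \<kappa>)"
definition U :: "real \<Rightarrow> real \<Rightarrow> real" where "U t x = heat (\<sigma> * sqrt (T - t)) G x"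
definition V :: "real \<Rightarrow> real \<Rightarrow> real" where "V t x = \<kappa> * ln (U t x)"
text \<open>This is v_x / (2 c): differentiating v = \<kappa> ln u gives \<sigma>^2 u_x / u. The
  value 0 from T on matches the convention of \<open>mfg_drift\<close>.\<close>

definition b :: "real \<Rightarrow> real \<Rightarrow> real" where
  "b t x = (if t < T then \<sigma>\<^sup>2 * (heat_deriv (\<sigma> * sqrt (T - t)) G x / U t x) else 0)"

lemma \<kappa>: "\<kappa> > 0"
  using c \<sigma> by (simp add: \<kappa>_def)

lemma C: "C \<ge> 0"
  using g_bound[of 0] by linarith

lemma bd: "bd \<ge> 1"
  using C \<kappa> by (simp add: bd_def)

lemma g_measurable [measurable]: "g \<in> borel_measurable borel"
  using g_mono by (rule borel_measurable_mono)

lemma G_measurable [measurable]: "G \<in> borel_measurable borel"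
  unfolding G_def[abs_def] by measurable

lemma G_mono: "mono G"
  using g_mono \<kappa> by (auto simp: mono_def G_def divide_right_mono)

lemma G_bounds: "1 / bd \<le> G x" "G x \<le> bd"
proof -
  have "- (C / \<kappa>) \<le> g x / \<kappa>" "g x / \<kappa> \<le> C / \<kappa>"
    using g_bound[of x] \<kappa> by (auto simp: abs_le_iff divide_right_mono simp flip: minus_divide_left
        intro!: divide_right_mono[of "-C", simplified])
  then show "1 / bd \<le> G x" "G x \<le> bd"
    by (auto simp: bd_def G_def exp_minus[symmetric] inverse_eq_divide[symmetric])
qed

lemma G_abs: "\<bar>G x\<bar> \<le> bd"
  using G_bounds[of x] by (simp add: G_def)

lemma U_bounds: "1 / bd \<le> U t x" "U t x \<le> bd"
  unfolding U_def using heat_bounds[of G "1 / bd" bd] G_bounds by auto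

lemma U_pos: "U t x > 0"
  using U_bounds[of t x] bd by (smt (verit) divide_pos_pos)

lemma U_measurable [measurable]: "U t \<in> borel_measurable borel"
  unfolding U_def[abs_def] by measurable

lemma V_measurable [measurable]: "V t \<in> borel_measurable borel"
  unfolding V_def[abs_def] by measurable

lemma V_exp: "exp (V t x / \<kappa>) = U t x"
  using \<kappa> U_pos by (simp add: V_def)

lemma V_bound: "\<bar>V t x\<bar> \<le> C"
proof -
  have "ln (1 / bd) \<le> ln (U t x)" "ln (U t x) \<le> ln bd"
    using U_bounds[of t x] U_pos[of t x] bd by (auto intro!: ln_mono)
  then have "- (C / \<kappa>) \<le> ln (U t x)" "ln (U t x) \<le> C / \<kappa>"
    by (auto simp: bd_def ln_div)
  then show ?thesis
    using \<kappa> unfolding V_def by (auto simp: abs_le_iff field_simps)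
qed

lemma V_T: "V T x = g x"
  using \<kappa> by (simp add: V_def U_def G_def)

lemma U_semigroup:
  assumes "t \<le> t'" "t' \<le> T"
  shows "U t x = heat (\<sigma> * sqrt (t' - t)) (U t') x"
proof -
  have "(\<sigma> * sqrt (t' - t))\<^sup>2 + (\<sigma> * sqrt (T - t'))\<^sup>2 = (\<sigma> * sqrt (T - t))\<^sup>2"
    using assms by (simp add: power_mult_distrib algebra_simps)
  then have "sqrt ((\<sigma> * sqrt (t' - t))\<^sup>2 + (\<sigma> * sqrt (T - t'))\<^sup>2) = \<sigma> * sqrt (T - t)"
    using \<sigma> assms by simp
  then show ?thesis
    unfolding U_def using heat_heat[of G bd "\<sigma> * sqrt (t' - t)" "\<sigma> * sqrt (T - t')" x] G_abs \<sigma> assms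
    by (simp add: U_def[abs_def])
qed

text \<open>Dynamic programming after the Cole-Hopf transform: the right-hand side is the
  log-exponential mean to which the one-step variational inequalities apply.\<close>

lemma V_semigroup:
  assumes "t \<le> t'" "t' \<le> T"
  shows "V t x = \<kappa> * ln (LINT z|gauss. exp (V t' (x + \<sigma> * sqrt (t' - t) * z) / \<kappa>))"
  unfolding V_exp using U_semigroup[OF assms, of x] by (simp add: V_def heat_def)

definition drift_const :: real where "drift_const = \<sigma> * bd\<^sup>2 * taylor_const"

text \<open>The first summand is the second-order error of U divided by U. The second comes from the
  logarithm: bd^4 from the squared relative increment of U and bd^2 from the lower bound 1 / bd^2
  for the ratio of two values of U.\<close>

definition curv :: "real \<Rightarrow> real" where
  "curv t = (bd\<^sup>2 * taylor_const + bd ^ 6 * taylor_const\<^sup>2) / (\<sigma>\<^sup>2 * (T - t))"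

lemma taylor_const: "taylor_const \<ge> 3"
  by (simp add: taylor_const_def)

lemma drift_const: "drift_const > 0"
  using \<sigma> bd taylor_const by (simp add: drift_const_def)

lemma curv_nonneg: "t < T \<Longrightarrow> curv t \<ge> 0"
  using bd taylor_const by (simp add: curv_def)

lemma curv_mono: "t \<le> t' \<Longrightarrow> t' < T \<Longrightarrow> curv t \<le> curv t'"
  unfolding curv_def using bd taylor_const \<sigma>
  by (intro divide_left_mono mult_left_mono mult_pos_pos add_nonneg_nonneg) auto

section \<open>Regularity in space at a fixed time before T\<close>

context
  fixes t assumes t: "t < T"
begin

lemma sd_pos: "\<sigma> * sqrt (T - t) > 0"
  using \<sigma> t by simp

lemma U_Taylor:
  "\<bar>U t y - U t x - heat_deriv (\<sigma> * sqrt (T - t)) G x * (y - x)\<bar>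
    \<le> bd * taylor_const / (\<sigma> * sqrt (T - t))\<^sup>2 * (y - x)\<^sup>2"
  unfolding U_def by (rule heat_taylor[OF _ G_abs sd_pos]) measurable

lemma heat_deriv_G_bound:
  "\<bar>heat_deriv (\<sigma> * sqrt (T - t)) G x\<bar> \<le> bd * taylor_const / (\<sigma> * sqrt (T - t))"
proof -
  have "\<bar>heat_deriv (\<sigma> * sqrt (T - t)) G x\<bar> \<le> bd * (taylor_const - 3) / (\<sigma> * sqrt (T - t))"
    by (rule heat_deriv_bound[OF _ G_abs sd_pos]) measurable
  also have "\<dots> \<le> bd * taylor_const / (\<sigma> * sqrt (T - t))"
    using bd sd_pos by (intro divide_right_mono mult_left_mono) auto
  finally show ?thesis .
qed

lemma U_DERIV: "(U t has_field_derivative heat_deriv (\<sigma> * sqrt (T - t)) G x) (at x)"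
  by (rule DERIV_of_quadratic_bound[OF U_Taylor])

lemma U_Lipschitz: "\<bar>U t y - U t x\<bar> \<le> bd * taylor_const / (\<sigma> * sqrt (T - t)) * \<bar>y - x\<bar>"
proof -
  have "norm (U t y - U t x) \<le> bd * taylor_const / (\<sigma> * sqrt (T - t)) * norm (y - x)"
    by (rule field_differentiable_bound[where S=UNIV and f'="heat_deriv (\<sigma> * sqrt (T - t)) G"])
      (auto intro!: U_DERIV heat_deriv_G_bound)
  then show ?thesis
    by simp
qed

lemma inverse_U: "1 / U t x \<le> bd"
  using U_bounds(1)[of t x] U_pos[of t x] bd by (simp add: field_simps)

text \<open>Supplies the expansion required by \<open>gauss_variational_gap\<close>, with w = V t /
  \<kappa> and d = b t x / \<sigma>^2. The derivative of V and the Lipschitz bound for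
  \<open>b\<close> are read off from the same inequality.\<close>

lemma V_Taylor: "\<bar>V t y / \<kappa> - V t x / \<kappa> - b t x / \<sigma>\<^sup>2 * (y - x)\<bar> \<le> curv t * (y - x)\<^sup>2"
proof -
  let ?s = "\<sigma> * sqrt (T - t)" and ?D = "heat_deriv (\<sigma> * sqrt (T - t)) G x"
  have bd0: "bd > 0" using bd by linarith
  have l: "1 / bd\<^sup>2 \<le> U t y / U t x"
  proof -
    have "1 / bd * (1 / bd) \<le> U t y * (1 / U t x)"
      using U_bounds[of t] U_pos[of t x] U_pos[of t y] bd0
      by (intro mult_mono) (auto intro!: divide_left_mono)
    then show ?thesis
      by (simp add: power2_eq_square)
  qed
  have "\<bar>ln (U t y) - ln (U t x) - (U t y - U t x) / U t x\<bar> \<le> ((U t y - U t x) / U t x)\<^sup>2 / (1 / bd\<^sup>2)"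
    using l U_pos bd by (intro ln_Taylor_bound) (auto simp: one_le_power)
  also have "\<dots> \<le> (bd * taylor_const / ?s * \<bar>y - x\<bar> * bd)\<^sup>2 / (1 / bd\<^sup>2)"
  proof (intro divide_right_mono power2_le_iff_abs_le[THEN iffD2])
    have "\<bar>U t y - U t x\<bar> * (1 / U t x) \<le> bd * taylor_const / ?s * \<bar>y - x\<bar> * bd"
      using U_Lipschitz[of y x] inverse_U[of x] U_pos[of t x] by (intro mult_mono) auto
    then show "\<bar>(U t y - U t x) / U t x\<bar> \<le> bd * taylor_const / ?s * \<bar>y - x\<bar> * bd"
      using U_pos[of t x] by (simp add: abs_divide)
    show "0 \<le> bd * taylor_const / ?s * \<bar>y - x\<bar> * bd"
      using bd0 taylor_const sd_pos by simp
  qed simp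
  finally have 1: "\<bar>ln (U t y) - ln (U t x) - (U t y - U t x) / U t x\<bar>
      \<le> bd ^ 6 * taylor_const\<^sup>2 / ?s\<^sup>2 * (y - x)\<^sup>2"
    by (simp add: power_mult_distrib power_divide mult_ac flip: power_add)
  have "\<bar>U t y - U t x - ?D * (y - x)\<bar> * (1 / U t x) \<le> (bd * taylor_const / ?s\<^sup>2 * (y - x)\<^sup>2) * bd"
    using U_Taylor[of y x] inverse_U[of x] U_pos[of t x] by (intro mult_mono) auto
  then have "\<bar>(U t y - U t x - ?D * (y - x)) / U t x\<bar> \<le> bd\<^sup>2 * taylor_const / ?s\<^sup>2 * (y - x)\<^sup>2"
    using U_pos[of t x] by (simp add: abs_divide power2_eq_square[of bd] mult_ac)
  moreover have "(U t y - U t x - ?D * (y - x)) / U t x = (U t y - U t x) / U t x - ?D / U t x * (y - x)"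
    by (simp add: diff_divide_distrib)
  ultimately have "\<bar>ln (U t y) - ln (U t x) - ?D / U t x * (y - x)\<bar> \<le>
      bd ^ 6 * taylor_const\<^sup>2 / ?s\<^sup>2 * (y - x)\<^sup>2 + bd\<^sup>2 * taylor_const / ?s\<^sup>2 * (y - x)\<^sup>2"
    using 1 by linarith
  also have "\<dots> = curv t * (y - x)\<^sup>2"
    using t by (simp add: curv_def power_mult_distrib add_divide_distrib distrib_right add.commute)
  finally show ?thesis
    using \<kappa> \<sigma> t by (simp add: V_def b_def)
qed

lemma V_DERIV: "(V t has_field_derivative 2 * c * b t x) (at x)"
proof -
  have "((\<lambda>x. V t x / \<kappa>) has_field_derivative b t x / \<sigma>\<^sup>2) (at x)"
    by (rule DERIV_of_quadratic_bound[OF V_Taylor])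
  then have "((\<lambda>x. \<kappa> * (V t x / \<kappa>)) has_field_derivative \<kappa> * (b t x / \<sigma>\<^sup>2)) (at x)"
    by (rule DERIV_cmult)
  moreover have "\<kappa> * (V t x / \<kappa>) = V t x" for x
    using \<kappa> by simp
  moreover have "\<kappa> * (b t x / \<sigma>\<^sup>2) = 2 * c * b t x"
    using \<sigma> by (simp add: \<kappa>_def)
  ultimately show ?thesis
    by simp
qed

lemma b_Lipschitz: "\<bar>b t y - b t x\<bar> \<le> 2 * \<sigma>\<^sup>2 * curv t * \<bar>y - x\<bar>"
proof -
  have "\<bar>b t y / \<sigma>\<^sup>2 - b t x / \<sigma>\<^sup>2\<bar> \<le> 2 * curv t * \<bar>y - x\<bar>"
    by (rule Lipschitz_deriv_of_quadratic_bound[OF V_Taylor])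
  moreover have "\<bar>b t y / \<sigma>\<^sup>2 - b t x / \<sigma>\<^sup>2\<bar> = \<bar>b t y - b t x\<bar> / \<sigma>\<^sup>2"
    by (simp flip: diff_divide_distrib)
  ultimately show ?thesis
    using \<sigma> by (simp add: field_simps)
qed

lemma b_bound: "\<bar>b t x\<bar> \<le> drift_const / sqrt (T - t)"
proof -
  have "\<bar>heat_deriv (\<sigma> * sqrt (T - t)) G x\<bar> * (1 / U t x) \<le> bd * taylor_const / (\<sigma> * sqrt (T - t)) * bd"
    using heat_deriv_G_bound inverse_U[of x] U_pos[of t x] bd taylor_const sd_pos by (intro mult_mono) auto
  then have "\<sigma>\<^sup>2 * (\<bar>heat_deriv (\<sigma> * sqrt (T - t)) G x\<bar> * (1 / U t x))
      \<le> \<sigma>\<^sup>2 * (bd * taylor_const / (\<sigma> * sqrt (T - t)) * bd)"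
    by (intro mult_left_mono) auto
  also have "\<dots> = drift_const / sqrt (T - t)"
    using \<sigma> by (simp add: drift_const_def power2_eq_square)
  finally show ?thesis
    using t U_pos[of t x] by (simp add: b_def abs_mult abs_divide)
qed

lemma V_Lipschitz: "\<bar>V t y - V t x\<bar> \<le> 2 * c * drift_const / sqrt (T - t) * \<bar>y - x\<bar>"
proof -
  have "norm (V t y - V t x) \<le> 2 * c * drift_const / sqrt (T - t) * norm (y - x)"
  proof (rule field_differentiable_bound[where S=UNIV and f'="\<lambda>x. 2 * c * b t x"])
    show "norm (2 * c * b t z) \<le> 2 * c * drift_const / sqrt (T - t)" for z
      using mult_left_mono[OF b_bound[of z], of "2 * c"] c by (simp add: abs_mult)
  qed (auto intro!: V_DERIV)
  then show ?thesis
    by simp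
qed

end

text \<open>The weights 1 and z in \<open>heat_weighted_tendsto\<close> treat the denominator and
  the numerator. The jumps of \<open>G\<close> are smoothed out as long as the standard deviation is
  positive, that is, for t < T.\<close>

lemma b_sequentially:
  assumes "t < T" "tn \<longlonglongrightarrow> t" "xn \<longlonglongrightarrow> x"
  shows "(\<lambda>n. b (tn n) (xn n)) \<longlonglongrightarrow> b t x"
proof -
  let ?s = "\<lambda>t. \<sigma> * sqrt (T - t)"
  have s: "(\<lambda>n. ?s (tn n)) \<longlonglongrightarrow> ?s t"
    using assms by (intro tendsto_intros)
  have s0: "?s t \<noteq> 0"
    using sd_pos[OF assms(1)] by linarith
  have "(\<lambda>n. U (tn n) (xn n)) \<longlonglongrightarrow> U t x"
    using heat_weighted_tendsto[OF G_mono G_abs _ s0 s assms(3), of "\<lambda>_. 1"]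
    by (simp add: U_def heat_def)
  moreover have "(\<lambda>n. heat_deriv (?s (tn n)) G (xn n)) \<longlonglongrightarrow> heat_deriv (?s t) G x"
    unfolding heat_deriv_def
    using heat_weighted_tendsto[OF G_mono G_abs integrable_gauss_ident s0 s assms(3)] s s0
    by (intro tendsto_divide) auto
  ultimately have "(\<lambda>n. \<sigma>\<^sup>2 * (heat_deriv (?s (tn n)) G (xn n) / U (tn n) (xn n)))
      \<longlonglongrightarrow> \<sigma>\<^sup>2 * (heat_deriv (?s t) G x / U t x)"
    using U_pos[of t x] by (intro tendsto_intros) auto
  then have "(\<lambda>n. \<sigma>\<^sup>2 * (heat_deriv (?s (tn n)) G (xn n) / U (tn n) (xn n))) \<longlonglongrightarrow> b t x"
    using assms(1) by (simp add: b_def)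
  moreover have "\<forall>\<^sub>F n in sequentially. tn n < T"
    by (rule order_tendstoD(2)[OF assms(2,1)])
  ultimately show ?thesis
    by (elim Lim_transform_eventually) (auto simp: b_def elim: eventually_mono)
qed

lemma b_continuous: "continuous_on ({..<T} \<times> UNIV) (\<lambda>(t, x). b t x)"
  unfolding continuous_on_sequentially
proof (intro allI ballI impI)
  fix p and a :: "real \<times> real"
  assume *: "a \<in> {..<T} \<times> UNIV" and "(\<forall>n. p n \<in> {..<T} \<times> UNIV) \<and> p \<longlonglongrightarrow> a"
  then have "(\<lambda>n. fst (p n)) \<longlonglongrightarrow> fst a" "(\<lambda>n. snd (p n)) \<longlonglongrightarrow> snd a"
    by (auto intro!: tendsto_intros)
  then show "((\<lambda>(t, x). b t x) \<circ> p) \<longlonglongrightarrow> (case a of (t, x) \<Rightarrow> b t x)"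
    using b_sequentially[of "fst a" "\<lambda>n. fst (p n)" "\<lambda>n. snd (p n)" "snd a"] *
    by (auto simp: comp_def case_prod_beta)
qed

lemma b_measurable2: "(\<lambda>(t, x). b t x) \<in> borel_measurable borel"
proof -
  have "(\<lambda>p. if p \<in> {..<T} \<times> UNIV then (\<lambda>(t, x). b t x) p else 0) \<in> borel_measurable borel"
    using b_continuous by (intro borel_measurable_continuous_on_if) (auto intro!: borel_open open_Times)
  also have "(\<lambda>p. if p \<in> {..<T} \<times> UNIV then (\<lambda>(t, x). b t x) p else 0) = (\<lambda>(t, x). b t x)"
    by (auto simp: b_def fun_eq_iff)
  finally show ?thesis .
qed

lemma b_measurable [measurable (raw)]:
  assumes "f \<in> borel_measurable M" "h \<in> borel_measurable M"
  shows "(\<lambda>w. b (f w) (h w)) \<in> borel_measurable M"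
  using measurable_compose[OF borel_measurable_Pair[OF assms] b_measurable2] by simp

text \<open>Here \<open>d\<close> is the displacement by the constant control d / (t' - t), whose
  cost over the step is c d^2 / (t' - t). In units of the standard deviation the shift is m = d / s,
  and \<kappa> m^2 / 2 is that cost.\<close>

lemma V_step_upper:
  assumes "t < t'" "t' \<le> T"
  shows "heat (\<sigma> * sqrt (t' - t)) (V t') (y + d) \<le> V t y + c / (t' - t) * d\<^sup>2"
proof -
  let ?s = "\<sigma> * sqrt (t' - t)"
  have s: "?s > 0"
    using \<sigma> assms by simp
  have "(LINT z|gauss. V t' (y + ?s * (z + d / ?s)) / \<kappa>) - (d / ?s)\<^sup>2 / 2
      \<le> ln (LINT z|gauss. exp (V t' (y + ?s * z) / \<kappa>))"
    using V_bound[of t'] \<kappa> by (intro gauss_variational[where K="C / \<kappa>"]) (auto simp: divide_right_mono)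
  moreover have "(LINT z|gauss. V t' (y + ?s * (z + d / ?s)) / \<kappa>) = heat ?s (V t') (y + d) / \<kappa>"
  proof -
    have "u * (z + d / u) = d + u * z" if "u > 0" for u z
      using that by (simp add: field_simps)
    then show ?thesis
      using s by (simp only: heat_def add.assoc) simp
  qed
  ultimately have "\<kappa> * (heat ?s (V t') (y + d) / \<kappa> - (d / ?s)\<^sup>2 / 2) \<le> V t y"
    unfolding V_semigroup[OF less_imp_le[OF assms(1)] assms(2), of y] using \<kappa> by (intro mult_left_mono) auto
  moreover have "\<kappa> * (heat ?s (V t') (y + d) / \<kappa> - (d / ?s)\<^sup>2 / 2) =
      heat ?s (V t') (y + d) - c / (t' - t) * d\<^sup>2"
  proof -
    have "\<kappa> * ((d / ?s)\<^sup>2 / 2) = c / (t' - t) * d\<^sup>2"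
      using \<sigma> assms by (simp add: power_divide power_mult_distrib \<kappa>_def)
    moreover have "\<kappa> * (h / \<kappa> - a) = h - \<kappa> * a" for h a
      using \<kappa> by (simp add: right_diff_distrib)
    ultimately show ?thesis
      by (simp only:)
  qed
  ultimately show ?thesis
    by linarith
qed

definition gap_const :: "real \<Rightarrow> real" where
  "gap_const t = \<kappa> * (curv t)\<^sup>2 * exp (1 + 2 * (C / \<kappa>)) * (LINT z|gauss. exp (5 * \<bar>z\<bar>)) * \<sigma> ^ 4"

text \<open>The gain from a shift is governed by the gradient of the function at the end of the
  step; hence the drift at time t', but at the starting point x. This respects adaptedness because
  \<open>b\<close> is deterministic. \<open>small\<close> keeps the shift below one standard
  deviation, as \<open>gauss_variational_gap\<close> requires.\<close>

lemma V_step_lower: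
  assumes "t < t'" "t' < T" and small: "sqrt (t' - t) * drift_const \<le> \<sigma> * sqrt (T - t')"
  shows "V t x + c * (t' - t) * (b t' x)\<^sup>2 - gap_const t' * (t' - t)\<^sup>2
    \<le> heat (\<sigma> * sqrt (t' - t)) (V t') (x + (t' - t) * b t' x)"
proof -
  let ?s = "\<sigma> * sqrt (t' - t)" and ?d = "b t' x / \<sigma>\<^sup>2"
  have s: "?s > 0"
    using \<sigma> assms by simp
  have "\<bar>?s * ?d\<bar> = sqrt (t' - t) * \<bar>b t' x\<bar> / \<sigma>"
    using \<sigma> assms by (simp add: abs_mult power2_eq_square)
  also have "\<dots> \<le> sqrt (t' - t) * (drift_const / sqrt (T - t')) / \<sigma>"
    using b_bound[OF assms(2), of x] \<sigma> assms(1) by (intro divide_right_mono mult_left_mono) auto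
  also have "\<dots> \<le> 1"
    using small \<sigma> assms by (simp add: field_simps)
  finally have "ln (LINT z|gauss. exp (V t' (x + ?s * z) / \<kappa>))
      \<le> (LINT z|gauss. V t' (x + ?s * (z + ?s * ?d)) / \<kappa>) - (?s * ?d)\<^sup>2 / 2
       + (curv t')\<^sup>2 * exp (1 + 2 * (C / \<kappa>)) * (LINT z|gauss. exp (5 * \<bar>z\<bar>)) * ?s ^ 4"
    using V_bound[of t'] \<kappa> V_Taylor[OF assms(2), of _ x]
    by (intro gauss_variational_gap[where w="\<lambda>x. V t' x / \<kappa>"]) (auto simp: divide_right_mono)
  moreover have "(LINT z|gauss. V t' (x + ?s * (z + ?s * ?d)) / \<kappa>) = heat ?s (V t') (x + (t' - t) * b t' x) / \<kappa>"
  proof -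
    have "?s * (?s * ?d) = (t' - t) * b t' x"
      using \<sigma> assms by (simp add: power2_eq_square)
    then show ?thesis
      by (simp only: heat_def distrib_left[of ?s _ "?s * ?d"] add.assoc add.commute[of "?s * _"]) simp
  qed
  ultimately have "V t x \<le> \<kappa> * (heat ?s (V t') (x + (t' - t) * b t' x) / \<kappa> - (?s * ?d)\<^sup>2 / 2
       + (curv t')\<^sup>2 * exp (1 + 2 * (C / \<kappa>)) * (LINT z|gauss. exp (5 * \<bar>z\<bar>)) * ?s ^ 4)"
    unfolding V_semigroup[OF less_imp_le[OF assms(1)] less_imp_le[OF assms(2)], of x]
    using \<kappa> by (intro mult_left_mono) auto
  moreover have "\<kappa> * ((?s * ?d)\<^sup>2 / 2) = c * (t' - t) * (b t' x)\<^sup>2"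
    using \<sigma> assms by (simp add: \<kappa>_def power_mult_distrib power_divide power2_eq_square)
  moreover have "?s ^ 4 = \<sigma> ^ 4 * (t' - t)\<^sup>2"
    using assms by (simp add: power_mult_distrib power4_eq_xxxx power2_eq_square)
  moreover have "\<kappa> * (h / \<kappa> - a + K * e) = h - \<kappa> * a + \<kappa> * K * e" for h a K e
    using \<kappa> by (simp add: algebra_simps)
  ultimately show ?thesis
    by (simp only: gap_const_def mult.assoc)
qed

text \<open>This is where upper semicontinuity of the monotone, right-continuous \<open>g\<close> enters.\<close>

lemma V_limsup:
  assumes tn: "\<And>n. tn n < T" "tn \<longlonglongrightarrow> T" and xn: "xn \<longlonglongrightarrow> x" and \<delta>: "\<delta> > 0" and \<epsilon>: "\<epsilon> > 0"
  shows "\<forall>\<^sub>F n in sequentially. V (tn n) (xn n) \<le> g (x + \<delta>) + \<epsilon>"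
proof -
  let ?s = "\<lambda>n. \<sigma> * sqrt (T - tn n)"
  have s: "?s \<longlonglongrightarrow> 0"
    using tendsto_mult[OF tendsto_const[of \<sigma>] tendsto_real_sqrt[OF tendsto_diff[OF tendsto_const[of T] tn(2)]]]
    by simp
  \<comment> \<open>For each z the maximum is eventually constant, so dominated convergence gives an
    upper bound even where G (xn n + ?s n * z) has no limit.\<close>
  have "(\<lambda>n. LINT z|gauss. max (G (xn n + ?s n * z)) (G (x + \<delta>))) \<longlonglongrightarrow> (LINT z|gauss. G (x + \<delta>))"
  proof (rule integral_dominated_convergence[where w="\<lambda>_. bd"])
    show "AE z in gauss. (\<lambda>n. max (G (xn n + ?s n * z)) (G (x + \<delta>))) \<longlonglongrightarrow> G (x + \<delta>)"
    proof (rule always_eventually, rule allI, rule tendsto_eventually)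
      fix z
      have "(\<lambda>n. xn n + ?s n * z) \<longlonglongrightarrow> x + 0 * z"
        using xn s by (intro tendsto_intros)
      then have "\<forall>\<^sub>F n in sequentially. xn n + ?s n * z < x + \<delta>"
        using \<delta> by (intro order_tendstoD) auto
      then show "\<forall>\<^sub>F n in sequentially. max (G (xn n + ?s n * z)) (G (x + \<delta>)) = G (x + \<delta>)"
        by eventually_elim (auto simp: max_def intro!: antisym monoD[OF G_mono])
    qed
    fix n
    show "AE z in gauss. norm (max (G (xn n + ?s n * z)) (G (x + \<delta>))) \<le> bd"
      using G_abs by (intro always_eventually) (auto simp: max_def)
  qed auto
  then have lim: "(\<lambda>n. \<kappa> * ln (LINT z|gauss. max (G (xn n + ?s n * z)) (G (x + \<delta>)))) \<longlonglongrightarrow> g (x + \<delta>)"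
    using tendsto_mult[OF tendsto_const[of \<kappa>] tendsto_ln[of _ "G (x + \<delta>)"]] \<kappa> by (simp add: G_def)
  have "V (tn n) (xn n) \<le> \<kappa> * ln (LINT z|gauss. max (G (xn n + ?s n * z)) (G (x + \<delta>)))" for n
  proof -
    have "U (tn n) (xn n) \<le> (LINT z|gauss. max (G (xn n + ?s n * z)) (G (x + \<delta>)))"
      unfolding U_def heat_def using G_abs
      by (intro integral_mono integrable_gauss_bounded[where K=bd]) (auto simp: max_def)
    then show ?thesis
      unfolding V_def using \<kappa> U_pos[of "tn n" "xn n"] by (intro mult_left_mono ln_mono) auto
  qed
  moreover have "\<forall>\<^sub>F n in sequentially. \<kappa> * ln (LINT z|gauss. max (G (xn n + ?s n * z)) (G (x + \<delta>))) < g (x + \<delta>) + \<epsilon>"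
    using lim \<epsilon> by (intro order_tendstoD) auto
  ultimately show ?thesis
    by (auto elim!: eventually_mono intro: order_trans less_imp_le)
qed

end

section \<open>Filtered probability spaces\<close>

locale filtered_space =
  fixes M :: "'a measure" and F :: "real \<Rightarrow> 'a measure"
  assumes filtered: "filtered_prob_space M F"
begin

sublocale prob_space M
  using filtered by (simp add: filtered_prob_space_def)

lemma space_F [simp]: "space (F t) = space M"
  using filtered by (auto simp: filtered_prob_space_def filtration_def)

lemma sets_F_mono: "s \<le> t \<Longrightarrow> sets (F s) \<subseteq> sets (F t)"
  using filtered by (auto simp: filtered_prob_space_def filtration_def)

lemma sets_F: "sets (F t) \<subseteq> sets M"
  using filtered by (auto simp: filtered_prob_space_def subalgebra_def)

lemma measurable_F_mono:
  assumes "f \<in> measurable (F s) N" "s \<le> t"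
  shows "f \<in> measurable (F t) N"
  using measurable_mono[of N N "F s" "F t"] assms sets_F_mono[OF assms(2)] by auto

lemma measurable_F:
  assumes "f \<in> measurable (F s) N"
  shows "f \<in> measurable M N"
  using measurable_mono[of N N "F s" M] assms sets_F[of s] by auto

lemma adapted_measurable:
  assumes "adapted F T X" "0 \<le> s" "s \<le> t" "s \<le> T"
  shows "X s \<in> borel_measurable (F t)"
  using assms by (auto simp: adapted_def intro: measurable_F_mono)

lemma progressively_measurable_of_continuous:
  assumes X: "adapted F T X" and cont: "\<And>\<omega>. \<omega> \<in> space M \<Longrightarrow> continuous_on {0..T} (\<lambda>t. X t \<omega>)"
  shows "progressively_measurable F T X"
  unfolding progressively_measurable_def
proof
  fix t assume t: "t \<in> {0..T}"
  define N where "N = restrict_space borel {0..t} \<Otimes>\<^sub>M F t"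
  have [measurable]: "fst \<in> borel_measurable N"
    unfolding N_def by (intro measurable_compose[OF measurable_fst] measurable_restrict_space1) simp
  \<comment> \<open>Time is sampled on a grid of mesh 1 / (n + 1). Clamping to [0, t] keeps every
    sampled value measurable with respect to F t.\<close>
  define cl where "cl n i = max 0 (min t (real_of_int i / real (Suc n)))" for n i
  have "(\<lambda>p. X (cl n \<lfloor>real (Suc n) * fst p\<rfloor>) (snd p)) \<in> borel_measurable N" for n
  proof (rule measurable_compose_countable)
    show "(\<lambda>p. X (cl n i) (snd p)) \<in> borel_measurable N" for i
    proof -
      have "X (cl n i) \<in> borel_measurable (F t)"
        using t by (intro adapted_measurable[OF X]) (auto simp: cl_def)
      then show ?thesis
        unfolding N_def by (rule measurable_compose[OF measurable_snd])
    qed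
    show "(\<lambda>p. \<lfloor>real (Suc n) * fst p\<rfloor>) \<in> measurable N (count_space UNIV)"
      by measurable
  qed
  moreover have "(\<lambda>n. X (cl n \<lfloor>real (Suc n) * fst p\<rfloor>) (snd p)) \<longlonglongrightarrow> X (fst p) (snd p)" if "p \<in> space N" for p
  proof -
    have p: "0 \<le> fst p" "fst p \<le> t" "snd p \<in> space M"
      using that by (auto simp: N_def space_pair_measure space_restrict_space)
    have cl: "\<bar>cl n \<lfloor>real (Suc n) * fst p\<rfloor> - fst p\<bar> \<le> 1 / real (Suc n)" for n
    proof -
      define m where "m = real (Suc n)"
      define q where "q = real_of_int \<lfloor>m * fst p\<rfloor> / m"
      have "m > 0"
        by (simp add: m_def)
      moreover have "real_of_int \<lfloor>m * fst p\<rfloor> \<le> m * fst p" "m * fst p - 1 \<le> real_of_int \<lfloor>m * fst p\<rfloor>"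
        by linarith+
      moreover have "m * (fst p - 1 / m) = m * fst p - 1"
        using \<open>m > 0\<close> by (simp add: right_diff_distrib)
      ultimately have "q \<le> fst p" "fst p - 1 / m \<le> q"
        unfolding q_def by (simp_all add: pos_divide_le_eq pos_le_divide_eq mult.commute)
      then show ?thesis
        using p unfolding cl_def m_def[symmetric] q_def[symmetric] by (auto simp: max_def min_def abs_le_iff)
    qed
    have "(\<lambda>n. cl n \<lfloor>real (Suc n) * fst p\<rfloor>) \<longlonglongrightarrow> fst p"
      by (rule LIM_zero_cancel, rule Lim_null_comparison[OF always_eventually LIMSEQ_Suc[OF lim_inverse_n']])
        (use cl in \<open>simp add: inverse_eq_divide\<close>)
    then show ?thesis
      using cont[OF p(3)] p t
      by (intro continuous_on_tendsto_compose[of "{0..T}" "\<lambda>t. X t (snd p)"] always_eventually)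
        (auto simp: cl_def)
  qed
  ultimately have "(\<lambda>p. X (fst p) (snd p)) \<in> borel_measurable N"
    by (rule borel_measurable_LIMSEQ_real[rotated])
  then show "(\<lambda>(s, \<omega>). X s \<omega>) \<in> borel_measurable (restrict_space borel {0..t} \<Otimes>\<^sub>M F t)"
    by (simp add: N_def case_prod_beta')
qed

lemma progressively_measurable_compose:
  assumes a: "progressively_measurable F T X" and h: "(\<lambda>(s, x). h s x) \<in> borel_measurable borel"
  shows "progressively_measurable F T (\<lambda>s \<omega>. h s (X s \<omega>))"
  unfolding progressively_measurable_def
proof
  fix t assume t: "t \<in> {0..T}"
  have [measurable]: "(\<lambda>p. X (fst p) (snd p)) \<in> borel_measurable (restrict_space borel {0..t} \<Otimes>\<^sub>M F t)"
    using a t by (simp add: progressively_measurable_def case_prod_beta')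
  have [measurable]: "fst \<in> borel_measurable (restrict_space borel {0..t} \<Otimes>\<^sub>M F t)"
    by (intro measurable_compose[OF measurable_fst] measurable_restrict_space1) simp
  have "(\<lambda>p. (fst p, X (fst p) (snd p))) \<in> borel_measurable (restrict_space borel {0..t} \<Otimes>\<^sub>M F t)"
    by measurable
  from measurable_compose[OF this h]
  show "(\<lambda>(s, \<omega>). h s (X s \<omega>)) \<in> borel_measurable (restrict_space borel {0..t} \<Otimes>\<^sub>M F t)"
    by (simp add: case_prod_beta')
qed

lemma
  assumes a: "progressively_measurable F T a" and "0 \<le> u" "t \<le> T" "0 \<le> t"
  shows measurable_progressive_integral: "(\<lambda>\<omega>. LINT s:{u..t}|lborel. a s \<omega>) \<in> borel_measurable (F t)"
    and measurable_progressive_nn_integral: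
      "h \<in> borel_measurable borel \<Longrightarrow>
        (\<lambda>\<omega>. \<integral>\<^sup>+s\<in>{u..t}. ennreal (h (a s \<omega>)) \<partial>lborel) \<in> borel_measurable (F t)"
proof -
  let ?L = "restrict_space lborel {0..t}"
  interpret sigma_finite_measure ?L
    by (intro sigma_finite_measure_restrict_space) (auto intro: sigma_finite_lborel)
  have sets: "sets (F t \<Otimes>\<^sub>M ?L) = sets (F t \<Otimes>\<^sub>M restrict_space borel {0..t})"
    by (intro sets_pair_measure_cong sets_restrict_space_cong) auto
  have "(\<lambda>(\<omega>, s). (s, \<omega>)) \<in> measurable (F t \<Otimes>\<^sub>M ?L) (restrict_space borel {0..t} \<Otimes>\<^sub>M F t)"
    unfolding measurable_cong_sets[OF sets refl] by measurable
  from measurable_compose[OF this, of "\<lambda>(s, \<omega>). a s \<omega>" borel] a assms(3,4)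
  have a': "(\<lambda>p. a (snd p) (fst p)) \<in> borel_measurable (F t \<Otimes>\<^sub>M ?L)"
    by (simp add: progressively_measurable_def case_prod_beta')
  have snd: "snd \<in> borel_measurable (F t \<Otimes>\<^sub>M ?L)"
    by (intro measurable_compose[OF measurable_snd] measurable_restrict_space1) simp
  have "(\<lambda>p. indicator {u..t} (snd p) *\<^sub>R a (snd p) (fst p)) \<in> borel_measurable (F t \<Otimes>\<^sub>M ?L)"
    by (intro borel_measurable_scaleR measurable_compose[OF snd borel_measurable_indicator] a') simp
  then have "(\<lambda>\<omega>. \<integral>s. indicator {u..t} s *\<^sub>R a s \<omega> \<partial>?L) \<in> borel_measurable (F t)"
    by (intro borel_measurable_lebesgue_integral) (simp add: case_prod_beta')
  moreover have "(\<integral>s. indicator {u..t} s *\<^sub>R a s \<omega> \<partial>?L) = (LINT s:{u..t}|lborel. a s \<omega>)" for \<omega>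
    unfolding set_lebesgue_integral_def using assms
    by (subst integral_restrict_space) (auto intro!: Bochner_Integration.integral_cong split: split_indicator)
  ultimately show "(\<lambda>\<omega>. LINT s:{u..t}|lborel. a s \<omega>) \<in> borel_measurable (F t)"
    by simp
  assume h: "h \<in> borel_measurable borel"
  have "(\<lambda>p. ennreal (h (a (snd p) (fst p))) * indicator {u..t} (snd p)) \<in> borel_measurable (F t \<Otimes>\<^sub>M ?L)"
    by (intro borel_measurable_times_ennreal measurable_compose[OF snd borel_measurable_indicator]
        measurable_compose[OF measurable_compose[OF a' h]]) simp_all
  then have "(\<lambda>\<omega>. \<integral>\<^sup>+s. ennreal (h (a s \<omega>)) * indicator {u..t} s \<partial>?L) \<in> borel_measurable (F t)"
    by (intro borel_measurable_nn_integral) (simp add: case_prod_beta')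
  moreover have "(\<integral>\<^sup>+s. ennreal (h (a s \<omega>)) * indicator {u..t} s \<partial>?L) = (\<integral>\<^sup>+s\<in>{u..t}. ennreal (h (a s \<omega>)) \<partial>lborel)" for \<omega>
    using assms by (subst nn_integral_restrict_space) (auto intro!: nn_integral_cong split: split_indicator)
  ultimately show "(\<lambda>\<omega>. \<integral>\<^sup>+s\<in>{u..t}. ennreal (h (a s \<omega>)) \<partial>lborel) \<in> borel_measurable (F t)"
    by simp
qed

lemma admissible_AE_integrable:
  assumes "admissible M F T a" "0 \<le> T"
  shows "AE \<omega> in M. set_integrable lborel {0..T} (\<lambda>s. a s \<omega>)"
proof -
  have p: "progressively_measurable F T a"
    and fin: "(\<integral>\<^sup>+ \<omega>. (\<integral>\<^sup>+ s\<in>{0..T}. ennreal \<bar>a s \<omega>\<bar> \<partial>lborel) \<partial>M) < \<infinity>"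
    using assms(1) by (auto simp: admissible_def)
  have "(\<lambda>\<omega>. \<integral>\<^sup>+ s\<in>{0..T}. ennreal \<bar>a s \<omega>\<bar> \<partial>lborel) \<in> borel_measurable M"
    using assms(2) by (intro measurable_F[of _ T] measurable_progressive_nn_integral[OF p]) auto
  then have "AE \<omega> in M. (\<integral>\<^sup>+ s\<in>{0..T}. ennreal \<bar>a s \<omega>\<bar> \<partial>lborel) \<noteq> \<infinity>"
    using fin by (intro nn_integral_noteq_infinite) auto
  then show ?thesis
  proof (rule AE_mp, intro AE_I2 impI)
    fix \<omega> assume \<omega>: "\<omega> \<in> space M" "(\<integral>\<^sup>+ s\<in>{0..T}. ennreal \<bar>a s \<omega>\<bar> \<partial>lborel) \<noteq> \<infinity>"
    have "(\<lambda>s. (s, \<omega>)) \<in> measurable (restrict_space borel {0..T}) (restrict_space borel {0..T} \<Otimes>\<^sub>M F T)"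
      using \<omega> by (intro measurable_Pair2') simp
    from measurable_compose[OF this, of "\<lambda>(s, \<omega>). a s \<omega>" borel] p assms(2)
    have "(\<lambda>s. a s \<omega>) \<in> borel_measurable (restrict_space borel {0..T})"
      by (simp add: progressively_measurable_def case_prod_beta')
    then have "(\<lambda>s. indicator {0..T} s *\<^sub>R a s \<omega>) \<in> borel_measurable borel"
      by (subst (asm) borel_measurable_restrict_space_iff) auto
    moreover have "(\<integral>\<^sup>+ s. ennreal (norm (indicator {0..T} s *\<^sub>R a s \<omega>)) \<partial>lborel) =
        (\<integral>\<^sup>+ s\<in>{0..T}. ennreal \<bar>a s \<omega>\<bar> \<partial>lborel)"
      by (intro nn_integral_cong) (auto split: split_indicator)
    ultimately show "set_integrable lborel {0..T} (\<lambda>s. a s \<omega>)"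
      unfolding set_integrable_def using \<omega>(2) by (intro integrableI_bounded) (simp_all add: less_top[symmetric])
  qed
qed

end

locale brownian_space = filtered_space M F
  for M :: "'a measure" and F +
  fixes T :: real and B :: "real \<Rightarrow> 'a \<Rightarrow> real"
  assumes brownian: "brownian_motion M F T B"
begin

lemma B_adapted: "adapted F T B"
  using brownian by (simp add: brownian_motion_def)

lemma B_measurable: "0 \<le> s \<Longrightarrow> s \<le> t \<Longrightarrow> s \<le> T \<Longrightarrow> B s \<in> borel_measurable (F t)"
  using B_adapted by (rule adapted_measurable)

lemma B_measurable_M [measurable]: "0 \<le> s \<Longrightarrow> s \<le> T \<Longrightarrow> B s \<in> borel_measurable M"
  by (rule measurable_F, rule B_measurable[of s s]) auto

lemma B_continuous: "\<omega> \<in> space M \<Longrightarrow> continuous_on {0..T} (\<lambda>t. B t \<omega>)"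
  using brownian by (simp add: brownian_motion_def)

lemma B_0: "AE \<omega> in M. B 0 \<omega> = 0"
  using brownian by (simp add: brownian_motion_def)

text \<open>Independence makes the joint law of Y and the increment a product, and Fubini integrates
  the increment out as a heat kernel. All uses of the law of the Brownian increments and of their
  independence of the past go through this lemma.\<close>

lemma markov:
  fixes f :: "real \<Rightarrow> real"
  assumes st: "0 \<le> s" "s < t" "t \<le> T" and Y: "Y \<in> borel_measurable (F s)"
    and [measurable]: "f \<in> borel_measurable borel" and bd: "\<And>x. \<bar>f x\<bar> \<le> K"
  shows "expectation (\<lambda>\<omega>. f (Y \<omega> + \<sigma> * (B t \<omega> - B s \<omega>))) = expectation (\<lambda>\<omega>. heat (\<sigma> * sqrt (t - s)) f (Y \<omega>))"
proof -
  define D where "D \<omega> = B t \<omega> - B s \<omega>" for \<omega>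
  have [measurable]: "Y \<in> borel_measurable M"
    using Y by (rule measurable_F)
  have [measurable]: "D \<in> borel_measurable M"
    unfolding D_def using st by (intro borel_measurable_diff B_measurable_M) auto
  have "distributed M lborel D (normal_density 0 (sqrt (t - s)))"
    and ind: "indep_set (sets (F s)) {D -` A \<inter> space M |A. A \<in> sets borel}"
    using brownian st unfolding D_def[abs_def] by (simp_all add: brownian_motion_def)
  then have "distributed M lborel (\<lambda>\<omega>. (D \<omega> - 0) / sqrt (t - s)) std_normal_density"
    using normal_standard_normal_convert[of "sqrt (t - s)" D 0] st by simp
  then have dist: "(LINT z|lborel. std_normal_density z * h z) = expectation (\<lambda>\<omega>. h (D \<omega> / sqrt (t - s)))"
    if "h \<in> borel_measurable borel" for h :: "real \<Rightarrow> real"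
    using distributed_integral[of M lborel "\<lambda>\<omega>. (D \<omega> - 0) / sqrt (t - s)" std_normal_density h] that by simp
  have "indep_set (sigma_sets (space M) (sets (F s))) (sigma_sets (space M) {D -` A \<inter> space M |A. A \<in> sets borel})"
    using ind
  proof (rule indep_set_sigma_sets)
    show "Int_stable (sets (F s))"
      by (auto simp: Int_stable_def)
    show "Int_stable {D -` A \<inter> space M |A. A \<in> sets borel}"
      by (auto simp: Int_stable_def) (metis Int_assoc Int_left_commute inf.idem sets.Int vimage_Int)
  qed
  moreover have "sigma_sets (space M) {Y -` A \<inter> space M |A. A \<in> sets borel} \<subseteq> sigma_sets (space M) (sets (F s))"
    using measurable_sets[OF Y] by (intro sigma_sets_mono') auto
  ultimately have "indep_var borel Y borel D"
    unfolding indep_var_eq by (auto simp: indep_sets2_eq)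
  then have joint: "distr M borel Y \<Otimes>\<^sub>M distr M borel D = distr M (borel \<Otimes>\<^sub>M borel) (\<lambda>\<omega>. (Y \<omega>, D \<omega>))"
    by (simp add: indep_var_distribution_eq)
  interpret Y: prob_space "distr M borel Y" by (rule prob_space_distr) simp
  interpret D: prob_space "distr M borel D" by (rule prob_space_distr) simp
  interpret P: pair_prob_space "distr M borel Y" "distr M borel D" ..
  have int: "integrable (distr M borel Y \<Otimes>\<^sub>M distr M borel D) (\<lambda>p. f (fst p + \<sigma> * snd p))"
    using bd by (intro P.integrable_const_bound[where B=K] always_eventually) simp_all
  have "expectation (\<lambda>\<omega>. f (Y \<omega> + \<sigma> * D \<omega>)) =
      (\<integral>p. f (fst p + \<sigma> * snd p) \<partial>(distr M borel Y \<Otimes>\<^sub>M distr M borel D))"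
    unfolding joint by (subst integral_distr) auto
  also have "\<dots> = (\<integral>y. (\<integral>d. f (y + \<sigma> * d) \<partial>distr M borel D) \<partial>distr M borel Y)"
    using P.integral_fst'[OF int] by simp
  also have "\<dots> = (\<integral>y. heat (\<sigma> * sqrt (t - s)) f y \<partial>distr M borel Y)"
  proof (rule Bochner_Integration.integral_cong[OF refl])
    fix y
    have "(\<integral>d. f (y + \<sigma> * d) \<partial>distr M borel D) = expectation (\<lambda>\<omega>. f (y + \<sigma> * sqrt (t - s) * (D \<omega> / sqrt (t - s))))"
      using st by (subst integral_distr) auto
    also have "\<dots> = (LINT z|lborel. std_normal_density z * f (y + \<sigma> * sqrt (t - s) * z))"
      by (subst dist) auto
    also have "\<dots> = heat (\<sigma> * sqrt (t - s)) f y"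
      unfolding heat_def by (subst integral_density) auto
    finally show "(\<integral>d. f (y + \<sigma> * d) \<partial>distr M borel D) = heat (\<sigma> * sqrt (t - s)) f y" .
  qed
  also have "\<dots> = expectation (\<lambda>\<omega>. heat (\<sigma> * sqrt (t - s)) f (Y \<omega>))"
    by (subst integral_distr) auto
  finally show ?thesis
    by (simp add: D_def)
qed

end

section \<open>Integrals over partitions\<close>

lemma set_lborel_integral_eq_integral:
  fixes f :: "real \<Rightarrow> real"
  assumes "set_integrable lborel {a..b} f"
  shows "f integrable_on {a..b}" "(LINT s:{a..b}|lborel. f s) = integral {a..b} f"
  using set_borel_integral_eq_integral[OF assms] by auto

lemma set_integrable_lborel_subset:
  fixes f :: "real \<Rightarrow> real"
  assumes "set_integrable lborel {a..b} f" "a \<le> c" "d \<le> b"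
  shows "set_integrable lborel {c..d} f"
  by (rule set_integrable_subset[OF assms(1)]) (use assms in auto)

lemma set_integrable_lborel_continuous:
  fixes f :: "real \<Rightarrow> real"
  assumes "continuous_on {a..b} f"
  shows "set_integrable lborel {a..b} f"
  unfolding set_integrable_def using assms by (intro borel_integrable_compact) auto

lemma integral_partition:
  fixes f :: "real \<Rightarrow> real"
  assumes "f integrable_on {a..b}" and h: "h \<ge> 0" and "a + real k * h \<le> b"
  shows "(\<Sum>j<k. integral {a + real j * h..a + real (Suc j) * h} f) = integral {a..a + real k * h} f"
  using assms(3)
proof (induction k)
  case (Suc k)
  have le: "a + real k * h \<le> a + real (Suc k) * h"
    using h by (simp add: distrib_right)
  then have "a + real k * h \<le> b"
    using Suc.prems by linarith
  moreover have "integral {a..a + real k * h} f + integral {a + real k * h..a + real (Suc k) * h} f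
      = integral {a..a + real (Suc k) * h} f"
    using le h Suc.prems by (intro Henstock_Kurzweil_Integration.integral_combine
        integrable_subinterval_real[OF assms(1)]) auto
  ultimately show ?case
    using Suc.IH by simp
qed simp

text \<open>Cauchy-Schwarz, from the nonnegative integral of (f - m)^2 with \<open>m\<close> the
  mean of \<open>f\<close> over the interval.\<close>

lemma square_integral_le:
  fixes f :: "real \<Rightarrow> real"
  assumes f: "set_integrable lborel {a..b} f" and f2: "set_integrable lborel {a..b} (\<lambda>s. (f s)\<^sup>2)" and "a < b"
  shows "(LINT s:{a..b}|lborel. f s)\<^sup>2 \<le> (b - a) * (LINT s:{a..b}|lborel. (f s)\<^sup>2)"
proof -
  define I where "I = (LINT s:{a..b}|lborel. f s)"
  define m where "m = I / (b - a)"
  have c: "set_integrable lborel {a..b} (\<lambda>s. m\<^sup>2)" "(LINT s:{a..b}|lborel. m\<^sup>2) = (b - a) * m\<^sup>2"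
    using \<open>a < b\<close> by (simp_all add: set_integral_const set_integrable_lborel_continuous)
  have f': "set_integrable lborel {a..b} (\<lambda>s. 2 * m * f s)"
    using f by simp
  have "0 \<le> (LINT s:{a..b}|lborel. (f s - m)\<^sup>2)"
    unfolding set_lebesgue_integral_def by (intro integral_nonneg_AE) auto
  also have "(\<lambda>s. (f s - m)\<^sup>2) = (\<lambda>s. ((f s)\<^sup>2 - 2 * m * f s) + m\<^sup>2)"
    by (auto simp: power2_diff algebra_simps)
  also have "(LINT s:{a..b}|lborel. ((f s)\<^sup>2 - 2 * m * f s) + m\<^sup>2)
      = (LINT s:{a..b}|lborel. (f s)\<^sup>2) - 2 * m * I + (b - a) * m\<^sup>2"
    using f2 f' c unfolding I_def
    by (subst set_integral_add) (auto simp: set_integral_diff)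
  also have "\<dots> = (LINT s:{a..b}|lborel. (f s)\<^sup>2) - I\<^sup>2 / (b - a)"
    using \<open>a < b\<close> by (simp add: m_def power2_eq_square divide_simps)
  finally show ?thesis
    using \<open>a < b\<close> by (simp add: I_def field_simps)
qed

text \<open>The majorant of the drift up to T. It is integrable although its square, which would
  bound the cost, is not.\<close>

lemma set_integrable_inverse_sqrt:
  assumes "t < T"
  shows "set_integrable lborel {t..T} (\<lambda>s. 1 / sqrt (T - s))"
proof -
  have "((\<lambda>s. 1 / sqrt (T - s)) has_integral (- 2 * sqrt (T - T)) - (- 2 * sqrt (T - t))) {t..T}"
  proof (rule fundamental_theorem_of_calculus_interior)
    show "continuous_on {t..T} (\<lambda>s. - 2 * sqrt (T - s))"
      by (intro continuous_intros)
    fix s assume s: "s \<in> {t<..<T}"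
    have "((\<lambda>s. - 2 * sqrt (T - s)) has_real_derivative - 2 * ((0 - 1) * (inverse (sqrt (T - s)) / 2))) (at s)"
      using s by (auto intro!: derivative_eq_intros)
    then show "((\<lambda>s. - 2 * sqrt (T - s)) has_vector_derivative 1 / sqrt (T - s)) (at s)"
      by (simp add: has_real_derivative_iff_has_vector_derivative inverse_eq_divide)
  qed (use assms in auto)
  then have "(\<lambda>s. 1 / sqrt (T - s)) absolutely_integrable_on {t..T}"
    by (intro nonnegative_absolutely_integrable_1) auto
  then show ?thesis
    unfolding set_integrable_def by (subst (asm) integrable_completion) auto
qed

text \<open>The first argument is frozen at the right end and the second at the left end of each
  block, because the one-step lower bound takes the drift at the later time and the state at the
  earlier one. The error is \<epsilon> h for all blocks at once, hence summable.\<close>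

lemma uniform_Riemann_error:
  fixes f :: "real \<times> real \<Rightarrow> real"
  assumes f: "continuous_on ({a..b} \<times> {a..b}) f" and "a < b" "\<epsilon> > 0"
  shows "\<forall>\<^sub>F n in sequentially. \<forall>k\<le>n. let h = (b - a) / real (Suc n) in
    \<bar>integral {a + real k * h..a + real (Suc k) * h} (\<lambda>s. f (s, s)) - h * f (a + real (Suc k) * h, a + real k * h)\<bar> \<le> \<epsilon> * h"
proof -
  have "uniformly_continuous_on ({a..b} \<times> {a..b}) f"
    using f by (intro compact_uniformly_continuous compact_Times) auto
  then obtain d where d: "d > 0" "\<And>p q. p \<in> {a..b} \<times> {a..b} \<Longrightarrow> q \<in> {a..b} \<times> {a..b} \<Longrightarrow> dist q p < d \<Longrightarrow> dist (f q) (f p) < \<epsilon>"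
    using \<open>\<epsilon> > 0\<close> unfolding uniformly_continuous_on_def by metis
  have "(\<lambda>n. (b - a) / real (Suc n)) \<longlonglongrightarrow> 0"
    by (intro LIMSEQ_Suc[OF lim_const_over_n])
  then have "\<forall>\<^sub>F n in sequentially. (b - a) / real (Suc n) < d / 2"
    using d by (intro order_tendstoD) auto
  then show ?thesis
  proof eventually_elim
    case (elim n)
    define h where "h = (b - a) / real (Suc n)"
    have h: "0 < h" "h < d / 2" "real (Suc n) * h = b - a"
      using elim \<open>a < b\<close> by (auto simp: h_def)
    show ?case
      unfolding h_def[symmetric] Let_def
    proof (intro allI impI)
      fix k assume "k \<le> n"
      define u v where "u = a + real k * h" and "v = a + real (Suc k) * h"
      have uv: "v - u = h"
        by (simp add: u_def v_def algebra_simps)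
      have "real (Suc k) * h \<le> real (Suc n) * h"
        using \<open>k \<le> n\<close> h by (intro mult_right_mono) auto
      then have "v \<le> b"
        unfolding v_def using h(3) by linarith
      then have ab: "a \<le> u" "v \<le> b" "u \<le> v"
        using h uv by (auto simp: u_def)
      have int: "(\<lambda>s. f (s, s)) integrable_on {u..v}"
        by (intro integrable_continuous_real continuous_on_compose2[OF f] continuous_intros) (use ab in auto)
      have "norm (integral {u..v} (\<lambda>s. f (s, s) - f (v, u))) \<le> \<epsilon> * (v - u)"
      proof (rule integral_bound)
        show "continuous_on {u..v} (\<lambda>s. f (s, s) - f (v, u))"
          by (intro continuous_intros continuous_on_compose2[OF f]) (use ab in auto)
        fix s assume s: "s \<in> {u..v}"
        have "dist (s, s) (v, u) \<le> dist s v + dist s u"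
          unfolding dist_Pair_Pair by (rule sqrt_sum_squares_le_sum) auto
        also have "\<dots> < d"
          using s uv h by (auto simp: dist_real_def)
        finally show "norm (f (s, s) - f (v, u)) \<le> \<epsilon>"
          using d(2)[of "(v, u)" "(s, s)"] s ab by (force simp: dist_norm)
      qed (use ab in auto)
      moreover have "integral {u..v} (\<lambda>s. f (s, s) - f (v, u)) = integral {u..v} (\<lambda>s. f (s, s)) - h * f (v, u)"
        using int ab uv by (subst Henstock_Kurzweil_Integration.integral_diff) auto
      ultimately show "\<bar>integral {a + real k * h..a + real (Suc k) * h} (\<lambda>s. f (s, s)) - h * f (a + real (Suc k) * h, a + real k * h)\<bar> \<le> \<epsilon> * h"
        unfolding real_norm_def uv u_def[symmetric] v_def[symmetric] by simp
    qed
  qed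
qed

section \<open>No admissible control beats the value function\<close>

locale controlled = monotone_reward T c \<sigma> C g + brownian_space M F T B
  for T c \<sigma> C g and M :: "'a measure" and F B
begin

lemma V_integrable:
  assumes "Y \<in> borel_measurable M"
  shows "integrable M (\<lambda>\<omega>. V t (Y \<omega>))"
  by (rule integrable_const_bound[where B=C]) (use assms V_bound in \<open>auto intro!: measurable_compose[OF assms V_measurable]\<close>)

lemma expectation_V_step_upper:
  assumes st: "0 \<le> s" "s < t" "t \<le> T" and Y: "Y \<in> borel_measurable (F s)"
    and D: "D \<in> borel_measurable (F s)" and D2: "integrable M (\<lambda>\<omega>. (D \<omega>)\<^sup>2)"
  shows "expectation (\<lambda>\<omega>. V t (Y \<omega> + D \<omega> + \<sigma> * (B t \<omega> - B s \<omega>)))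
    \<le> expectation (\<lambda>\<omega>. V s (Y \<omega>)) + c / (t - s) * expectation (\<lambda>\<omega>. (D \<omega>)\<^sup>2)"
proof -
  have [measurable]: "Y \<in> borel_measurable M" "D \<in> borel_measurable M"
    using Y D by (auto intro: measurable_F)
  have "expectation (\<lambda>\<omega>. V t (Y \<omega> + D \<omega> + \<sigma> * (B t \<omega> - B s \<omega>))) =
      expectation (\<lambda>\<omega>. heat (\<sigma> * sqrt (t - s)) (V t) (Y \<omega> + D \<omega>))"
    using V_bound by (intro markov[OF st] borel_measurable_add Y D) auto
  also have "\<dots> \<le> expectation (\<lambda>\<omega>. V s (Y \<omega>) + c / (t - s) * (D \<omega>)\<^sup>2)"
  proof (rule integral_mono)
    have "\<bar>heat r (V t) x\<bar> \<le> C" for r x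
      using heat_bounds[of "V t" "-C" C r x] V_bound[of t] by (auto simp: abs_le_iff minus_le_iff)
    then show "integrable M (\<lambda>\<omega>. heat (\<sigma> * sqrt (t - s)) (V t) (Y \<omega> + D \<omega>))"
      by (intro integrable_const_bound[where B=C]) auto
    show "integrable M (\<lambda>\<omega>. V s (Y \<omega>) + c / (t - s) * (D \<omega>)\<^sup>2)"
      using D2 by (intro Bochner_Integration.integrable_add V_integrable integrable_mult_right) auto
    show "heat (\<sigma> * sqrt (t - s)) (V t) (Y \<omega> + D \<omega>) \<le> V s (Y \<omega>) + c / (t - s) * (D \<omega>)\<^sup>2" for \<omega>
      using st by (intro V_step_upper) auto
  qed
  also have "\<dots> = expectation (\<lambda>\<omega>. V s (Y \<omega>)) + c / (t - s) * expectation (\<lambda>\<omega>. (D \<omega>)\<^sup>2)"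
    using D2 V_integrable by (subst Bochner_Integration.integral_add) auto
  finally show ?thesis .
qed

text \<open>Delaying the control by one block of the partition makes each increment measurable at the
  start of its block, so that the one-step inequality applies exactly; the missing last block is
  absorbed by a shift of the starting point, because \<open>g\<close> is monotone.\<close>

lemma delayed_control_bound:
  assumes \<beta>: "progressively_measurable F T \<beta>" and t0: "0 \<le> t0" "t0 < T"
    and int: "AE \<omega> in M. set_integrable lborel {t0..T} (\<lambda>s. \<beta> s \<omega>)"
    and int2: "AE \<omega> in M. set_integrable lborel {t0..T} (\<lambda>s. (\<beta> s \<omega>)\<^sup>2)"
    and cost: "integrable M (\<lambda>\<omega>. LINT s:{t0..T}|lborel. (\<beta> s \<omega>)\<^sup>2)"
    and n: "h = (T - t0) / real (Suc n)"
  shows "expectation (\<lambda>\<omega>. g (x + (LINT s:{t0..t0 + real n * h}|lborel. \<beta> s \<omega>) + \<sigma> * (B T \<omega> - B t0 \<omega>)))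
    \<le> V t0 x + c * expectation (\<lambda>\<omega>. LINT s:{t0..T}|lborel. (\<beta> s \<omega>)\<^sup>2)"
proof -
  have h: "h > 0" "real (Suc n) * h = T - t0"
    using t0 by (auto simp: n)
  define p where "p k = t0 + real k * h" for k
  have p0: "p 0 = t0" and pn: "p (Suc n) = T"
    using h by (auto simp: p_def)
  have pS: "p (Suc k) - p k = h" "p k < p (Suc k)" for k
    using h by (auto simp: p_def algebra_simps)
  have p_ge: "t0 \<le> p k" for k
    using h by (simp add: p_def)
  have p_mono: "p j \<le> p k" if "j \<le> k" for j k
    using that h by (simp add: p_def mult_right_mono)
  have p_le: "p k \<le> T" if "k \<le> Suc n" for k
    using p_mono[OF that] pn by simp
  define D where "D k \<omega> = (case k of 0 \<Rightarrow> 0 | Suc j \<Rightarrow> LINT s:{p j..p k}|lborel. \<beta> s \<omega>)" for k \<omega>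
  define S where "S \<omega> = (LINT s:{t0..T}|lborel. (\<beta> s \<omega>)\<^sup>2)" for \<omega>
  define Y where "Y k \<omega> = x + (\<Sum>j<k. D j \<omega>) + \<sigma> * (B (p k) \<omega> - B t0 \<omega>)" for k \<omega>
  have D_meas: "D k \<in> borel_measurable (F (p k))" if "k \<le> Suc n" for k
  proof (cases k)
    case (Suc j)
    then show ?thesis
      unfolding D_def[abs_def] using p_ge[of j] p_ge[of k] p_le[OF that] t0
      by (auto intro!: measurable_progressive_integral[OF \<beta>])
  qed (simp add: D_def[abs_def])
  have Y_meas: "Y k \<in> borel_measurable (F (p k))" if "k \<le> Suc n" for k
  proof -
    have "D j \<in> borel_measurable (F (p k))" if "j < k" for j
      using D_meas[of j] \<open>k \<le> Suc n\<close> that p_mono[of j k] by (auto intro: measurable_F_mono)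
    moreover have "B (p k) \<in> borel_measurable (F (p k))" "B t0 \<in> borel_measurable (F (p k))"
      using p_ge[of k] p_le[OF that] t0 by (auto intro!: B_measurable)
    ultimately show ?thesis
      unfolding Y_def[abs_def]
      by (intro borel_measurable_add borel_measurable_const borel_measurable_sum borel_measurable_times borel_measurable_diff) auto
  qed
  \<comment> \<open>Cauchy-Schwarz on each block yields a factor h, which cancels the 1 / h in the
    cost of the one-step inequality.\<close>
  have good: "AE \<omega> in M. (\<Sum>j<Suc n. (D j \<omega>)\<^sup>2) \<le> h * S \<omega> \<and>
      (\<Sum>j<Suc n. D j \<omega>) = (LINT s:{t0..t0 + real n * h}|lborel. \<beta> s \<omega>)"
    using int int2
  proof eventually_elim
    case (elim \<omega>)
    have sub: "set_integrable lborel {p j..p (Suc j)} (\<lambda>s. \<beta> s \<omega>)"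
      "set_integrable lborel {p j..p (Suc j)} (\<lambda>s. (\<beta> s \<omega>)\<^sup>2)" if "j < n" for j
      using elim p_ge[of j] p_le[of "Suc j"] that by (auto intro!: set_integrable_lborel_subset[where a=t0 and b=T])
    have "(\<Sum>j<Suc n. (D j \<omega>)\<^sup>2) = (\<Sum>j<n. (LINT s:{p j..p (Suc j)}|lborel. \<beta> s \<omega>)\<^sup>2)"
      by (subst sum.lessThan_Suc_shift) (simp add: D_def)
    also have "\<dots> \<le> (\<Sum>j<n. h * (LINT s:{p j..p (Suc j)}|lborel. (\<beta> s \<omega>)\<^sup>2))"
      using square_integral_le[OF sub] pS by (intro sum_mono) auto
    also have "\<dots> = h * (\<Sum>j<n. integral {p j..p (Suc j)} (\<lambda>s. (\<beta> s \<omega>)\<^sup>2))"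
      using sub by (simp add: set_lborel_integral_eq_integral sum_distrib_left)
    also have "\<dots> = h * integral {t0..p n} (\<lambda>s. (\<beta> s \<omega>)\<^sup>2)"
      unfolding p_def using h p_le[of n] set_lborel_integral_eq_integral(1)[OF elim(2)]
      by (subst integral_partition[where b=T]) (auto simp: p_def)
    also have "\<dots> \<le> h * integral {t0..T} (\<lambda>s. (\<beta> s \<omega>)\<^sup>2)"
      using h p_le[of n] set_lborel_integral_eq_integral(1)[OF elim(2)]
      by (intro mult_left_mono integral_subset_le integrable_subinterval_real[OF set_lborel_integral_eq_integral(1)[OF elim(2)]]) auto
    also have "\<dots> = h * S \<omega>"
      unfolding S_def using elim(2) by (simp add: set_lborel_integral_eq_integral)
    finally have 1: "(\<Sum>j<Suc n. (D j \<omega>)\<^sup>2) \<le> h * S \<omega>" .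
    have "(\<Sum>j<Suc n. D j \<omega>) = (\<Sum>j<n. (LINT s:{p j..p (Suc j)}|lborel. \<beta> s \<omega>))"
      by (subst sum.lessThan_Suc_shift) (simp add: D_def)
    also have "\<dots> = (\<Sum>j<n. integral {p j..p (Suc j)} (\<lambda>s. \<beta> s \<omega>))"
      using sub by (simp add: set_lborel_integral_eq_integral)
    also have "\<dots> = integral {t0..p n} (\<lambda>s. \<beta> s \<omega>)"
      unfolding p_def using h p_le[of n] set_lborel_integral_eq_integral(1)[OF elim(1)]
      by (subst integral_partition[where b=T]) (auto simp: p_def)
    also have "\<dots> = (LINT s:{t0..p n}|lborel. \<beta> s \<omega>)"
      using set_integrable_lborel_subset[OF elim(1), of t0 "p n"] p_le[of n]
      by (simp add: set_lborel_integral_eq_integral)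
    finally show ?case
      using 1 by (simp add: p_def)
  qed
  have D2: "integrable M (\<lambda>\<omega>. (D k \<omega>)\<^sup>2)" if "k \<le> n" for k
  proof (rule Bochner_Integration.integrable_bound)
    show "integrable M (\<lambda>\<omega>. h * S \<omega>)"
      using cost by (simp add: S_def)
    show "(\<lambda>\<omega>. (D k \<omega>)\<^sup>2) \<in> borel_measurable M"
      using measurable_F[OF D_meas[of k]] that by auto
    show "AE \<omega> in M. norm ((D k \<omega>)\<^sup>2) \<le> norm (h * S \<omega>)"
      using good
    proof eventually_elim
      case (elim \<omega>)
      have "(D k \<omega>)\<^sup>2 \<le> (\<Sum>j<Suc n. (D j \<omega>)\<^sup>2)"
        using that by (intro member_le_sum) auto
      also have "\<dots> \<le> h * S \<omega>"
        using elim by simp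
      also have "\<dots> \<le> \<bar>h * S \<omega>\<bar>"
        by (rule abs_ge_self)
      finally show ?case
        unfolding real_norm_def abs_power2 .
    qed
  qed
  have ind: "expectation (\<lambda>\<omega>. V (p k) (Y k \<omega>)) \<le> V t0 x + c / h * (\<Sum>j<k. expectation (\<lambda>\<omega>. (D j \<omega>)\<^sup>2))"
    if "k \<le> Suc n" for k
    using that
  proof (induction k)
    case 0
    then show ?case
      by (simp add: Y_def p0 prob_space)
  next
    case (Suc k)
    have "Y (Suc k) \<omega> = Y k \<omega> + D k \<omega> + \<sigma> * (B (p (Suc k)) \<omega> - B (p k) \<omega>)" for \<omega>
      by (simp add: Y_def algebra_simps)
    then have "expectation (\<lambda>\<omega>. V (p (Suc k)) (Y (Suc k) \<omega>)) \<le>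
      expectation (\<lambda>\<omega>. V (p k) (Y k \<omega>)) + c / (p (Suc k) - p k) * expectation (\<lambda>\<omega>. (D k \<omega>)\<^sup>2)"
      using expectation_V_step_upper[of "p k" "p (Suc k)" "Y k" "D k"] Suc.prems pS[of k] p_ge[of k] t0
        p_le[of "Suc k"] Y_meas[of k] D_meas[of k] D2[of k] by simp
    then show ?case
      using Suc by (simp add: pS distrib_left)
  qed
  have "expectation (\<lambda>\<omega>. g (x + (LINT s:{t0..t0 + real n * h}|lborel. \<beta> s \<omega>) + \<sigma> * (B T \<omega> - B t0 \<omega>))) =
      expectation (\<lambda>\<omega>. V (p (Suc n)) (Y (Suc n) \<omega>))"
  proof (rule integral_cong_AE)
    show "AE \<omega> in M. g (x + (LINT s:{t0..t0 + real n * h}|lborel. \<beta> s \<omega>) + \<sigma> * (B T \<omega> - B t0 \<omega>)) =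
        V (p (Suc n)) (Y (Suc n) \<omega>)"
      using good by eventually_elim (simp only: pn V_T Y_def)
    have "(\<lambda>\<omega>. LINT s:{t0..p n}|lborel. \<beta> s \<omega>) \<in> borel_measurable M"
      using t0 p_ge[of n] p_le[of n] by (intro measurable_F[of _ "p n"] measurable_progressive_integral[OF \<beta>]) auto
    then show "(\<lambda>\<omega>. g (x + (LINT s:{t0..t0 + real n * h}|lborel. \<beta> s \<omega>) + \<sigma> * (B T \<omega> - B t0 \<omega>))) \<in> borel_measurable M"
      using t0 by (intro measurable_compose[OF _ g_measurable] borel_measurable_add borel_measurable_const
          borel_measurable_times borel_measurable_diff B_measurable_M) (auto simp: p_def)
    show "(\<lambda>\<omega>. V (p (Suc n)) (Y (Suc n) \<omega>)) \<in> borel_measurable M"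
      using measurable_F[OF Y_meas[of "Suc n"]] by (intro measurable_compose[OF _ V_measurable]) auto
  qed
  also have "\<dots> \<le> V t0 x + c / h * (\<Sum>j<Suc n. expectation (\<lambda>\<omega>. (D j \<omega>)\<^sup>2))"
    by (rule ind) simp
  finally have 1: "expectation (\<lambda>\<omega>. g (x + (LINT s:{t0..t0 + real n * h}|lborel. \<beta> s \<omega>) + \<sigma> * (B T \<omega> - B t0 \<omega>)))
    \<le> V t0 x + c / h * (\<Sum>j<Suc n. expectation (\<lambda>\<omega>. (D j \<omega>)\<^sup>2))" .
  have "(\<Sum>j<Suc n. expectation (\<lambda>\<omega>. (D j \<omega>)\<^sup>2)) = expectation (\<lambda>\<omega>. \<Sum>j<Suc n. (D j \<omega>)\<^sup>2)"
    using D2 by (subst Bochner_Integration.integral_sum) auto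
  also have "\<dots> \<le> expectation (\<lambda>\<omega>. h * S \<omega>)"
  proof (rule integral_mono_AE)
    show "integrable M (\<lambda>\<omega>. \<Sum>j<Suc n. (D j \<omega>)\<^sup>2)"
      using D2 by (intro Bochner_Integration.integrable_sum) auto
    show "integrable M (\<lambda>\<omega>. h * S \<omega>)"
      using cost by (simp add: S_def)
    show "AE \<omega> in M. (\<Sum>j<Suc n. (D j \<omega>)\<^sup>2) \<le> h * S \<omega>"
      using good by eventually_elim simp
  qed
  also have "\<dots> = h * expectation S"
    by simp
  finally have "c / h * (\<Sum>j<Suc n. expectation (\<lambda>\<omega>. (D j \<omega>)\<^sup>2)) \<le> c / h * (h * expectation S)"
    using h c by (intro mult_left_mono) auto
  also have "\<dots> = c * expectation S"
    using h by simp
  finally show ?thesis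
    using 1 unfolding S_def[symmetric] by linarith
qed

text \<open>Passes from the extended cost in \<open>expected_payoff\<close> to Bochner integrals. A
  control of infinite cost has payoff minus infinity, so the upper bound concerns only the controls
  treated here.\<close>

lemma finite_cost:
  assumes a: "admissible M F T a" and t0: "0 \<le> t0" "t0 < T"
    and fin: "(\<integral>\<^sup>+ \<omega>. (\<integral>\<^sup>+ s\<in>{t0..T}. ennreal (c * (a s \<omega>)\<^sup>2) \<partial>lborel) \<partial>M) < \<infinity>"
  shows "AE \<omega> in M. set_integrable lborel {t0..T} (\<lambda>s. a s \<omega>)"
    and "AE \<omega> in M. set_integrable lborel {t0..T} (\<lambda>s. (a s \<omega>)\<^sup>2)"
    and "integrable M (\<lambda>\<omega>. LINT s:{t0..T}|lborel. (a s \<omega>)\<^sup>2)"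
    and "(\<integral>\<^sup>+ \<omega>. (\<integral>\<^sup>+ s\<in>{t0..T}. ennreal (c * (a s \<omega>)\<^sup>2) \<partial>lborel) \<partial>M)
      = ennreal (c * expectation (\<lambda>\<omega>. LINT s:{t0..T}|lborel. (a s \<omega>)\<^sup>2))"
proof -
  have p: "progressively_measurable F T a"
    using a by (simp add: admissible_def)
  show 1: "AE \<omega> in M. set_integrable lborel {t0..T} (\<lambda>s. a s \<omega>)"
    using admissible_AE_integrable[OF a] T t0 by (auto elim!: eventually_mono intro: set_integrable_lborel_subset)
  let ?I = "\<lambda>\<omega>. \<integral>\<^sup>+ s\<in>{t0..T}. ennreal (c * (a s \<omega>)\<^sup>2) \<partial>lborel"
  let ?S = "\<lambda>\<omega>. LINT s:{t0..T}|lborel. (a s \<omega>)\<^sup>2"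
  have I: "?I \<in> borel_measurable M"
    using t0 by (intro measurable_F[of _ T] measurable_progressive_nn_integral[OF p]) auto
  have "AE \<omega> in M. ?I \<omega> \<noteq> \<infinity>"
    using fin I by (intro nn_integral_noteq_infinite) auto
  with 1 have 2: "AE \<omega> in M. set_integrable lborel {t0..T} (\<lambda>s. (a s \<omega>)\<^sup>2) \<and> ?I \<omega> = ennreal (c * ?S \<omega>)"
  proof eventually_elim
    case (elim \<omega>)
    have "(\<lambda>s. indicator {t0..T} s *\<^sub>R a s \<omega>) \<in> borel_measurable lborel"
      using elim(1) by (simp add: set_integrable_def borel_measurable_integrable)
    then have "(\<lambda>s. c * (indicator {t0..T} s *\<^sub>R a s \<omega>)\<^sup>2) \<in> borel_measurable lborel"
      by measurable
    moreover have *: "c * (indicator {t0..T} s *\<^sub>R a s \<omega>)\<^sup>2 = indicator {t0..T} s *\<^sub>R (c * (a s \<omega>)\<^sup>2)" for s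
      by (simp split: split_indicator)
    ultimately have m: "(\<lambda>s. indicator {t0..T} s *\<^sub>R (c * (a s \<omega>)\<^sup>2)) \<in> borel_measurable lborel"
      by (simp only: *)
    have eq: "(\<integral>\<^sup>+ s. ennreal (indicator {t0..T} s *\<^sub>R (c * (a s \<omega>)\<^sup>2)) \<partial>lborel) = ?I \<omega>"
      by (intro nn_integral_cong) (auto split: split_indicator)
    have i: "set_integrable lborel {t0..T} (\<lambda>s. c * (a s \<omega>)\<^sup>2)"
      unfolding set_integrable_def
    proof (rule integrableI_nonneg[OF m])
      show "AE s in lborel. 0 \<le> indicator {t0..T} s *\<^sub>R (c * (a s \<omega>)\<^sup>2)"
        using c by simp
      show "(\<integral>\<^sup>+ s. ennreal (indicator {t0..T} s *\<^sub>R (c * (a s \<omega>)\<^sup>2)) \<partial>lborel) < \<infinity>"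
        unfolding eq using elim(2) by (simp add: less_top)
    qed
    then have "set_integrable lborel {t0..T} (\<lambda>s. (a s \<omega>)\<^sup>2)"
      using c by simp
    moreover have "?I \<omega> = ennreal (c * ?S \<omega>)"
    proof -
      have "?I \<omega> = ennreal (LINT s:{t0..T}|lborel. c * (a s \<omega>)\<^sup>2)"
        unfolding eq[symmetric] set_lebesgue_integral_def
        by (rule nn_integral_eq_integral[OF i[unfolded set_integrable_def]]) (use c in auto)
      then show ?thesis
        by simp
    qed
    ultimately show ?case ..
  qed
  then show "AE \<omega> in M. set_integrable lborel {t0..T} (\<lambda>s. (a s \<omega>)\<^sup>2)"
    by eventually_elim simp
  have S0: "?S \<omega> \<ge> 0" for \<omega>
    unfolding set_lebesgue_integral_def by (intro integral_nonneg_AE) auto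
  have Sm: "?S \<in> borel_measurable M"
  proof -
    have "progressively_measurable F T (\<lambda>s \<omega>. (a s \<omega>)\<^sup>2)"
      by (rule progressively_measurable_compose[OF p])
          (auto simp: case_prod_beta' intro!: borel_measurable_continuous_onI continuous_intros)
    then show ?thesis
      using t0 by (intro measurable_F[of _ T] measurable_progressive_integral) auto
  qed
  have eq: "(\<integral>\<^sup>+ \<omega>. ?I \<omega> \<partial>M) = (\<integral>\<^sup>+ \<omega>. ennreal (c * ?S \<omega>) \<partial>M)"
    using 2 by (intro nn_integral_cong_AE) (auto elim: eventually_mono)
  have "integrable M (\<lambda>\<omega>. c * ?S \<omega>)"
    using fin S0 c Sm unfolding eq by (intro integrableI_nonneg) auto
  then show 3: "integrable M ?S"
    using c by simp
  show "(\<integral>\<^sup>+ \<omega>. ?I \<omega> \<partial>M) = ennreal (c * expectation ?S)"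
    unfolding eq using nn_integral_eq_integral[OF integrable_mult_right[OF 3, of c]] S0 c by simp
qed

theorem payoff_le_V:
  assumes a: "admissible M F T a" and t0: "0 \<le> t0" "t0 < T"
  shows "expected_payoff M c t0 T
    (\<lambda>\<omega>. g (x + (LINT s:{t0..T}|lborel. a s \<omega>) + \<sigma> * (B T \<omega> - B t0 \<omega>))) a \<le> ereal (V t0 x)"
proof (cases "(\<integral>\<^sup>+ \<omega>. (\<integral>\<^sup>+ s\<in>{t0..T}. ennreal (c * (a s \<omega>)\<^sup>2) \<partial>lborel) \<partial>M) < \<infinity>")
  case False
  then have "(\<integral>\<^sup>+ \<omega>. (\<integral>\<^sup>+ s\<in>{t0..T}. ennreal (c * (a s \<omega>)\<^sup>2) \<partial>lborel) \<partial>M) = \<infinity>"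
    by (simp add: less_top[symmetric])
  then show ?thesis
    by (simp add: expected_payoff_def)
next
  case True
  note fc = finite_cost[OF a t0 True]
  define q where "q = c * expectation (\<lambda>\<omega>. LINT s:{t0..T}|lborel. (a s \<omega>)\<^sup>2)"
  have p: "progressively_measurable F T a"
    using a by (simp add: admissible_def)
  define X where "X \<omega> = x + (LINT s:{t0..T}|lborel. a s \<omega>) + \<sigma> * (B T \<omega> - B t0 \<omega>)" for \<omega>
  have int_meas: "(\<lambda>\<omega>. LINT s:{t0..u}|lborel. a s \<omega>) \<in> borel_measurable M" if "t0 \<le> u" "u \<le> T" for u
    using that t0 by (intro measurable_F[of _ u] measurable_progressive_integral[OF p]) auto
  have [measurable]: "(\<lambda>\<omega>. B T \<omega> - B t0 \<omega>) \<in> borel_measurable M"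
    using t0 by (intro borel_measurable_diff B_measurable_M) auto
  have bound: "expectation (\<lambda>\<omega>. g (X \<omega>)) \<le> V t0 (x + \<delta>) + q" if \<delta>: "\<delta> > 0" for \<delta>
  proof -
    define u where "u n = t0 + real n * ((T - t0) / real (Suc n))" for n
    have u: "t0 \<le> u n" "u n \<le> T" for n
      using t0 mult_right_mono[of "real n" "real (Suc n)" "(T - t0) / real (Suc n)"] by (auto simp: u_def)
    define Y where "Y n \<omega> = x + \<delta> + (LINT s:{t0..u n}|lborel. a s \<omega>) + \<sigma> * (B T \<omega> - B t0 \<omega>)" for n \<omega>
    have [measurable]: "Y n \<in> borel_measurable M" "X \<in> borel_measurable M" for n
      using int_meas[OF u, of n] int_meas[of T] t0 unfolding X_def[abs_def] Y_def[abs_def] by auto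
    have u_lim: "u \<longlonglongrightarrow> T"
    proof -
      have "u n = T - (T - t0) / real (Suc n)" for n
        by (simp add: u_def field_simps)
      then have "u = (\<lambda>n. T - (T - t0) / real (Suc n))" ..
      then show ?thesis
        using tendsto_diff[OF tendsto_const[of T] LIMSEQ_Suc[OF lim_const_over_n[of "T - t0"]]] by simp
    qed
    \<comment> \<open>Along almost every path the head start \<delta> eventually exceeds the error
      of the delay, so the minimum is eventually g (X \<omega>) by monotonicity, whether or not g (Y
      n \<omega>) converges.\<close>
    have "(\<lambda>n. expectation (\<lambda>\<omega>. min (g (X \<omega>)) (g (Y n \<omega>)))) \<longlonglongrightarrow> expectation (\<lambda>\<omega>. g (X \<omega>))"
    proof (rule integral_dominated_convergence[where w="\<lambda>_. C"])
      show "AE \<omega> in M. (\<lambda>n. min (g (X \<omega>)) (g (Y n \<omega>))) \<longlonglongrightarrow> g (X \<omega>)"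
        using fc(1)
      proof eventually_elim
        case (elim \<omega>)
        have "continuous_on {t0..T} (\<lambda>u. integral {t0..u} (\<lambda>s. a s \<omega>))"
          by (rule indefinite_integral_continuous_1[OF set_lborel_integral_eq_integral(1)[OF elim]])
        then have "(\<lambda>n. integral {t0..u n} (\<lambda>s. a s \<omega>)) \<longlonglongrightarrow> integral {t0..T} (\<lambda>s. a s \<omega>)"
          by (rule continuous_on_tendsto_compose[OF _ u_lim]) (use u t0 in auto)
        then have "(\<lambda>n. LINT s:{t0..u n}|lborel. a s \<omega>) \<longlonglongrightarrow> (LINT s:{t0..T}|lborel. a s \<omega>)"
          using set_lborel_integral_eq_integral(2)[OF set_integrable_lborel_subset[OF elim]] u t0 by simp
        then have "(\<lambda>n. Y n \<omega>) \<longlonglongrightarrow> x + \<delta> + (LINT s:{t0..T}|lborel. a s \<omega>) + \<sigma> * (B T \<omega> - B t0 \<omega>)"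
          unfolding Y_def by (intro tendsto_intros)
        then have "\<forall>\<^sub>F n in sequentially. X \<omega> < Y n \<omega>"
          by (rule order_tendstoD) (use \<delta> in \<open>simp add: X_def\<close>)
        then have "\<forall>\<^sub>F n in sequentially. min (g (X \<omega>)) (g (Y n \<omega>)) = g (X \<omega>)"
          by eventually_elim (auto simp: min_def dest: monoD[OF g_mono, OF less_imp_le])
        then show ?case
          by (rule tendsto_eventually)
      qed
      fix n
      show "AE \<omega> in M. norm (min (g (X \<omega>)) (g (Y n \<omega>))) \<le> C"
        using g_bound by (intro always_eventually) (auto simp: min_def)
    qed auto
    moreover have "expectation (\<lambda>\<omega>. min (g (X \<omega>)) (g (Y n \<omega>))) \<le> V t0 (x + \<delta>) + q" for n
    proof -
      have "expectation (\<lambda>\<omega>. min (g (X \<omega>)) (g (Y n \<omega>))) \<le> expectation (\<lambda>\<omega>. g (Y n \<omega>))"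
        using g_bound by (intro integral_mono integrable_const_bound[where B=C]) (auto simp: min_def)
      also have "\<dots> \<le> V t0 (x + \<delta>) + q"
        unfolding Y_def u_def q_def by (rule delayed_control_bound[OF p t0 fc(1-3) refl])
      finally show ?thesis .
    qed
    ultimately show ?thesis
      by (intro LIMSEQ_le_const2) auto
  qed
  \<comment> \<open>The head start is removed inside V t0, which is continuous because t0 < T, and
    not inside \<open>g\<close>, which may jump.\<close>
  have "expectation (\<lambda>\<omega>. g (X \<omega>)) \<le> V t0 x + q"
  proof (rule LIMSEQ_le_const)
    have "isCont (V t0) x"
      using V_DERIV[OF t0(2)] by (rule DERIV_isCont)
    moreover have "(\<lambda>n. x + 1 / real (Suc n)) \<longlonglongrightarrow> x"
      using tendsto_add[OF tendsto_const[of x] LIMSEQ_Suc[OF lim_const_over_n[of 1]]] by simp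
    ultimately show "(\<lambda>n. V t0 (x + 1 / real (Suc n)) + q) \<longlonglongrightarrow> V t0 x + q"
      by (rule tendsto_add[OF isCont_tendsto_compose tendsto_const])
    show "\<exists>N. \<forall>n\<ge>N. expectation (\<lambda>\<omega>. g (X \<omega>)) \<le> V t0 (x + 1 / real (Suc n)) + q"
      using bound by auto
  qed
  moreover have "q \<ge> 0"
    unfolding q_def set_lebesgue_integral_def using c
    by (intro mult_nonneg_nonneg integral_nonneg_AE always_eventually allI) auto
  ultimately show ?thesis
    unfolding expected_payoff_def fc(4) q_def[symmetric] X_def[symmetric] by simp
qed

end

section \<open>The feedback control attains the value function\<close>

lemma LINT_tendsto_upper:
  fixes f :: "real \<Rightarrow> real"
  assumes "set_integrable lborel {a..b} f" "\<And>n. a \<le> u n" "\<And>n. u n \<le> b" "u \<longlonglongrightarrow> b" "a \<le> b"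
  shows "(\<lambda>n. LINT s:{a..u n}|lborel. f s) \<longlonglongrightarrow> (LINT s:{a..b}|lborel. f s)"
proof -
  have "continuous_on {a..b} (\<lambda>u. integral {a..u} f)"
    by (rule indefinite_integral_continuous_1[OF set_lborel_integral_eq_integral(1)[OF assms(1)]])
  then have "(\<lambda>n. integral {a..u n} f) \<longlonglongrightarrow> integral {a..b} f"
    by (rule continuous_on_tendsto_compose[OF _ assms(4)]) (use assms in auto)
  then show ?thesis
    using set_lborel_integral_eq_integral(2)[OF set_integrable_lborel_subset[OF assms(1)]] assms by simp
qed

context monotone_reward
begin

lemma b_path_continuous:
  assumes "continuous_on {u..v} \<phi>" "v < T"
  shows "continuous_on {u..v} (\<lambda>s. b s (\<phi> s))"
proof -
  have "continuous_on {u..v} (\<lambda>s. (s, \<phi> s))"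
    using assms(1) by (intro continuous_on_Pair continuous_on_id)
  then have "continuous_on {u..v} (\<lambda>s. case (s, \<phi> s) of (t, x) \<Rightarrow> b t x)"
    by (rule continuous_on_compose2[OF b_continuous]) (use assms(2) in auto)
  then show ?thesis
    by simp
qed

lemma b_path_bound:
  assumes "s \<le> v" "v < T"
  shows "\<bar>b s y\<bar> \<le> drift_const / sqrt (T - v)"
proof -
  have "\<bar>b s y\<bar> \<le> drift_const / sqrt (T - s)"
    using assms by (intro b_bound) auto
  also have "\<dots> \<le> drift_const / sqrt (T - v)"
    using assms drift_const by (intro divide_left_mono mult_pos_pos) auto
  finally show ?thesis .
qed

lemma b_path_integrable:
  assumes "continuous_on {t0..<T} \<phi>" "t0 < T"
  shows "set_integrable lborel {t0..T} (\<lambda>s. b s (\<phi> s))"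
  unfolding set_integrable_def
proof (rule Bochner_Integration.integrable_bound)
  show "integrable lborel (\<lambda>s. drift_const * (indicator {t0..T} s *\<^sub>R (1 / sqrt (T - s))))"
    using set_integrable_inverse_sqrt[OF assms(2)] unfolding set_integrable_def by (rule integrable_mult_right)
  \<comment> \<open>Cutting the path off outside [t0, T) makes it Borel on the whole line. Within
    [t0, T] the cut only affects s = T, where \<open>b\<close> is 0 for every state.\<close>
  have m: "(\<lambda>s. indicator {t0..<T} s *\<^sub>R \<phi> s) \<in> borel_measurable borel"
    using assms(1) by (intro borel_measurable_continuous_on_indicator) auto
  have "(\<lambda>s. indicator {t0..T} s *\<^sub>R b s (indicator {t0..<T} s *\<^sub>R \<phi> s)) \<in> borel_measurable borel"
    by (intro borel_measurable_scaleR b_measurable m) auto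
  also have "(\<lambda>s. indicator {t0..T} s *\<^sub>R b s (indicator {t0..<T} s *\<^sub>R \<phi> s)) = (\<lambda>s. indicator {t0..T} s *\<^sub>R b s (\<phi> s))"
    by (auto simp: b_def split: split_indicator)
  finally show "(\<lambda>s. indicator {t0..T} s *\<^sub>R b s (\<phi> s)) \<in> borel_measurable lborel"
    by simp
  have "\<bar>b s (\<phi> s)\<bar> \<le> drift_const / sqrt (T - s)" if "s \<le> T" for s
    using b_bound[of s "\<phi> s"] that by (cases "s < T") (auto simp: b_def)
  then show "AE s in lborel. norm (indicator {t0..T} s *\<^sub>R b s (\<phi> s))
      \<le> norm (drift_const * (indicator {t0..T} s *\<^sub>R (1 / sqrt (T - s))))"
    using drift_const by (intro always_eventually) (auto split: split_indicator)
qed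

text \<open>Two successors instead of one, so that already the first term lies strictly between t0
  and T.\<close>

definition approach :: "real \<Rightarrow> nat \<Rightarrow> real" where
  "approach t0 n = T - (T - t0) / real (Suc (Suc n))"

lemma approach:
  assumes "t0 < T"
  shows "t0 < approach t0 n" "approach t0 n < T" "approach t0 \<longlonglongrightarrow> T" "m \<le> n \<Longrightarrow> approach t0 m \<le> approach t0 n"
proof -
  have "(T - t0) / real (Suc (Suc n)) < T - t0"
    using assms by (simp add: divide_less_eq)
  then show "t0 < approach t0 n"
    by (simp add: approach_def)
  show "approach t0 n < T"
    using assms by (simp add: approach_def)
  have "(\<lambda>n. T - (T - t0) / real (Suc (Suc n))) \<longlonglongrightarrow> T - 0"
    by (intro tendsto_diff tendsto_const LIMSEQ_Suc[OF LIMSEQ_Suc[OF lim_const_over_n]])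
  then show "approach t0 \<longlonglongrightarrow> T"
    by (simp add: approach_def[abs_def])
  show "m \<le> n \<Longrightarrow> approach t0 m \<le> approach t0 n"
    using assms unfolding approach_def by (intro diff_left_mono divide_left_mono) auto
qed

end

context controlled
begin

text \<open>A \<open>strong_solution\<close> started from an arbitrary (t0, x): the drift is a
  derivative of the value function, so the value has to be identified at every point and not only at
  (0, 0).\<close>

definition solves :: "real \<Rightarrow> real \<Rightarrow> (real \<Rightarrow> 'a \<Rightarrow> real) \<Rightarrow> bool" where
  "solves t0 x X \<longleftrightarrow> adapted F T X \<and> (\<forall>\<omega>\<in>space M. continuous_on {0..T} (\<lambda>t. X t \<omega>)) \<and>
    (AE \<omega> in M. \<forall>t\<in>{t0..<T}. X t \<omega> = x + (LINT s:{t0..t}|lborel. b s (X s \<omega>)) + \<sigma> * (B t \<omega> - B t0 \<omega>))"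


context
  fixes t0 x X
  assumes X: "solves t0 x X" and t0: "0 \<le> t0" "t0 < T"
begin

lemma X_adapted: "adapted F T X"
  using X by (simp add: solves_def)

lemma X_continuous: "\<omega> \<in> space M \<Longrightarrow> continuous_on {0..T} (\<lambda>t. X t \<omega>)"
  using X by (simp add: solves_def)

lemma X_measurable: "0 \<le> s \<Longrightarrow> s \<le> t \<Longrightarrow> s \<le> T \<Longrightarrow> X s \<in> borel_measurable (F t)"
  using X_adapted by (rule adapted_measurable)

lemma X_measurable_M: "0 \<le> s \<Longrightarrow> s \<le> T \<Longrightarrow> X s \<in> borel_measurable M"
  by (rule measurable_F, rule X_measurable[of s s]) auto

text \<open>At T both sides are limits from the left: the paths of X and B are continuous, and the
  drift is integrable up to T.\<close>

lemma X_equation: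
  "AE \<omega> in M. \<forall>t\<in>{t0..T}. X t \<omega> = x + (LINT s:{t0..t}|lborel. b s (X s \<omega>)) + \<sigma> * (B t \<omega> - B t0 \<omega>)"
proof -
  have "AE \<omega> in M. \<forall>t\<in>{t0..<T}. X t \<omega> = x + (LINT s:{t0..t}|lborel. b s (X s \<omega>)) + \<sigma> * (B t \<omega> - B t0 \<omega>)"
    using X by (simp add: solves_def)
  then show ?thesis
  proof (rule AE_mp, intro AE_I2 impI ballI)
    fix \<omega> t assume \<omega>: "\<omega> \<in> space M" and t: "t \<in> {t0..T}"
      and *: "\<forall>t\<in>{t0..<T}. X t \<omega> = x + (LINT s:{t0..t}|lborel. b s (X s \<omega>)) + \<sigma> * (B t \<omega> - B t0 \<omega>)"
    show "X t \<omega> = x + (LINT s:{t0..t}|lborel. b s (X s \<omega>)) + \<sigma> * (B t \<omega> - B t0 \<omega>)"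
    proof (cases "t < T")
      case False
      then have [simp]: "t = T" using t by simp
      let ?u = "approach t0"
      have u: "?u n \<in> {0..T}" "?u n \<in> {t0..<T}" for n
        using approach(1,2)[OF t0(2), of n] t0 by auto
      have "(\<lambda>n. X (?u n) \<omega>) \<longlonglongrightarrow> X T \<omega>" "(\<lambda>n. B (?u n) \<omega>) \<longlonglongrightarrow> B T \<omega>"
        using u t0 by (auto intro!: continuous_on_tendsto_compose[OF X_continuous[OF \<omega>] approach(3)[OF t0(2)]]
            continuous_on_tendsto_compose[OF B_continuous[OF \<omega>] approach(3)[OF t0(2)]])
      moreover have "(\<lambda>n. LINT s:{t0..?u n}|lborel. b s (X s \<omega>)) \<longlonglongrightarrow> (LINT s:{t0..T}|lborel. b s (X s \<omega>))"
      proof (rule LINT_tendsto_upper[OF b_path_integrable])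
        show "continuous_on {t0..<T} (\<lambda>s. X s \<omega>)"
          using X_continuous[OF \<omega>] by (rule continuous_on_subset) (use t0 in auto)
      qed (use approach[OF t0(2)] t0 in \<open>auto intro: less_imp_le\<close>)
      ultimately have "(\<lambda>n. x + (LINT s:{t0..?u n}|lborel. b s (X s \<omega>)) + \<sigma> * (B (?u n) \<omega> - B t0 \<omega>))
          \<longlonglongrightarrow> x + (LINT s:{t0..T}|lborel. b s (X s \<omega>)) + \<sigma> * (B T \<omega> - B t0 \<omega>)"
        by (intro tendsto_intros)
      moreover have "x + (LINT s:{t0..?u n}|lborel. b s (X s \<omega>)) + \<sigma> * (B (?u n) \<omega> - B t0 \<omega>) = X (?u n) \<omega>" for n
        using *[rule_format, OF u(2)[of n]] by simp
      ultimately show ?thesis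
        using \<open>(\<lambda>n. X (?u n) \<omega>) \<longlonglongrightarrow> X T \<omega>\<close> by (simp add: LIMSEQ_unique)
    qed (use * t in auto)
  qed
qed

text \<open>Zero before t0, where \<open>solves\<close> does not impose the equation: admissibility
  concerns all of [0, T], while the payoff from t0 sees later times only.\<close>

definition feedback :: "real \<Rightarrow> 'a \<Rightarrow> real" where
  "feedback s \<omega> = (if s < t0 then 0 else b s (X s \<omega>))"

lemma feedback_progressive: "progressively_measurable F T feedback"
proof -
  have "(\<lambda>(s, y). if s < t0 then 0 else b s y) = (\<lambda>p. if p \<in> {..<t0} \<times> UNIV then 0 else (\<lambda>(t, x). b t x) p)"
    by (auto simp: fun_eq_iff)
  moreover have "(\<lambda>p. if p \<in> {..<t0} \<times> (UNIV :: real set) then 0 else (\<lambda>(t, x). b t x) p) \<in> borel_measurable borel"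
    using b_measurable2 by (intro measurable_If_set) (auto intro!: borel_open open_Times)
  ultimately show ?thesis
    unfolding feedback_def[abs_def]
    by (intro progressively_measurable_compose[OF progressively_measurable_of_continuous[OF X_adapted X_continuous]]) simp_all
qed

lemma feedback_integral: "(LINT s:{t0..t}|lborel. feedback s \<omega>) = (LINT s:{t0..t}|lborel. b s (X s \<omega>))"
  by (intro set_lebesgue_integral_cong) (auto simp: feedback_def)

lemma feedback_admissible: "admissible M F T feedback"
  unfolding admissible_def
proof
  show "progressively_measurable F T feedback"
    by (rule feedback_progressive)
  let ?f = "\<lambda>s. indicator {t0..T} s *\<^sub>R (1 / sqrt (T - s))"
  have i: "integrable lborel (\<lambda>s. drift_const * ?f s)"
    using set_integrable_inverse_sqrt[OF t0(2)] unfolding set_integrable_def by (rule integrable_mult_right)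
  have "(\<integral>\<^sup>+ s\<in>{0..T}. ennreal \<bar>feedback s \<omega>\<bar> \<partial>lborel) \<le> ennreal (LINT s|lborel. drift_const * ?f s)" for \<omega>
  proof -
    have "\<bar>b s y\<bar> \<le> drift_const / sqrt (T - s)" if "s \<le> T" for s y
      using b_bound[of s y] that by (cases "s < T") (auto simp: b_def)
    then have "(\<integral>\<^sup>+ s\<in>{0..T}. ennreal \<bar>feedback s \<omega>\<bar> \<partial>lborel) \<le> (\<integral>\<^sup>+ s. ennreal (drift_const * ?f s) \<partial>lborel)"
      by (intro nn_integral_mono) (auto simp: feedback_def intro!: ennreal_leI split: split_indicator)
    also have "\<dots> = ennreal (LINT s|lborel. drift_const * ?f s)"
      using drift_const by (intro nn_integral_eq_integral[OF i] always_eventually) (auto split: split_indicator)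
    finally show ?thesis .
  qed
  then have "(\<integral>\<^sup>+ \<omega>. (\<integral>\<^sup>+ s\<in>{0..T}. ennreal \<bar>feedback s \<omega>\<bar> \<partial>lborel) \<partial>M)
      \<le> (\<integral>\<^sup>+ \<omega>. ennreal (LINT s|lborel. drift_const * ?f s) \<partial>M)"
    by (intro nn_integral_mono)
  also have "\<dots> < \<infinity>"
    by (simp add: emeasure_space_1)
  finally show "(\<integral>\<^sup>+ \<omega>. (\<integral>\<^sup>+ s\<in>{0..T}. ennreal \<bar>feedback s \<omega>\<bar> \<partial>lborel) \<partial>M) < \<infinity>" .
qed

lemma expectation_V_step_lower:
  assumes st: "t0 \<le> s" "s < t" "t \<le> u" "u < T"
    and small: "sqrt (t - s) * drift_const \<le> \<sigma> * sqrt (T - u)"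
    and L: "L = 2 * c * drift_const / sqrt (T - u)"
    and e: "e = (\<lambda>\<omega>. \<bar>X t \<omega> - X s \<omega> - \<sigma> * (B t \<omega> - B s \<omega>) - (t - s) * b t (X s \<omega>)\<bar>)"
    and ei: "integrable M e"
  shows "expectation (\<lambda>\<omega>. V s (X s \<omega>)) + c * (t - s) * expectation (\<lambda>\<omega>. (b t (X s \<omega>))\<^sup>2)
      - gap_const u * (t - s)\<^sup>2 - L * expectation e \<le> expectation (\<lambda>\<omega>. V t (X t \<omega>))"
proof -
  have [measurable]: "X s \<in> borel_measurable M" "X t \<in> borel_measurable M"
    "B s \<in> borel_measurable M" "B t \<in> borel_measurable M"
    using st t0 by (auto intro!: X_measurable_M B_measurable_M)
  define Y where "Y \<omega> = X s \<omega> + (t - s) * b t (X s \<omega>)" for \<omega>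
  have Y: "Y \<in> borel_measurable (F s)"
    unfolding Y_def[abs_def] using st t0 X_measurable[of s s]
    by (intro borel_measurable_add borel_measurable_times borel_measurable_const b_measurable) auto
  have [measurable]: "Y \<in> borel_measurable M"
    using Y by (rule measurable_F)
  have L0: "L \<ge> 0"
    using c drift_const st by (simp add: L)
  have bi: "integrable M (\<lambda>\<omega>. (b t (X s \<omega>))\<^sup>2)"
  proof (rule integrable_const_bound)
    show "AE \<omega> in M. norm ((b t (X s \<omega>))\<^sup>2) \<le> (drift_const / sqrt (T - u))\<^sup>2"
      unfolding real_norm_def abs_power2
      by (intro always_eventually allI abs_le_square_iff[THEN iffD1] order_trans[OF b_path_bound[OF st(3,4)] abs_ge_self])
  qed measurable
  have "gap_const t \<le> gap_const u"
    unfolding gap_const_def using \<kappa> \<sigma> curv_nonneg[of t] curv_mono[OF st(3,4)] st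
    by (intro mult_right_mono mult_left_mono power_mono integral_nonneg_AE) auto
  then have gap: "gap_const t * (t - s)\<^sup>2 \<le> gap_const u * (t - s)\<^sup>2"
    by (intro mult_right_mono) auto
  have small': "sqrt (t - s) * drift_const \<le> \<sigma> * sqrt (T - t)"
  proof -
    have "\<sigma> * sqrt (T - u) \<le> \<sigma> * sqrt (T - t)"
      using \<sigma> st by (intro mult_left_mono) auto
    then show ?thesis
      using small by linarith
  qed
  have "expectation (\<lambda>\<omega>. V s (X s \<omega>)) + c * (t - s) * expectation (\<lambda>\<omega>. (b t (X s \<omega>))\<^sup>2) - gap_const u * (t - s)\<^sup>2
      = expectation (\<lambda>\<omega>. V s (X s \<omega>) + c * (t - s) * (b t (X s \<omega>))\<^sup>2 - gap_const u * (t - s)\<^sup>2)"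
    using V_integrable[of "X s" s] bi by (simp add: prob_space)
  also have "\<dots> \<le> expectation (\<lambda>\<omega>. heat (\<sigma> * sqrt (t - s)) (V t) (Y \<omega>))"
  proof (rule integral_mono)
    show "integrable M (\<lambda>\<omega>. V s (X s \<omega>) + c * (t - s) * (b t (X s \<omega>))\<^sup>2 - gap_const u * (t - s)\<^sup>2)"
      using V_integrable[of "X s" s] bi by simp
    have "\<bar>heat r (V t) x\<bar> \<le> C" for r x
      using heat_bounds[of "V t" "-C" C r x] V_bound[of t] by (auto simp: abs_le_iff minus_le_iff)
    then show "integrable M (\<lambda>\<omega>. heat (\<sigma> * sqrt (t - s)) (V t) (Y \<omega>))"
      by (intro integrable_const_bound[where B=C]) auto
    show "V s (X s \<omega>) + c * (t - s) * (b t (X s \<omega>))\<^sup>2 - gap_const u * (t - s)\<^sup>2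
        \<le> heat (\<sigma> * sqrt (t - s)) (V t) (Y \<omega>)" for \<omega>
      using V_step_lower[of s t "X s \<omega>"] st small' gap unfolding Y_def by linarith
  qed
  also have "\<dots> = expectation (\<lambda>\<omega>. V t (Y \<omega> + \<sigma> * (B t \<omega> - B s \<omega>)))"
    using V_bound st t0 by (intro markov[symmetric] Y) auto
  also have "\<dots> \<le> expectation (\<lambda>\<omega>. V t (X t \<omega>) + L * e \<omega>)"
  proof (rule integral_mono)
    show "integrable M (\<lambda>\<omega>. V t (Y \<omega> + \<sigma> * (B t \<omega> - B s \<omega>)))"
      by (intro V_integrable) measurable
    show "integrable M (\<lambda>\<omega>. V t (X t \<omega>) + L * e \<omega>)"
      using V_integrable[of "X t" t] ei by simp
    show "V t (Y \<omega> + \<sigma> * (B t \<omega> - B s \<omega>)) \<le> V t (X t \<omega>) + L * e \<omega>" for \<omega>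
    proof -
      have "V t (Y \<omega> + \<sigma> * (B t \<omega> - B s \<omega>)) - V t (X t \<omega>)
          \<le> 2 * c * drift_const / sqrt (T - t) * \<bar>Y \<omega> + \<sigma> * (B t \<omega> - B s \<omega>) - X t \<omega>\<bar>"
        using V_Lipschitz[of t "Y \<omega> + \<sigma> * (B t \<omega> - B s \<omega>)" "X t \<omega>"] st by linarith
      also have "\<bar>Y \<omega> + \<sigma> * (B t \<omega> - B s \<omega>) - X t \<omega>\<bar> = e \<omega>"
        by (simp add: e Y_def abs_minus_commute algebra_simps)
      also have "2 * c * drift_const / sqrt (T - t) * e \<omega> \<le> L * e \<omega>"
        unfolding L using st c drift_const
        by (intro mult_right_mono divide_left_mono mult_pos_pos) (auto simp: e)
      finally show ?thesis
        by simp
    qed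
  qed
  also have "\<dots> = expectation (\<lambda>\<omega>. V t (X t \<omega>)) + L * expectation e"
    using V_integrable[of "X t" t] ei by simp
  finally show ?thesis
    by simp
qed

text \<open>Sum of the one-step bounds over a partition of mesh h: the gaps add up to O(h), the
  local errors to o(1), and the squared drifts to a Riemann sum of the cost. The constants are
  finite at u < T and blow up as u tends to T.\<close>

lemma value_decrease:
  assumes u: "t0 < u" "u < T"
  shows "V t0 x + c * expectation (\<lambda>\<omega>. LINT s:{t0..u}|lborel. (feedback s \<omega>)\<^sup>2) \<le> expectation (\<lambda>\<omega>. V u (X u \<omega>))"
proof -
  define K where "K = drift_const / sqrt (T - u)"
  define L where "L = 2 * c * drift_const / sqrt (T - u)"
  have K0: "K > 0" and L0: "L > 0"
    using drift_const c u by (auto simp: K_def L_def)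
  have bK: "\<bar>b s y\<bar> \<le> K" if "s \<le> u" for s y
    unfolding K_def using that u by (intro b_path_bound) auto
  define h where "h n = (u - t0) / real (Suc n)" for n
  have h0: "h n > 0" and hn: "real (Suc n) * h n = u - t0" for n
    using u by (auto simp: h_def)
  define p where "p n k = t0 + real k * h n" for n k
  have p0: "p n 0 = t0" and pn: "p n (Suc n) = u" and pS: "p n (Suc k) - p n k = h n" for n k
    using hn[of n] by (auto simp: p_def algebra_simps)
  have p_lt: "p n k < p n (Suc k)" for n k
    using pS[of n k] h0[of n] by linarith
  have p_ge: "t0 \<le> p n k" for n k
    using h0[of n] by (simp add: p_def)
  have p_le: "p n k \<le> u" if "k \<le> Suc n" for n k
  proof -
    have "real k * h n \<le> real (Suc n) * h n"
      using that h0[of n] by (intro mult_right_mono) auto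
    then show ?thesis
      using hn[of n] by (simp add: p_def)
  qed
  define e where "e n k \<omega> = \<bar>X (p n (Suc k)) \<omega> - X (p n k) \<omega> - \<sigma> * (B (p n (Suc k)) \<omega> - B (p n k) \<omega>)
      - (p n (Suc k) - p n k) * b (p n (Suc k)) (X (p n k) \<omega>)\<bar>" for n k \<omega>
  define I where "I \<omega> = (LINT s:{t0..u}|lborel. (feedback s \<omega>)\<^sup>2)" for \<omega>
  have Xm [measurable]: "X (p n k) \<in> borel_measurable M" if "k \<le> Suc n" for n k
    using p_le[OF that] p_ge[of n k] u t0 by (intro X_measurable_M) auto
  have Bm [measurable]: "B (p n k) \<in> borel_measurable M" if "k \<le> Suc n" for n k
    using p_le[OF that] p_ge[of n k] u t0 by (intro B_measurable_M) auto
  have em: "e n k \<in> borel_measurable M" if "k \<le> n" for n k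
    unfolding e_def[abs_def] using that
    by (intro borel_measurable_abs borel_measurable_diff borel_measurable_times borel_measurable_const b_measurable Xm Bm) auto
  have path: "AE \<omega> in M. \<forall>n k. k \<le> n \<longrightarrow> e n k \<omega> = \<bar>integral {p n k..p n (Suc k)} (\<lambda>s. b s (X s \<omega>)) - h n * b (p n (Suc k)) (X (p n k) \<omega>)\<bar>"
    using X_equation
  proof (rule AE_mp, intro AE_I2 impI allI)
    fix \<omega> and n k :: nat assume \<omega>: "\<omega> \<in> space M" and "k \<le> n"
      and *: "\<forall>t\<in>{t0..T}. X t \<omega> = x + (LINT s:{t0..t}|lborel. b s (X s \<omega>)) + \<sigma> * (B t \<omega> - B t0 \<omega>)"
    have c: "continuous_on {t0..u} (\<lambda>s. b s (X s \<omega>))"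
      by (rule b_path_continuous[OF continuous_on_subset[OF X_continuous[OF \<omega>]]]) (use u t0 in auto)
    have l: "(LINT s:{t0..t}|lborel. b s (X s \<omega>)) = integral {t0..t} (\<lambda>s. b s (X s \<omega>))" if "t \<le> u" for t
      by (intro set_lborel_integral_eq_integral(2) set_integrable_lborel_continuous continuous_on_subset[OF c]) (use that in auto)
    have 1: "X (p n j) \<omega> = x + integral {t0..p n j} (\<lambda>s. b s (X s \<omega>)) + \<sigma> * (B (p n j) \<omega> - B t0 \<omega>)" if "j \<le> Suc n" for j
      using *[rule_format, of "p n j"] p_ge[of n j] p_le[OF that] u l[of "p n j"] by simp
    have "integral {t0..p n k} (\<lambda>s. b s (X s \<omega>)) + integral {p n k..p n (Suc k)} (\<lambda>s. b s (X s \<omega>)) =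
        integral {t0..p n (Suc k)} (\<lambda>s. b s (X s \<omega>))"
      using p_lt[of n k] p_ge[of n k] p_le[of "Suc k" n] \<open>k \<le> n\<close>
      by (intro Henstock_Kurzweil_Integration.integral_combine integrable_continuous_real continuous_on_subset[OF c]) auto
    then show "e n k \<omega> = \<bar>integral {p n k..p n (Suc k)} (\<lambda>s. b s (X s \<omega>)) - h n * b (p n (Suc k)) (X (p n k) \<omega>)\<bar>"
      unfolding e_def pS using 1[of k] 1[of "Suc k"] \<open>k \<le> n\<close> by (simp add: algebra_simps)
  qed
  have e_bound: "AE \<omega> in M. \<forall>n k. k \<le> n \<longrightarrow> e n k \<omega> \<le> 2 * K * h n"
    using path
  proof (rule AE_mp, intro AE_I2 impI allI)
    fix \<omega> and n k :: nat assume \<omega>: "\<omega> \<in> space M" and k: "k \<le> n"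
      and *: "\<forall>n k. k \<le> n \<longrightarrow> e n k \<omega> = \<bar>integral {p n k..p n (Suc k)} (\<lambda>s. b s (X s \<omega>)) - h n * b (p n (Suc k)) (X (p n k) \<omega>)\<bar>"
    have "norm (integral {p n k..p n (Suc k)} (\<lambda>s. b s (X s \<omega>))) \<le> K * (p n (Suc k) - p n k)"
    proof (rule integral_bound)
      show "continuous_on {p n k..p n (Suc k)} (\<lambda>s. b s (X s \<omega>))"
        using p_ge[of n k] p_le[of "Suc k" n] k u t0
        by (intro b_path_continuous[OF continuous_on_subset[OF X_continuous[OF \<omega>]]]) auto
      show "norm (b s (X s \<omega>)) \<le> K" if "s \<in> {p n k..p n (Suc k)}" for s
        using bK[of s] that p_le[of "Suc k" n] k by simp
    qed (use p_lt[of n k] in auto)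
    moreover have "\<bar>h n * b (p n (Suc k)) (X (p n k) \<omega>)\<bar> \<le> h n * K"
      unfolding abs_mult using bK[of "p n (Suc k)"] p_le[of "Suc k" n] k h0[of n] by (intro mult_mono) auto
    moreover have "\<bar>i - v\<bar> \<le> 2 * K * w" if "\<bar>i\<bar> \<le> K * w" "\<bar>v\<bar> \<le> w * K" for i v w
    proof -
      have "\<bar>i - v\<bar> \<le> K * w + w * K"
        using that by linarith
      then show ?thesis
        by simp
    qed
    ultimately show "e n k \<omega> \<le> 2 * K * h n"
      unfolding *[rule_format, OF k] pS real_norm_def by blast
  qed
  have ei: "integrable M (e n k)" if "k \<le> n" for n k
  proof (rule integrable_const_bound)
    show "AE \<omega> in M. norm (e n k \<omega>) \<le> 2 * K * h n"
      using e_bound by eventually_elim (use that in \<open>auto simp: e_def\<close>)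
  qed (rule em[OF that])
  have b2i: "integrable M (\<lambda>\<omega>. (b (p n (Suc k)) (X (p n k) \<omega>))\<^sup>2)" if "k \<le> n" for n k
  proof (rule integrable_const_bound)
    show "AE \<omega> in M. norm ((b (p n (Suc k)) (X (p n k) \<omega>))\<^sup>2) \<le> K\<^sup>2"
      using bK[of "p n (Suc k)"] p_le[of "Suc k" n] that K0
      by (intro always_eventually) (auto simp: abs_le_square_iff[symmetric])
    show "(\<lambda>\<omega>. (b (p n (Suc k)) (X (p n k) \<omega>))\<^sup>2) \<in> borel_measurable M"
      using that by (intro borel_measurable_power b_measurable borel_measurable_const Xm) auto
  qed
  \<comment> \<open>Riemann sum of the cost minus the accumulated local errors, so that one
    dominated convergence settles both limits.\<close>
  define Z where "Z n \<omega> = (\<Sum>k<Suc n. c * h n * (b (p n (Suc k)) (X (p n k) \<omega>))\<^sup>2 - L * e n k \<omega>)" for n \<omega>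
  have Zi: "integrable M (Z n)" for n
    unfolding Z_def[abs_def] using ei[of _ n] b2i[of _ n]
    by (intro Bochner_Integration.integrable_sum Bochner_Integration.integrable_diff integrable_mult_right) auto
  have EZ: "expectation (Z n) = (\<Sum>k<Suc n. c * h n * expectation (\<lambda>\<omega>. (b (p n (Suc k)) (X (p n k) \<omega>))\<^sup>2) - L * expectation (e n k))" for n
    unfolding Z_def[abs_def] using ei[of _ n] b2i[of _ n]
    by (subst Bochner_Integration.integral_sum) auto
  have "(\<lambda>n. sqrt (h n) * drift_const) \<longlonglongrightarrow> sqrt 0 * drift_const"
    unfolding h_def by (intro tendsto_intros tendsto_real_sqrt LIMSEQ_Suc[OF lim_const_over_n])
  then have small: "\<forall>\<^sub>F n in sequentially. sqrt (h n) * drift_const < \<sigma> * sqrt (T - u)"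
    by (rule order_tendstoD) (use \<sigma> u in auto)
  have main: "\<forall>\<^sub>F n in sequentially. V t0 x + expectation (Z n) - gap_const u * (u - t0) * h n \<le> expectation (\<lambda>\<omega>. V u (X u \<omega>))"
    using small
  proof eventually_elim
    case (elim n)
    have "V t0 x + (\<Sum>j<k. c * h n * expectation (\<lambda>\<omega>. (b (p n (Suc j)) (X (p n j) \<omega>))\<^sup>2) - L * expectation (e n j))
        - real k * (gap_const u * (h n)\<^sup>2) \<le> expectation (\<lambda>\<omega>. V (p n k) (X (p n k) \<omega>))" if "k \<le> Suc n" for k
      using that
    proof (induction k)
      case 0
      have "expectation (\<lambda>\<omega>. V t0 (X t0 \<omega>)) = expectation (\<lambda>\<omega>. V t0 x)"
      proof (rule integral_cong_AE)
        show "AE \<omega> in M. V t0 (X t0 \<omega>) = V t0 x"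
          using X_equation
        proof eventually_elim
          case (elim \<omega>)
          have "(LINT s:{t0..t0}|lborel. b s (X s \<omega>)) = 0"
            unfolding set_lebesgue_integral_def
            by (rule integral_eq_zero_AE, rule AE_mp[OF AE_lborel_singleton[of t0]]) auto
          then have "X t0 \<omega> = x"
            using elim[rule_format, of t0] t0 by simp
          then show ?case by simp
        qed
        show "(\<lambda>\<omega>. V t0 (X t0 \<omega>)) \<in> borel_measurable M"
          using Xm[of 0 n] by (simp add: p0)
      qed simp
      then show ?case
        by (simp add: p0 prob_space)
    next
      case (Suc k)
      have "expectation (\<lambda>\<omega>. V (p n k) (X (p n k) \<omega>))
          + c * (p n (Suc k) - p n k) * expectation (\<lambda>\<omega>. (b (p n (Suc k)) (X (p n k) \<omega>))\<^sup>2)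
          - gap_const u * (p n (Suc k) - p n k)\<^sup>2 - L * expectation (e n k) \<le> expectation (\<lambda>\<omega>. V (p n (Suc k)) (X (p n (Suc k)) \<omega>))"
      proof (rule expectation_V_step_lower)
        show "e n k = (\<lambda>\<omega>. \<bar>X (p n (Suc k)) \<omega> - X (p n k) \<omega> - \<sigma> * (B (p n (Suc k)) \<omega> - B (p n k) \<omega>)
            - (p n (Suc k) - p n k) * b (p n (Suc k)) (X (p n k) \<omega>)\<bar>)"
          by (rule ext) (simp only: e_def)
        show "sqrt (p n (Suc k) - p n k) * drift_const \<le> \<sigma> * sqrt (T - u)"
          using elim unfolding pS by simp
        show "integrable M (e n k)"
          using Suc.prems by (intro ei) simp
      qed (use p_ge[of n k] p_lt[of n k] p_le[of "Suc k" n] Suc.prems u L_def in auto)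
      moreover have "real (Suc k) * (gap_const u * (h n)\<^sup>2) = real k * (gap_const u * (h n)\<^sup>2) + gap_const u * (h n)\<^sup>2"
        by (simp add: distrib_right)
      ultimately show ?case
        using Suc.IH Suc.prems unfolding pS sum.lessThan_Suc by linarith
    qed
    from this[of "Suc n"] have "V t0 x + expectation (Z n) - real (Suc n) * (gap_const u * (h n)\<^sup>2) \<le> expectation (\<lambda>\<omega>. V u (X u \<omega>))"
      by (simp only: pn EZ order_refl simp_thms)
    moreover have "real (Suc n) * (gap_const u * (h n)\<^sup>2) = gap_const u * (u - t0) * h n"
      unfolding hn[of n, symmetric] by (simp only: power2_eq_square ac_simps)
    ultimately show ?case
      by linarith
  qed
  have limZ: "(\<lambda>n. expectation (Z n)) \<longlonglongrightarrow> expectation (\<lambda>\<omega>. c * I \<omega>)"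
  proof (rule integral_dominated_convergence[where w="\<lambda>_. (c * K\<^sup>2 + 2 * L * K) * (u - t0)"])
    show "(\<lambda>\<omega>. c * I \<omega>) \<in> borel_measurable M"
    proof -
      have "progressively_measurable F T (\<lambda>s \<omega>. (feedback s \<omega>)\<^sup>2)"
        by (rule progressively_measurable_compose[OF feedback_progressive])
          (auto simp: case_prod_beta' intro!: borel_measurable_continuous_onI continuous_intros)
      then have "I \<in> borel_measurable M"
        unfolding I_def[abs_def] using t0 u by (intro measurable_F[of _ u] measurable_progressive_integral) auto
      then show ?thesis by simp
    qed
    show "Z n \<in> borel_measurable M" for n
      using Zi by (rule borel_measurable_integrable)
    show "AE \<omega> in M. norm (Z n \<omega>) \<le> (c * K\<^sup>2 + 2 * L * K) * (u - t0)" for n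
      using e_bound
    proof eventually_elim
      case (elim \<omega>)
      have "norm (Z n \<omega>) \<le> (\<Sum>k<Suc n. (c * K\<^sup>2 + 2 * L * K) * h n)"
        unfolding Z_def
      proof (rule sum_norm_le)
        fix k assume "k \<in> {..<Suc n}"
        then have k: "k \<le> n" by simp
        have "(b (p n (Suc k)) (X (p n k) \<omega>))\<^sup>2 \<le> K\<^sup>2"
          using bK[of "p n (Suc k)"] p_le[of "Suc k" n] k K0 by (auto simp: abs_le_square_iff[symmetric])
        then have "c * h n * (b (p n (Suc k)) (X (p n k) \<omega>))\<^sup>2 \<le> c * h n * K\<^sup>2"
          using c h0[of n] by (intro mult_left_mono) auto
        moreover have "L * e n k \<omega> \<le> L * (2 * K * h n)"
          using elim k L0 by (intro mult_left_mono) auto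
        moreover have "0 \<le> c * h n * (b (p n (Suc k)) (X (p n k) \<omega>))\<^sup>2" "0 \<le> L * e n k \<omega>"
          using c h0[of n] L0 by (auto simp: e_def)
        ultimately have "\<bar>c * h n * (b (p n (Suc k)) (X (p n k) \<omega>))\<^sup>2 - L * e n k \<omega>\<bar> \<le> c * h n * K\<^sup>2 + L * (2 * K * h n)"
          by linarith
        then show "norm (c * h n * (b (p n (Suc k)) (X (p n k) \<omega>))\<^sup>2 - L * e n k \<omega>) \<le> (c * K\<^sup>2 + 2 * L * K) * h n"
          by (simp add: algebra_simps)
      qed
      also have "\<dots> = (c * K\<^sup>2 + 2 * L * K) * (real (Suc n) * h n)"
        by (simp add: algebra_simps)
      finally show ?case
        unfolding hn .
    qed
    show "AE \<omega> in M. (\<lambda>n. Z n \<omega>) \<longlonglongrightarrow> c * I \<omega>"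
      using path
    proof (rule AE_mp, intro AE_I2 impI)
      fix \<omega> assume \<omega>: "\<omega> \<in> space M"
        and path: "\<forall>n k. k \<le> n \<longrightarrow> e n k \<omega> = \<bar>integral {p n k..p n (Suc k)} (\<lambda>s. b s (X s \<omega>)) - h n * b (p n (Suc k)) (X (p n k) \<omega>)\<bar>"
      \<comment> \<open>Time and state are separate arguments: block k uses the drift at its right
        end and the state at its left end.\<close>
      define f where "f = (\<lambda>q. b (fst q) (X (snd q) \<omega>))"
      have Xc: "continuous_on {t0..u} (\<lambda>s. X s \<omega>)"
        by (intro continuous_on_subset[OF X_continuous[OF \<omega>]]) (use u t0 in auto)
      have fc: "continuous_on ({t0..u} \<times> {t0..u}) f"
      proof -
        have "continuous_on ({t0..u} \<times> {t0..u}) (\<lambda>q. X (snd q) \<omega>)"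
          by (rule continuous_on_compose2[OF Xc continuous_on_snd[OF continuous_on_id]]) auto
        then have "continuous_on ({t0..u} \<times> {t0..u}) (\<lambda>q. (fst q, X (snd q) \<omega>))"
          by (intro continuous_on_Pair continuous_on_fst continuous_on_id)
        then have "continuous_on ({t0..u} \<times> {t0..u}) (\<lambda>q. case (fst q, X (snd q) \<omega>) of (t, x) \<Rightarrow> b t x)"
          by (rule continuous_on_compose2[OF b_continuous]) (use u in auto)
        then show ?thesis
          by (simp add: f_def)
      qed
      have f2c: "continuous_on ({t0..u} \<times> {t0..u}) (\<lambda>q. (f q)\<^sup>2)"
        by (intro continuous_intros fc)
      have Ieq: "I \<omega> = integral {t0..u} (\<lambda>s. (b s (X s \<omega>))\<^sup>2)"
      proof -
        have "I \<omega> = (LINT s:{t0..u}|lborel. (b s (X s \<omega>))\<^sup>2)"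
          unfolding I_def by (intro set_lebesgue_integral_cong) (auto simp: feedback_def)
        also have "\<dots> = integral {t0..u} (\<lambda>s. (b s (X s \<omega>))\<^sup>2)"
          by (intro set_lborel_integral_eq_integral(2) set_integrable_lborel_continuous continuous_on_power
              b_path_continuous Xc u)
        finally show ?thesis .
      qed
      show "(\<lambda>n. Z n \<omega>) \<longlonglongrightarrow> c * I \<omega>"
      proof (rule LIMSEQ_I)
        fix r :: real assume r: "r > 0"
        \<comment> \<open>Each of the n + 1 blocks contributes at most (c + L) * \<epsilon> * h n,
          in total q * \<epsilon> = r / 2.\<close>
        define q where "q = (c + L) * (u - t0)"
        define \<epsilon> where "\<epsilon> = r / (2 * q)"
        have q: "q > 0"
          using c L0 u by (simp add: q_def)
        have "(c + L) * \<epsilon> * (u - t0) = q * \<epsilon>"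
          by (simp add: q_def)
        also have "\<dots> = r / 2"
          using q by (simp add: \<epsilon>_def)
        finally have \<epsilon>: "\<epsilon> > 0" "(c + L) * \<epsilon> * (u - t0) < r"
          using r q by (auto simp: \<epsilon>_def)
        have "\<forall>\<^sub>F n in sequentially. norm (Z n \<omega> - c * I \<omega>) < r"
          using uniform_Riemann_error[OF fc u(1) \<epsilon>(1)] uniform_Riemann_error[OF f2c u(1) \<epsilon>(1)]
        proof eventually_elim
          case (elim n)
          have e1: "e n k \<omega> \<le> \<epsilon> * h n" if "k \<le> n" for k
            using elim(1)[rule_format, OF that] path that
            by (simp add: Let_def f_def p_def h_def)
          have e2: "\<bar>integral {p n k..p n (Suc k)} (\<lambda>s. (b s (X s \<omega>))\<^sup>2) - h n * (b (p n (Suc k)) (X (p n k) \<omega>))\<^sup>2\<bar> \<le> \<epsilon> * h n" if "k \<le> n" for k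
            using elim(2)[rule_format, OF that] by (simp add: Let_def f_def p_def h_def)
          have "I \<omega> = (\<Sum>k<Suc n. integral {p n k..p n (Suc k)} (\<lambda>s. (b s (X s \<omega>))\<^sup>2))"
            unfolding Ieq p_def using hn[of n] h0[of n]
            by (subst integral_partition[where b=u]) (auto intro!: integrable_continuous_real continuous_on_power b_path_continuous Xc u)
          then have eq: "Z n \<omega> - c * I \<omega> = (\<Sum>k<Suc n. (c * h n * (b (p n (Suc k)) (X (p n k) \<omega>))\<^sup>2 - L * e n k \<omega>)
              - c * integral {p n k..p n (Suc k)} (\<lambda>s. (b s (X s \<omega>))\<^sup>2))"
            unfolding Z_def by (simp only: sum_distrib_left sum_subtractf)
          have "norm (Z n \<omega> - c * I \<omega>) \<le> (\<Sum>k<Suc n. (c + L) * \<epsilon> * h n)"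
            unfolding eq
          proof (rule sum_norm_le)
            fix k assume "k \<in> {..<Suc n}"
            then have k: "k \<le> n" by simp
            define i v where "i = integral {p n k..p n (Suc k)} (\<lambda>s. (b s (X s \<omega>))\<^sup>2)"
              and "v = h n * (b (p n (Suc k)) (X (p n k) \<omega>))\<^sup>2"
            have "\<bar>c * (v - i)\<bar> \<le> c * (\<epsilon> * h n)"
              unfolding abs_mult using e2[OF k] c by (intro mult_mono) (auto simp: i_def v_def abs_minus_commute)
            moreover have "\<bar>L * e n k \<omega>\<bar> \<le> L * (\<epsilon> * h n)"
              unfolding abs_mult using e1[OF k] L0 by (intro mult_mono) (auto simp: e_def)
            ultimately have "\<bar>c * (v - i) - L * e n k \<omega>\<bar> \<le> c * (\<epsilon> * h n) + L * (\<epsilon> * h n)"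
              by linarith
            then show "norm ((c * h n * (b (p n (Suc k)) (X (p n k) \<omega>))\<^sup>2 - L * e n k \<omega>)
              - c * integral {p n k..p n (Suc k)} (\<lambda>s. (b s (X s \<omega>))\<^sup>2)) \<le> (c + L) * \<epsilon> * h n"
              by (simp add: i_def v_def algebra_simps)
          qed
          also have "\<dots> = (c + L) * \<epsilon> * (real (Suc n) * h n)"
            by (simp add: algebra_simps)
          finally show ?case
            using \<epsilon>(2) unfolding hn by simp
        qed
        then show "\<exists>N. \<forall>n\<ge>N. norm (Z n \<omega> - c * I \<omega>) < r"
          by (simp add: eventually_sequentially)
      qed
    qed
  qed simp
  have "(\<lambda>n. V t0 x + expectation (Z n) - gap_const u * (u - t0) * h n) \<longlonglongrightarrow>
      V t0 x + expectation (\<lambda>\<omega>. c * I \<omega>) - gap_const u * (u - t0) * 0"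
    unfolding h_def by (intro tendsto_intros limZ LIMSEQ_Suc[OF lim_const_over_n])
  then have "V t0 x + expectation (\<lambda>\<omega>. c * I \<omega>) - gap_const u * (u - t0) * 0 \<le> expectation (\<lambda>\<omega>. V u (X u \<omega>))"
    by (rule tendsto_upperbound[OF _ main]) simp
  then show ?thesis
    by (simp add: I_def)
qed

text \<open>The pointwise bound on the squared drift is of order 1 / (T - t) and does not show that
  the cost is finite. That comes from \<open>value_decrease\<close>: up to any time u < T the cost
  is at most E V u (X u) - V t0 x, and V is bounded. With \<open>q\<close> as below, the claim says
  that the total cost is at most q.\<close>

theorem payoff_ge_V:
  "ereal (V t0 x) \<le> expected_payoff M c t0 T (\<lambda>\<omega>. g (X T \<omega>)) feedback"
proof -
  define q where "q = expectation (\<lambda>\<omega>. g (X T \<omega>)) - V t0 x"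
  have [measurable]: "X T \<in> borel_measurable M"
    using T by (intro X_measurable_M) auto
  let ?u = "approach t0"
  note u = approach[OF t0(2)]
  have u_ge0: "0 \<le> ?u n" for n
    using u(1)[of n] t0 by linarith
  have Xu [measurable]: "X (?u n) \<in> borel_measurable M" for n
    by (rule X_measurable_M[OF u_ge0 less_imp_le[OF u(2)]])
  \<comment> \<open>\<open>J\<close> is the cost as a real number, for
    \<open>value_decrease\<close>; \<open>N\<close> is the same cost as an extended real, for
    monotone convergence in the time horizon.\<close>
  define J where "J n \<omega> = (LINT s:{t0..?u n}|lborel. (feedback s \<omega>)\<^sup>2)" for n \<omega>
  define N where "N n \<omega> = (\<integral>\<^sup>+ s\<in>{t0..?u n}. ennreal (c * (feedback s \<omega>)\<^sup>2) \<partial>lborel)" for n \<omega>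
  have Nm: "N n \<in> borel_measurable M" for n
    unfolding N_def[abs_def] using t0 u_ge0[of n] u(2)[of n]
    by (intro measurable_F[of _ "?u n"] measurable_progressive_nn_integral[OF feedback_progressive]) auto
  define K where "K n = drift_const / sqrt (T - ?u n)" for n
  have N_le: "N n \<omega> \<le> ennreal (c * (K n)\<^sup>2 * (?u n - t0))" for n \<omega>
  proof -
    have "(feedback s \<omega>)\<^sup>2 \<le> (K n)\<^sup>2" if "s \<in> {t0..?u n}" for s
      using b_path_bound[of s "?u n" "X s \<omega>"] that u(2)[of n] unfolding feedback_def K_def
      by (intro abs_le_square_iff[THEN iffD1]) (auto simp: abs_of_pos[OF drift_const])
    then have "N n \<omega> \<le> (\<integral>\<^sup>+ s. ennreal (c * (K n)\<^sup>2) * indicator {t0..?u n} s \<partial>lborel)"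
      unfolding N_def using c by (intro nn_integral_mono) (auto intro!: ennreal_leI split: split_indicator)
    also have "\<dots> = ennreal (c * (K n)\<^sup>2 * (?u n - t0))"
      using u(1)[of n] c by (subst nn_integral_cmult_indicator) (auto simp: ennreal_mult'')
    finally show ?thesis .
  qed
  have NJ: "(\<integral>\<^sup>+ \<omega>. N n \<omega> \<partial>M) = ennreal (c * expectation (J n))" for n
  proof -
    have J0: "J n \<omega> \<ge> 0" for \<omega>
      unfolding J_def set_lebesgue_integral_def by (intro integral_nonneg_AE) auto
    have eq: "N n \<omega> = ennreal (c * J n \<omega>)" if \<omega>: "\<omega> \<in> space M" for \<omega>
    proof -
      have "continuous_on {t0..?u n} (\<lambda>s. X s \<omega>)"
        by (rule continuous_on_subset[OF X_continuous[OF \<omega>]]) (use t0 u(2)[of n] in auto)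
      then have "continuous_on {t0..?u n} (\<lambda>s. c * (b s (X s \<omega>))\<^sup>2)"
        by (intro continuous_on_mult_left continuous_on_power b_path_continuous u)
      then have "set_integrable lborel {t0..?u n} (\<lambda>s. c * (b s (X s \<omega>))\<^sup>2)"
        by (rule set_integrable_lborel_continuous)
      then have i: "set_integrable lborel {t0..?u n} (\<lambda>s. c * (feedback s \<omega>)\<^sup>2)"
        by (subst set_integrable_cong[OF refl refl]) (auto simp: feedback_def)
      have "N n \<omega> = (\<integral>\<^sup>+ s. ennreal (indicator {t0..?u n} s *\<^sub>R (c * (feedback s \<omega>)\<^sup>2)) \<partial>lborel)"
        unfolding N_def by (intro nn_integral_cong) (auto split: split_indicator)
      also have "\<dots> = ennreal (LINT s:{t0..?u n}|lborel. c * (feedback s \<omega>)\<^sup>2)"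
        unfolding set_lebesgue_integral_def
        by (rule nn_integral_eq_integral[OF i[unfolded set_integrable_def]]) (use c in auto)
      finally show ?thesis
        by (simp add: J_def)
    qed
    have "(\<integral>\<^sup>+ \<omega>. N n \<omega> \<partial>M) = (\<integral>\<^sup>+ \<omega>. ennreal (c * J n \<omega>) \<partial>M)"
      by (intro nn_integral_cong eq)
    moreover have "integrable M (\<lambda>\<omega>. c * J n \<omega>)"
    proof (rule integrable_const_bound)
      show "AE \<omega> in M. norm (c * J n \<omega>) \<le> c * (K n)\<^sup>2 * (?u n - t0)"
      proof (intro AE_I2)
        fix \<omega> assume "\<omega> \<in> space M"
        from N_le[of n \<omega>] show "norm (c * J n \<omega>) \<le> c * (K n)\<^sup>2 * (?u n - t0)"
          unfolding eq[OF \<open>\<omega> \<in> space M\<close>] using J0[of \<omega>] c u(1)[of n] by (subst (asm) ennreal_le_iff) auto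
      qed
      have "progressively_measurable F T (\<lambda>s \<omega>. (feedback s \<omega>)\<^sup>2)"
        by (rule progressively_measurable_compose[OF feedback_progressive])
          (auto simp: case_prod_beta' intro!: borel_measurable_continuous_onI continuous_intros)
      then have "J n \<in> borel_measurable M"
        unfolding J_def[abs_def] using t0 u_ge0[of n] u(2)[of n]
        by (intro measurable_F[of _ "?u n"] measurable_progressive_integral) auto
      then show "(\<lambda>\<omega>. c * J n \<omega>) \<in> borel_measurable M"
        by simp
    qed
    ultimately show ?thesis
      using J0 c by (subst (asm) nn_integral_eq_integral) auto
  qed
  have decr: "V t0 x + c * expectation (J n) \<le> expectation (\<lambda>\<omega>. V (?u n) (X (?u n) \<omega>))" for n
    unfolding J_def[abs_def] using u by (intro value_decrease)
  have N_mono: "N m \<omega> \<le> N n \<omega>" if "m \<le> n" for m n \<omega>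
    unfolding N_def using u(4)[OF that] by (intro nn_integral_mono) (auto split: split_indicator)
  \<comment> \<open>The cost is kept up to the time with index m while the time in V tends to T,
    which is allowed because the cost grows with the horizon. The maximum with the bound from
    \<open>V_limsup\<close> is eventually constant on each path.\<close>
  have bound: "c * expectation (J m) \<le> q + (expectation (\<lambda>\<omega>. g (X T \<omega> + \<delta>)) - expectation (\<lambda>\<omega>. g (X T \<omega>))) + \<delta>"
    if \<delta>: "\<delta> > 0" for m \<delta>
  proof -
    let ?G = "\<lambda>\<omega>. g (X T \<omega> + \<delta>) + \<delta>"
    have "\<bar>max v (g y + \<delta>)\<bar> \<le> C + \<delta>" if "\<bar>v\<bar> \<le> C" for v y
      using that g_bound[of y] \<delta> by (auto simp: max_def abs_le_iff)
    then have bdG: "AE \<omega> in M. norm (max (V (?u n) (X (?u n) \<omega>)) (?G \<omega>)) \<le> C + \<delta>" for n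
      using V_bound by (intro always_eventually) simp
    have "(\<lambda>n. expectation (\<lambda>\<omega>. max (V (?u n) (X (?u n) \<omega>)) (?G \<omega>))) \<longlonglongrightarrow> expectation ?G"
    proof (rule integral_dominated_convergence[where w="\<lambda>_. C + \<delta>"])
      show "AE \<omega> in M. (\<lambda>n. max (V (?u n) (X (?u n) \<omega>)) (?G \<omega>)) \<longlonglongrightarrow> ?G \<omega>"
      proof (rule AE_I2, rule tendsto_eventually)
        fix \<omega> assume \<omega>: "\<omega> \<in> space M"
        have "(\<lambda>n. X (?u n) \<omega>) \<longlonglongrightarrow> X T \<omega>"
          by (rule continuous_on_tendsto_compose[OF X_continuous[OF \<omega>] u(3)])
            (use T u_ge0 u(2) in \<open>auto intro!: always_eventually intro: less_imp_le\<close>)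
        then have "\<forall>\<^sub>F n in sequentially. V (?u n) (X (?u n) \<omega>) \<le> ?G \<omega>"
          using u \<delta> by (intro V_limsup) auto
        then show "\<forall>\<^sub>F n in sequentially. max (V (?u n) (X (?u n) \<omega>)) (?G \<omega>) = ?G \<omega>"
          by eventually_elim (simp add: max_def)
      qed
      fix n
      show "AE \<omega> in M. norm (max (V (?u n) (X (?u n) \<omega>)) (?G \<omega>)) \<le> C + \<delta>"
        by (rule bdG)
    qed auto
    moreover have "V t0 x + c * expectation (J m) \<le> expectation (\<lambda>\<omega>. max (V (?u n) (X (?u n) \<omega>)) (?G \<omega>))" if "n \<ge> m" for n
    proof -
      have "ennreal (c * expectation (J m)) \<le> ennreal (c * expectation (J n))"
        unfolding NJ[symmetric] using that by (intro nn_integral_mono N_mono)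
      moreover have "0 \<le> c * expectation (J n)"
        unfolding J_def set_lebesgue_integral_def using c
        by (intro mult_nonneg_nonneg integral_nonneg_AE always_eventually allI) auto
      ultimately have "c * expectation (J m) \<le> c * expectation (J n)"
        by (subst (asm) ennreal_le_iff)
      also have "\<dots> \<le> expectation (\<lambda>\<omega>. V (?u n) (X (?u n) \<omega>)) - V t0 x"
        using decr[of n] by linarith
      also have "expectation (\<lambda>\<omega>. V (?u n) (X (?u n) \<omega>)) \<le> expectation (\<lambda>\<omega>. max (V (?u n) (X (?u n) \<omega>)) (?G \<omega>))"
      proof (rule integral_mono)
        show "integrable M (\<lambda>\<omega>. max (V (?u n) (X (?u n) \<omega>)) (?G \<omega>))"
        proof (rule integrable_const_bound[where B="C + \<delta>"])
          show "AE \<omega> in M. norm (max (V (?u n) (X (?u n) \<omega>)) (?G \<omega>)) \<le> C + \<delta>"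
            by (rule bdG)
        qed measurable
      qed (auto intro: V_integrable)
      finally show ?thesis by simp
    qed
    ultimately have "V t0 x + c * expectation (J m) \<le> expectation ?G"
      by (intro LIMSEQ_le_const) auto
    also have "expectation ?G = expectation (\<lambda>\<omega>. g (X T \<omega> + \<delta>)) + \<delta>"
      using g_bound by (subst Bochner_Integration.integral_add) (auto intro!: integrable_const_bound[where B=C] simp: prob_space)
    finally show ?thesis
      by (simp add: q_def)
  qed
  \<comment> \<open>Here \<delta> tends to 0 inside \<open>g\<close>, which is where right
    continuity enters.\<close>
  have bound0: "c * expectation (J m) \<le> q" for m
  proof (rule LIMSEQ_le_const)
    let ?d = "\<lambda>n. 1 / real (Suc n)"
    have d: "?d \<longlonglongrightarrow> 0"
      by (rule LIMSEQ_Suc[OF lim_const_over_n])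
    have "(\<lambda>n. expectation (\<lambda>\<omega>. g (X T \<omega> + ?d n))) \<longlonglongrightarrow> expectation (\<lambda>\<omega>. g (X T \<omega>))"
    proof (rule integral_dominated_convergence[where w="\<lambda>_. C"])
      show "AE \<omega> in M. (\<lambda>n. g (X T \<omega> + ?d n)) \<longlonglongrightarrow> g (X T \<omega>)"
      proof (rule always_eventually, rule allI)
        fix \<omega>
        have "(\<lambda>n. X T \<omega> + ?d n) \<longlonglongrightarrow> X T \<omega>"
          using tendsto_add[OF tendsto_const[of "X T \<omega>"] d] by simp
        then have "filterlim (\<lambda>n. X T \<omega> + ?d n) (at_right (X T \<omega>)) sequentially"
          by (auto simp: filterlim_at intro!: always_eventually)
        moreover have "(g \<longlongrightarrow> g (X T \<omega>)) (at_right (X T \<omega>))"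
          using g_right[of "X T \<omega>"] by (simp add: continuous_within)
        ultimately show "(\<lambda>n. g (X T \<omega> + ?d n)) \<longlonglongrightarrow> g (X T \<omega>)"
          by (rule filterlim_compose[rotated])
      qed
      fix n
      show "AE \<omega> in M. norm (g (X T \<omega> + ?d n)) \<le> C"
        using g_bound by simp
    qed auto
    then have "(\<lambda>n. q + (expectation (\<lambda>\<omega>. g (X T \<omega> + ?d n)) - expectation (\<lambda>\<omega>. g (X T \<omega>))) + ?d n)
        \<longlonglongrightarrow> q + (expectation (\<lambda>\<omega>. g (X T \<omega>)) - expectation (\<lambda>\<omega>. g (X T \<omega>))) + 0"
      by (intro tendsto_intros d)
    then show "(\<lambda>n. q + (expectation (\<lambda>\<omega>. g (X T \<omega> + ?d n)) - expectation (\<lambda>\<omega>. g (X T \<omega>))) + ?d n) \<longlonglongrightarrow> q"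
      by simp
    show "\<exists>n0. \<forall>n\<ge>n0. c * expectation (J m) \<le> q + (expectation (\<lambda>\<omega>. g (X T \<omega> + ?d n)) - expectation (\<lambda>\<omega>. g (X T \<omega>))) + ?d n"
      using bound by auto
  qed
  have inner: "(SUP n. N n \<omega>) = (\<integral>\<^sup>+ s\<in>{t0..T}. ennreal (c * (feedback s \<omega>)\<^sup>2) \<partial>lborel)" if \<omega>: "\<omega> \<in> space M" for \<omega>
  proof -
    have "(\<lambda>s. ennreal (c * (feedback s \<omega>)\<^sup>2) * indicator {t0..?u n} s) \<in> borel_measurable lborel" for n
    proof -
      have "(\<lambda>s. ennreal (c * (b s (X (max 0 (min T s)) \<omega>))\<^sup>2) * indicator {t0..?u n} s) \<in> borel_measurable borel"
        using T by (intro borel_measurable_times_ennreal[OF _ borel_measurable_indicator] measurable_compose[OF _ measurable_ennreal] borel_measurable_times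
            borel_measurable_power b_measurable borel_measurable_continuous_onI
            continuous_on_compose2[OF X_continuous[OF \<omega>]] continuous_intros) auto
      also have "(\<lambda>s. ennreal (c * (b s (X (max 0 (min T s)) \<omega>))\<^sup>2) * indicator {t0..?u n} s) =
          (\<lambda>s. ennreal (c * (feedback s \<omega>)\<^sup>2) * indicator {t0..?u n} s)"
        using t0 u(2)[of n] by (auto simp: fun_eq_iff feedback_def max_def min_def split: split_indicator)
      finally show ?thesis
        by simp
    qed
    then have "(\<integral>\<^sup>+ s. (SUP n. ennreal (c * (feedback s \<omega>)\<^sup>2) * indicator {t0..?u n} s) \<partial>lborel) = (SUP n. N n \<omega>)"
      unfolding N_def
    proof (intro nn_integral_monotone_convergence_SUP)
      show "incseq (\<lambda>n s. ennreal (c * (feedback s \<omega>)\<^sup>2) * indicator {t0..?u n} s)"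
        unfolding incseq_def le_fun_def by (auto split: split_indicator dest: order_trans[OF _ u(4)])
    qed
    moreover have "(SUP n. ennreal (c * (feedback s \<omega>)\<^sup>2) * indicator {t0..?u n} s) = ennreal (c * (feedback s \<omega>)\<^sup>2) * indicator {t0..T} s" for s
    proof (cases "t0 \<le> s \<and> s < T")
      case True
      then have "\<forall>\<^sub>F n in sequentially. s < ?u n"
        by (intro order_tendstoD(1)[OF u(3)]) auto
      then obtain n where "s < ?u n"
        by (auto simp: eventually_sequentially)
      then show ?thesis
        using True by (intro antisym SUP_least SUP_upper2[of n]) (auto split: split_indicator)
    next
      case False
      \<comment> \<open>The time s = T lies in none of the intervals {t0..?u n}, but the feedback
        vanishes there, as it does before t0.\<close>
      then have "feedback s \<omega> = 0 \<or> s > T"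
        by (auto simp: feedback_def b_def)
      then show ?thesis
        using u(2) by (auto simp: not_le intro!: SUP_eq_const split: split_indicator) (metis less_asym less_le_trans)
    qed
    ultimately show ?thesis
      by simp
  qed
  have "(\<integral>\<^sup>+ \<omega>. (\<integral>\<^sup>+ s\<in>{t0..T}. ennreal (c * (feedback s \<omega>)\<^sup>2) \<partial>lborel) \<partial>M) = (\<integral>\<^sup>+ \<omega>. (SUP n. N n \<omega>) \<partial>M)"
    by (intro nn_integral_cong inner[symmetric])
  also have "\<dots> = (SUP n. \<integral>\<^sup>+ \<omega>. N n \<omega> \<partial>M)"
    using N_mono by (intro nn_integral_monotone_convergence_SUP Nm) (auto simp: incseq_def le_fun_def)
  also have "\<dots> \<le> ennreal q"
    unfolding NJ by (intro SUP_least ennreal_leI bound0)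
  finally have cost: "(\<integral>\<^sup>+ \<omega>. (\<integral>\<^sup>+ s\<in>{t0..T}. ennreal (c * (feedback s \<omega>)\<^sup>2) \<partial>lborel) \<partial>M) \<le> ennreal q" .
  have "0 \<le> c * expectation (J 0)"
    unfolding J_def set_lebesgue_integral_def using c
    by (intro mult_nonneg_nonneg integral_nonneg_AE always_eventually allI) auto
  then have "q \<ge> 0"
    using bound0[of 0] by linarith
  then have "enn2ereal (\<integral>\<^sup>+ \<omega>. (\<integral>\<^sup>+ s\<in>{t0..T}. ennreal (c * (feedback s \<omega>)\<^sup>2) \<partial>lborel) \<partial>M) \<le> ereal q"
    using cost[unfolded less_eq_ennreal.rep_eq] by (simp only: enn2ereal_ennreal)
  then have "ereal (expectation (\<lambda>\<omega>. g (X T \<omega>))) - ereal q \<le> expected_payoff M c t0 T (\<lambda>\<omega>. g (X T \<omega>)) feedback"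
    unfolding expected_payoff_def by (intro ereal_minus_mono) auto
  then show ?thesis
    by (simp add: q_def)
qed

end

end

section \<open>Pathwise solution of the state equation\<close>

context monotone_reward
begin

definition ode :: "real \<Rightarrow> real \<Rightarrow> (real \<Rightarrow> real) \<Rightarrow> real \<Rightarrow> (real \<Rightarrow> real) \<Rightarrow> bool" where
  "ode t0 x w u y \<longleftrightarrow> continuous_on {t0..u} y \<and>
    (\<forall>t\<in>{t0..u}. y t = x + integral {t0..t} (\<lambda>s. b s (y s)) + \<sigma> * (w t - w t0))"

text \<open>The summand 1 makes it positive, so that one can divide by it.\<close>

definition lip :: "real \<Rightarrow> real" where
  "lip u = 2 * \<sigma>\<^sup>2 * curv u + 1"

lemma lip:
  assumes "s \<le> u" "u < T"
  shows "\<bar>b s y - b s y'\<bar> \<le> lip u * \<bar>y - y'\<bar>"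
proof -
  have "\<bar>b s y - b s y'\<bar> \<le> 2 * \<sigma>\<^sup>2 * curv s * \<bar>y - y'\<bar>"
    using assms by (intro b_Lipschitz) auto
  also have "\<dots> \<le> lip u * \<bar>y - y'\<bar>"
    using curv_mono[OF assms] \<sigma> unfolding lip_def
    by (intro mult_right_mono) (auto intro!: order_trans[OF mult_left_mono[of "curv s" "curv u" "2 * \<sigma>\<^sup>2"]])
  finally show ?thesis .
qed

lemma lip_pos: "u < T \<Longrightarrow> lip u > 0"
  using curv_nonneg[of u] by (simp add: lip_def add_nonneg_pos)

primrec picard :: "real \<Rightarrow> real \<Rightarrow> (real \<Rightarrow> real) \<Rightarrow> nat \<Rightarrow> real \<Rightarrow> real" where
  "picard t0 x w 0 = (\<lambda>t. x + \<sigma> * (w t - w t0))"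
| "picard t0 x w (Suc n) = (\<lambda>t. x + integral {t0..t} (\<lambda>s. b s (picard t0 x w n s)) + \<sigma> * (w t - w t0))"

text \<open>Bielecki's device: measured against the weight exp (2 P (t - t0)), the Picard map
  contracts by 1 / 2 on the whole interval, whatever its length. The iterates then converge by the
  M-test.\<close>

lemma picard_converges:
  assumes w: "continuous_on {t0..u} w" and u: "t0 \<le> u" "u < T"
  shows "uniform_limit {t0..u} (picard t0 x w) (\<lambda>t. lim (\<lambda>n. picard t0 x w n t)) sequentially"
    and "ode t0 x w u (\<lambda>t. lim (\<lambda>n. picard t0 x w n t))"
proof -
  let ?Y = "picard t0 x w"
  define K where "K = drift_const / sqrt (T - u)"
  have bK: "\<bar>b s y\<bar> \<le> K" if "s \<le> u" for s y
    unfolding K_def using that u by (intro b_path_bound) auto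
  define P where "P = lip u"
  have P: "P > 0"
    using lip_pos u by (simp add: P_def)
  have cY: "continuous_on {t0..u} (?Y n)" for n
  proof (induction n)
    case (Suc n)
    have "continuous_on {t0..u} (\<lambda>t. integral {t0..t} (\<lambda>s. b s (?Y n s)))"
      by (intro indefinite_integral_continuous_1 integrable_continuous_real b_path_continuous Suc.IH u)
    then show ?case
      by (auto intro!: continuous_intros w)
  qed (auto intro!: continuous_intros w)
  have int: "(\<lambda>s. b s (?Y n s)) integrable_on {t0..t}" if "t \<le> u" for n t
    using that u by (intro integrable_continuous_real b_path_continuous continuous_on_subset[OF cY]) auto
  define A where "A = K * (u - t0)"
  have step: "\<bar>?Y (Suc n) t - ?Y n t\<bar> \<le> A * (1 / 2) ^ n * exp (2 * P * (t - t0))" if "t \<in> {t0..u}" for n t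
    using that
  proof (induction n arbitrary: t)
    case 0
    have "norm (integral {t0..t} (\<lambda>s. b s (?Y 0 s))) \<le> K * (t - t0)"
    proof (rule integral_bound)
      show "continuous_on {t0..t} (\<lambda>s. b s (?Y 0 s))"
        using 0 u by (intro b_path_continuous continuous_on_subset[OF cY]) auto
    qed (use 0 bK in auto)
    also have "\<dots> \<le> A * 1"
      using 0 bK[of t0 0] u unfolding A_def by (auto intro!: mult_left_mono order_trans[OF abs_ge_zero])
    also have "\<dots> \<le> A * exp (2 * P * (t - t0))"
      using 0 P bK[of t0 0] u unfolding A_def
      by (intro mult_left_mono) (auto intro!: mult_nonneg_nonneg order_trans[OF abs_ge_zero])
    finally show ?case
      by simp
  next
    case (Suc n)
    let ?e = "\<lambda>s. P * (A * (1 / 2) ^ n * exp (2 * P * (s - t0)))"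
    have t: "t0 \<le> t" "t \<le> u"
      using Suc.prems by auto
    have "(?e has_integral A * (1 / 2) ^ Suc n * exp (2 * P * (t - t0)) - A * (1 / 2) ^ Suc n * exp (2 * P * (t0 - t0))) {t0..t}"
    proof (rule fundamental_theorem_of_calculus[OF t(1)])
      fix s assume "s \<in> {t0..t}"
      have "((\<lambda>s. A * (1 / 2) ^ Suc n * exp (2 * P * (s - t0))) has_real_derivative ?e s) (at s within {t0..t})"
        by (rule derivative_eq_intros refl | simp)+
      then show "((\<lambda>s. A * (1 / 2) ^ Suc n * exp (2 * P * (s - t0))) has_vector_derivative ?e s) (at s within {t0..t})"
        by (simp add: has_real_derivative_iff_has_vector_derivative)
    qed
    then have e: "?e integrable_on {t0..t}"
      "integral {t0..t} ?e = A * (1 / 2) ^ Suc n * exp (2 * P * (t - t0)) - A * (1 / 2) ^ Suc n"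
      by (auto simp: has_integral_integrable_integral)
    have eq: "?Y (Suc (Suc n)) t - ?Y (Suc n) t = integral {t0..t} (\<lambda>s. b s (?Y (Suc n) s) - b s (?Y n s))"
      using int[OF t(2), of "Suc n"] int[OF t(2), of n]
      by (simp add: Henstock_Kurzweil_Integration.integral_diff del: picard.simps(2)) (simp only: picard.simps)
    have "norm (?Y (Suc (Suc n)) t - ?Y (Suc n) t) \<le> integral {t0..t} ?e"
      unfolding eq
    proof (rule Henstock_Kurzweil_Integration.integral_norm_bound_integral)
      show "(\<lambda>s. b s (?Y (Suc n) s) - b s (?Y n s)) integrable_on {t0..t}"
        using int[OF t(2), of "Suc n"] int[OF t(2), of n] by (rule integrable_diff)
      fix s assume s: "s \<in> {t0..t}"
      have "\<bar>b s (?Y (Suc n) s) - b s (?Y n s)\<bar> \<le> P * \<bar>?Y (Suc n) s - ?Y n s\<bar>"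
        unfolding P_def using s t u by (intro lip) auto
      also have "\<dots> \<le> ?e s"
        using s t P by (intro mult_left_mono Suc.IH) auto
      finally show "norm (b s (?Y (Suc n) s) - b s (?Y n s)) \<le> ?e s"
        by simp
    qed (rule e)
    also have "\<dots> \<le> A * (1 / 2) ^ Suc n * exp (2 * P * (t - t0))"
      unfolding e(2) using bK[of t0 0] u by (auto simp: A_def intro!: mult_nonneg_nonneg order_trans[OF abs_ge_zero])
    finally show ?case
      unfolding real_norm_def .
  qed
  define A' where "A' = A * exp (2 * P * (u - t0))"
  have A0: "A \<ge> 0"
    using bK[of t0 0] u unfolding A_def by (auto intro!: mult_nonneg_nonneg order_trans[OF abs_ge_zero])
  have step': "norm (?Y (Suc n) t - ?Y n t) \<le> A' * (1 / 2) ^ n" if "t \<in> {t0..u}" for n t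
  proof -
    have "A * (1 / 2) ^ n * exp (2 * P * (t - t0)) \<le> A * (1 / 2) ^ n * exp (2 * P * (u - t0))"
      using that P A0 by (intro mult_left_mono) auto
    then show ?thesis
      using step[OF that, of n] by (simp add: A'_def mult_ac)
  qed
  have "uniform_limit {t0..u} (\<lambda>n t. \<Sum>i<n. ?Y (Suc i) t - ?Y i t) (\<lambda>t. \<Sum>i. ?Y (Suc i) t - ?Y i t) sequentially"
    using step' by (rule Weierstrass_m_test) (auto intro!: summable_mult summable_geometric)
  then have "uniform_limit {t0..u} (\<lambda>n t. ?Y 0 t + (\<Sum>i<n. ?Y (Suc i) t - ?Y i t)) (\<lambda>t. ?Y 0 t + (\<Sum>i. ?Y (Suc i) t - ?Y i t)) sequentially"
    by (intro uniform_limit_add uniform_limit_const)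
  moreover have "?Y 0 t + (\<Sum>i<n. ?Y (Suc i) t - ?Y i t) = ?Y n t" for n t
    by (induction n) (simp_all del: picard.simps)
  ultimately have lim0: "uniform_limit {t0..u} ?Y (\<lambda>t. ?Y 0 t + (\<Sum>i. ?Y (Suc i) t - ?Y i t)) sequentially"
    by simp
  have lim_eq: "lim (\<lambda>n. ?Y n t) = ?Y 0 t + (\<Sum>i. ?Y (Suc i) t - ?Y i t)" if "t \<in> {t0..u}" for t
    using tendsto_uniform_limitI[OF lim0 that] by (rule limI)
  show ul: "uniform_limit {t0..u} ?Y (\<lambda>t. lim (\<lambda>n. ?Y n t)) sequentially"
    by (rule uniform_limit_cong'[THEN iffD2, OF refl lim_eq lim0])
  let ?y = "\<lambda>t. lim (\<lambda>n. ?Y n t)"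
  have cy: "continuous_on {t0..u} ?y"
    by (rule uniform_limit_theorem[OF always_eventually ul]) (use cY in auto)
  have "?y t = x + integral {t0..t} (\<lambda>s. b s (?y s)) + \<sigma> * (w t - w t0)" if t: "t \<in> {t0..u}" for t
  proof -
    have "uniform_limit {t0..t} (\<lambda>n s. b s (?Y n s)) (\<lambda>s. b s (?y s)) sequentially"
    proof (rule uniform_limitI)
      fix e :: real assume e: "e > 0"
      have "\<forall>\<^sub>F n in sequentially. \<forall>s\<in>{t0..u}. dist (?Y n s) (?y s) < e / P"
        using e P by (intro uniform_limitD[OF ul]) auto
      then show "\<forall>\<^sub>F n in sequentially. \<forall>s\<in>{t0..t}. dist (b s (?Y n s)) (b s (?y s)) < e"
      proof eventually_elim
        case (elim n)
        show ?case
        proof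
          fix s assume s: "s \<in> {t0..t}"
          have "dist (b s (?Y n s)) (b s (?y s)) \<le> P * dist (?Y n s) (?y s)"
            unfolding dist_real_def P_def using s t u by (intro lip) auto
          also have "\<dots> < P * (e / P)"
            using elim s t P by (intro mult_strict_left_mono) auto
          finally show "dist (b s (?Y n s)) (b s (?y s)) < e"
            using P by simp
        qed
      qed
    qed
    moreover have "continuous_on {t0..t} (\<lambda>s. b s (?Y n s))" for n
      using t u by (intro b_path_continuous continuous_on_subset[OF cY]) auto
    ultimately obtain I J where IJ: "\<And>n. ((\<lambda>s. b s (?Y n s)) has_integral I n) {t0..t}"
      "((\<lambda>s. b s (?y s)) has_integral J) {t0..t}" "I \<longlonglongrightarrow> J"
      by (rule uniform_limit_integral) auto
    have "(\<lambda>n. ?Y (Suc n) t) \<longlonglongrightarrow> x + J + \<sigma> * (w t - w t0)"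
      using IJ(3) unfolding picard.simps integral_unique[OF IJ(1)] by (intro tendsto_intros)
    moreover have "(\<lambda>n. ?Y (Suc n) t) \<longlonglongrightarrow> ?y t"
      using tendsto_uniform_limitI[OF ul t] by (rule LIMSEQ_Suc)
    ultimately have "?y t = x + J + \<sigma> * (w t - w t0)"
      by (rule LIMSEQ_unique[rotated])
    then show ?thesis
      using integral_unique[OF IJ(2)] by simp
  qed
  then show "ode t0 x w u ?y"
    using cy by (simp add: ode_def)
qed

text \<open>The iterates are given by the same formula for every u, so the limits on the intervals
  [t0, u] agree automatically and form one function on [t0, T).\<close>

lemma ode_exists:
  assumes w: "continuous_on {0..T} w" and t0: "0 \<le> t0" "t0 < T"
  shows "\<exists>y. continuous_on {0..T} y \<and> (\<forall>t\<le>t0. y t = x) \<and> (\<forall>u\<in>{t0..<T}. ode t0 x w u y)"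
proof -
  let ?z = "\<lambda>t. lim (\<lambda>n. picard t0 x w n t)"
  have z: "ode t0 x w u ?z" if "u \<in> {t0..<T}" for u
    using that t0 by (intro picard_converges continuous_on_subset[OF w]) auto
  have cz: "continuous_on {t0..<T} ?z"
    unfolding continuous_on_eq_continuous_within
  proof
    fix t assume t: "t \<in> {t0..<T}"
    define u where "u = (t + T) / 2"
    have u: "t < u" "u < T"
      using t by (auto simp: u_def)
    have "continuous_on {t0..u} ?z"
      using z[of u] t u by (auto simp: ode_def)
    then have "continuous (at t within {t0..u}) ?z"
      using t u by (auto simp: continuous_on_eq_continuous_within)
    moreover have "at t within {t0..<T} = at t within {t0..u}"
      by (rule at_within_nhd[of t "{..<u}"]) (use u in auto)
    ultimately show "continuous (at t within {t0..<T}) ?z"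
      by simp
  qed
  have int: "(\<lambda>s. b s (?z s)) integrable_on {t0..T}"
    by (rule set_lborel_integral_eq_integral(1)[OF b_path_integrable[OF cz t0(2)]])
  \<comment> \<open>\<open>?z\<close> is controlled on [t0, T) only. The right-hand side of the
    integral equation extends it: to T, because the drift along \<open>?z\<close> is integrable up
    to T, and to times before t0 as the constant x, through max t0 t.\<close>
  define y where "y t = x + integral {t0..max t0 t} (\<lambda>s. b s (?z s)) + \<sigma> * (w (max t0 t) - w t0)" for t
  have yz: "y t = ?z t" if "t \<in> {t0..<T}" for t
    using z[OF that] that by (auto simp: ode_def y_def max_def)
  have "continuous_on {0..T} y"
    unfolding y_def using t0
    by (intro continuous_on_add continuous_on_const continuous_on_mult_left continuous_on_diff
        continuous_on_compose2[OF indefinite_integral_continuous_1[OF int]] continuous_on_compose2[OF w]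
        continuous_on_max continuous_on_id) auto
  moreover have "y t = x" if "t \<le> t0" for t
    using that by (simp add: y_def max_def)
  moreover have "ode t0 x w u y" if u: "u \<in> {t0..<T}" for u
    unfolding ode_def
  proof (intro conjI ballI)
    show "continuous_on {t0..u} y"
      using \<open>continuous_on {0..T} y\<close> by (rule continuous_on_subset) (use u t0 in auto)
    fix t assume t: "t \<in> {t0..u}"
    have "integral {t0..t} (\<lambda>s. b s (y s)) = integral {t0..t} (\<lambda>s. b s (?z s))"
      using t u by (intro integral_cong) (simp add: yz)
    then show "y t = x + integral {t0..t} (\<lambda>s. b s (y s)) + \<sigma> * (w t - w t0)"
      using t by (simp add: y_def max_def)
  qed
  ultimately show ?thesis
    by blast
qed

text \<open>The scheme reads the path at finitely many times. This makes its limits adapted on the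
  one hand, and measurable functionals on the product space of paths on the other.\<close>

primrec euler :: "real \<Rightarrow> real \<Rightarrow> real \<Rightarrow> (real \<Rightarrow> real) \<Rightarrow> nat \<Rightarrow> real" where
  "euler t0 h x w 0 = x"
| "euler t0 h x w (Suc k) = euler t0 h x w k + h * b (t0 + real k * h) (euler t0 h x w k)
    + \<sigma> * (w (t0 + real (Suc k) * h) - w (t0 + real k * h))"

text \<open>The noise is additive and cancels in the difference of scheme and solution. What remains
  is the Riemann error of the drift, at most \<epsilon> h per step, propagated by a discrete
  Gronwall inequality.\<close>

lemma euler_converges:
  assumes y: "ode t0 x w u y" and u: "t0 < u" "u < T"
  shows "(\<lambda>n. euler t0 ((u - t0) / real (Suc n)) x w (Suc n)) \<longlonglongrightarrow> y u"
proof (rule LIMSEQ_I)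
  fix r :: real assume r: "r > 0"
  define P where "P = lip u"
  have P: "P > 0"
    using lip_pos u by (simp add: P_def)
  \<comment> \<open>The Gronwall factor times the total length of the steps; \<epsilon> is chosen to
    make the final error at most r / 2.\<close>
  define q where "q = exp (P * (u - t0)) * (u - t0)"
  have q: "q > 0"
    using u by (simp add: q_def)
  define \<epsilon> where "\<epsilon> = r / (2 * q)"
  have \<epsilon>: "\<epsilon> > 0" "\<epsilon> * q < r"
    using r q by (auto simp: \<epsilon>_def)
  have cy: "continuous_on {t0..u} y"
    using y by (simp add: ode_def)
  have cb: "continuous_on {t0..u} (\<lambda>s. b s (y s))"
    using cy u by (intro b_path_continuous)
  have "continuous_on ({t0..u} \<times> {t0..u}) (\<lambda>q. b (snd q) (y (snd q)))"
    by (rule continuous_on_compose2[OF cb continuous_on_snd[OF continuous_on_id]]) auto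
  from uniform_Riemann_error[OF this u(1) \<epsilon>(1)]
  have "\<forall>\<^sub>F n in sequentially. norm (euler t0 ((u - t0) / real (Suc n)) x w (Suc n) - y u) < r"
  proof eventually_elim
    case (elim n)
    define h where "h = (u - t0) / real (Suc n)"
    have h: "h > 0" "real (Suc n) * h = u - t0"
      using u by (auto simp: h_def)
    define p where "p k = t0 + real k * h" for k
    have p_le: "p k \<le> u" if "k \<le> Suc n" for k
    proof -
      have "real k * h \<le> real (Suc n) * h"
        using that h by (intro mult_right_mono) auto
      then show ?thesis
        using h(2) unfolding p_def by linarith
    qed
    have p_ge: "t0 \<le> p k" for k
      using h by (simp add: p_def)
    have pS: "p (Suc k) - p k = h" "p k \<le> p (Suc k)" for k
      using h by (auto simp: p_def algebra_simps)
    define E where "E k = euler t0 h x w k" for k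
    have err: "\<bar>E k - y (p k)\<bar> \<le> (1 + P * h) ^ k * (real k * (\<epsilon> * h))" if "k \<le> Suc n" for k
      using that
    proof (induction k)
      case 0
      have "y t0 = x"
        using y u by (auto simp: ode_def)
      then show ?case
        by (simp add: E_def p_def)
    next
      case (Suc k)
      have k: "k \<le> n" using Suc.prems by simp
      define i where "i = integral {p k..p (Suc k)} (\<lambda>s. b s (y s))"
      have yk: "y (p j) = x + integral {t0..p j} (\<lambda>s. b s (y s)) + \<sigma> * (w (p j) - w t0)" if "j \<le> Suc n" for j
        using y p_ge[of j] p_le[OF that] by (auto simp: ode_def)
      have "integral {t0..p k} (\<lambda>s. b s (y s)) + i = integral {t0..p (Suc k)} (\<lambda>s. b s (y s))"
        unfolding i_def using p_ge[of k] p_le[OF Suc.prems] pS[of k]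
        by (intro Henstock_Kurzweil_Integration.integral_combine integrable_continuous_real continuous_on_subset[OF cb]) auto
      then have "y (p (Suc k)) = y (p k) + i + \<sigma> * (w (p (Suc k)) - w (p k))"
        using yk[of k] yk[of "Suc k"] Suc.prems by (simp add: algebra_simps)
      moreover have "E (Suc k) = E k + h * b (p k) (E k) + \<sigma> * (w (p (Suc k)) - w (p k))"
        by (simp add: E_def p_def)
      ultimately have "E (Suc k) - y (p (Suc k)) = (E k - y (p k)) + h * (b (p k) (E k) - b (p k) (y (p k))) + (h * b (p k) (y (p k)) - i)"
        by (simp add: algebra_simps)
      moreover have "\<bar>i - h * b (p k) (y (p k))\<bar> \<le> \<epsilon> * h"
        using elim[rule_format, OF k] unfolding Let_def h_def[symmetric] p_def[symmetric] i_def snd_conv .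
      moreover have "\<bar>h * (b (p k) (E k) - b (p k) (y (p k)))\<bar> \<le> h * (P * \<bar>E k - y (p k)\<bar>)"
        unfolding abs_mult P_def using h p_le[of k] k u by (intro mult_mono lip) auto
      ultimately have "\<bar>E (Suc k) - y (p (Suc k))\<bar> \<le> \<bar>E k - y (p k)\<bar> + h * (P * \<bar>E k - y (p k)\<bar>) + \<epsilon> * h"
        by linarith
      also have "\<dots> = (1 + P * h) * \<bar>E k - y (p k)\<bar> + \<epsilon> * h"
        by (simp add: algebra_simps)
      also have "\<dots> \<le> (1 + P * h) * ((1 + P * h) ^ k * (real k * (\<epsilon> * h))) + (1 + P * h) ^ Suc k * (\<epsilon> * h)"
        using P h \<epsilon> Suc.IH k by (intro add_mono mult_left_mono) (auto intro!: mult_le_cancel_right1[THEN iffD2] one_le_power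
            simp del: power_Suc)
      also have "\<dots> = (1 + P * h) ^ Suc k * (real (Suc k) * (\<epsilon> * h))"
        by (simp add: algebra_simps)
      finally show ?case .
    qed
    have "(1 + P * h) ^ Suc n \<le> exp (P * h) ^ Suc n"
      using P h by (intro power_mono exp_ge_add_one_self) auto
    also have "\<dots> = exp (P * (u - t0))"
      using h(2) by (simp only: exp_of_nat_mult[symmetric]) (simp add: mult.left_commute)
    finally have "(1 + P * h) ^ Suc n * (real (Suc n) * (\<epsilon> * h)) \<le> exp (P * (u - t0)) * (real (Suc n) * (\<epsilon> * h))"
      using \<epsilon> h by (intro mult_right_mono) auto
    also have "\<dots> = \<epsilon> * (exp (P * (u - t0)) * (real (Suc n) * h))"
      by (simp only: ac_simps)
    also have "\<dots> < r"
      unfolding h(2) using \<epsilon>(2) by (simp add: q_def)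
    finally have "\<bar>E (Suc n) - y (p (Suc n))\<bar> < r"
      using err[of "Suc n"] by linarith
    moreover have "p (Suc n) = u"
      using h by (simp add: p_def)
    ultimately show ?case
      by (simp only: E_def h_def real_norm_def)
  qed
  then show "\<exists>N. \<forall>n\<ge>N. norm (euler t0 ((u - t0) / real (Suc n)) x w (Suc n) - y u) < r"
    by (simp add: eventually_sequentially)
qed

text \<open>This iterated kernel does not refer to the probability space, which is why the terminal law is the
  same on every space.\<close>

primrec euler_law :: "real \<Rightarrow> real \<Rightarrow> real \<Rightarrow> nat \<Rightarrow> (real \<Rightarrow> real) \<Rightarrow> real" where
  "euler_law t0 h x 0 f = f x"
| "euler_law t0 h x (Suc k) f = euler_law t0 h x k (\<lambda>y. heat (\<sigma> * sqrt h) f (y + h * b (t0 + real k * h) y))"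

text \<open>Two limits, because the Lipschitz bound for the drift explodes at T: the mesh tends to 0
  on [0, approach 0 m], and then m tends to infinity. Since \<open>lim\<close> is total, the map is
  measurable on all paths, including those where the scheme diverges.\<close>

definition path_map :: "(real \<Rightarrow> real) \<Rightarrow> real" where
  "path_map w = lim (\<lambda>m. lim (\<lambda>n. euler 0 (approach 0 m / real (Suc n)) 0 w (Suc n)))"

lemma euler_measurable_path:
  assumes "0 \<le> h" "real k * h \<le> T"
  shows "(\<lambda>w. euler 0 h 0 w k) \<in> borel_measurable (PiM {0..T} (\<lambda>_. borel))"
  using assms(2)
proof (induction k)
  case (Suc k)
  have "real k * h \<le> real (Suc k) * h"
    using assms by (intro mult_right_mono) auto
  then have "real k * h \<in> {0..T}" "real (Suc k) * h \<in> {0..T}" "(\<lambda>w. euler 0 h 0 w k) \<in> borel_measurable (PiM {0..T} (\<lambda>_. borel))"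
    using Suc assms by auto
  then show ?case
    by (auto intro!: borel_measurable_add borel_measurable_times b_measurable borel_measurable_diff measurable_component_singleton simp del: of_nat_Suc)
qed simp

lemma path_map_measurable [measurable]: "path_map \<in> borel_measurable (PiM {0..T} (\<lambda>_. borel))"
  unfolding path_map_def
proof (intro borel_measurable_lim_metric euler_measurable_path)
  fix m n
  show "0 \<le> approach 0 m / real (Suc n)" "real (Suc n) * (approach 0 m / real (Suc n)) \<le> T"
    using approach(1,2)[OF T, of m] by auto
qed

end

section \<open>Existence, adaptedness and law of the solution\<close>

context controlled
begin

lemma solves_ode:
  assumes X: "solves t0 x X" and t0: "0 \<le> t0" "t0 < T"
  shows "AE \<omega> in M. \<forall>u\<in>{t0..<T}. ode t0 x (\<lambda>t. B t \<omega>) u (\<lambda>t. X t \<omega>)"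
  using X_equation[OF X t0]
proof (rule AE_mp, intro AE_I2 impI ballI)
  fix \<omega> u assume \<omega>: "\<omega> \<in> space M" and u: "u \<in> {t0..<T}"
    and *: "\<forall>t\<in>{t0..T}. X t \<omega> = x + (LINT s:{t0..t}|lborel. b s (X s \<omega>)) + \<sigma> * (B t \<omega> - B t0 \<omega>)"
  have c: "continuous_on {t0..u} (\<lambda>t. X t \<omega>)"
    by (rule continuous_on_subset[OF X_continuous[OF X t0 \<omega>]]) (use t0 u in auto)
  have "(LINT s:{t0..t}|lborel. b s (X s \<omega>)) = integral {t0..t} (\<lambda>s. b s (X s \<omega>))" if "t \<in> {t0..u}" for t
    by (intro set_lborel_integral_eq_integral(2) set_integrable_lborel_continuous b_path_continuous continuous_on_subset[OF c])
      (use that u in auto)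
  then show "ode t0 x (\<lambda>t. B t \<omega>) u (\<lambda>t. X t \<omega>)"
    using * c u by (auto simp: ode_def)
qed

lemma euler_measurable:
  assumes "0 \<le> t0" "0 \<le> h" "t0 + real k * h \<le> T"
  shows "(\<lambda>\<omega>. euler t0 h x (\<lambda>t. B t \<omega>) k) \<in> borel_measurable (F (t0 + real k * h))"
  using assms(3)
proof (induction k)
  case (Suc k)
  let ?p = "t0 + real k * h" and ?q = "t0 + real (Suc k) * h"
  have "real k * h \<le> real (Suc k) * h"
    using assms by (intro mult_right_mono) auto
  then have pq: "?p \<le> ?q" "?p \<le> T"
    using Suc.prems by linarith+
  have "B ?p \<in> borel_measurable (F ?q)" "B ?q \<in> borel_measurable (F ?q)"
    using assms pq Suc.prems by (auto intro!: B_measurable simp del: of_nat_Suc)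
  moreover have "(\<lambda>\<omega>. euler t0 h x (\<lambda>t. B t \<omega>) k) \<in> borel_measurable (F ?q)"
    using Suc.IH[OF pq(2)] pq(1) by (rule measurable_F_mono)
  ultimately show ?case
    by (auto intro!: borel_measurable_add borel_measurable_times b_measurable borel_measurable_diff simp del: of_nat_Suc)
qed simp

text \<open>The paths are chosen separately for each \<omega>, so the choice carries no
  measurability. Adaptedness comes from the Euler scheme, whose limit at time t involves the
  Brownian path up to t only.\<close>

theorem solution_exists:
  assumes t0: "0 \<le> t0" "t0 < T"
  shows "\<exists>X. solves t0 x X"
proof -
  have "\<forall>\<omega>\<in>space M. \<exists>y. continuous_on {0..T} y \<and> (\<forall>t\<le>t0. y t = x) \<and> (\<forall>u\<in>{t0..<T}. ode t0 x (\<lambda>t. B t \<omega>) u y)"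
    using ode_exists[OF B_continuous t0] by blast
  then obtain Y where Y: "\<And>\<omega>. \<omega> \<in> space M \<Longrightarrow> continuous_on {0..T} (Y \<omega>)"
    "\<And>\<omega> t. \<omega> \<in> space M \<Longrightarrow> t \<le> t0 \<Longrightarrow> Y \<omega> t = x"
    "\<And>\<omega> u. \<omega> \<in> space M \<Longrightarrow> u \<in> {t0..<T} \<Longrightarrow> ode t0 x (\<lambda>t. B t \<omega>) u (Y \<omega>)"
    by metis
  define X where "X t \<omega> = Y \<omega> t" for t \<omega>
  have m1: "X t \<in> borel_measurable (F t)" if "t \<le> t0" for t
    using Y(2) that by (subst measurable_cong[where g="\<lambda>_. x"]) (auto simp: X_def)
  have m2: "X t \<in> borel_measurable (F t)" if t: "t0 < t" "t < T" for t
  proof (rule borel_measurable_LIMSEQ_real)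
    show "(\<lambda>n. euler t0 ((t - t0) / real (Suc n)) x (\<lambda>t. B t \<omega>) (Suc n)) \<longlonglongrightarrow> X t \<omega>" if "\<omega> \<in> space (F t)" for \<omega>
      unfolding X_def using that t by (intro euler_converges Y) auto
    fix n
    have "t0 + real (Suc n) * ((t - t0) / real (Suc n)) = t"
      by simp
    then show "(\<lambda>\<omega>. euler t0 ((t - t0) / real (Suc n)) x (\<lambda>t. B t \<omega>) (Suc n)) \<in> borel_measurable (F t)"
      using euler_measurable[of t0 "(t - t0) / real (Suc n)" "Suc n" x] t t0 by (simp only:) auto
  qed
  have m3: "X T \<in> borel_measurable (F T)"
  proof (rule borel_measurable_LIMSEQ_real)
    note u = approach[OF t0(2)]
    show "(\<lambda>n. X (approach t0 n) \<omega>) \<longlonglongrightarrow> X T \<omega>" if "\<omega> \<in> space (F T)" for \<omega>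
      unfolding X_def using that T u t0
      by (intro continuous_on_tendsto_compose[OF Y(1)]) (auto intro!: always_eventually intro: less_imp_le order_trans[OF t0(1)])
    show "X (approach t0 n) \<in> borel_measurable (F T)" for n
      using m2[OF u(1,2), of n] u(2)[of n] by (auto intro: measurable_F_mono)
  qed
  have "adapted F T X"
    unfolding adapted_def using m1 m2 m3 by (metis atLeastAtMost_iff not_le order.order_iff_strict)
  moreover have "X t \<omega> = x + (LINT s:{t0..t}|lborel. b s (X s \<omega>)) + \<sigma> * (B t \<omega> - B t0 \<omega>)"
    if \<omega>: "\<omega> \<in> space M" and t: "t \<in> {t0..<T}" for \<omega> t
  proof -
    have c: "continuous_on {t0..t} (\<lambda>t. X t \<omega>)"
      and eq: "X t \<omega> = x + integral {t0..t} (\<lambda>s. b s (X s \<omega>)) + \<sigma> * (B t \<omega> - B t0 \<omega>)"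
      using Y(3)[OF \<omega> t] t by (auto simp: ode_def X_def)
    have "(LINT s:{t0..t}|lborel. b s (X s \<omega>)) = integral {t0..t} (\<lambda>s. b s (X s \<omega>))"
      using t by (intro set_lborel_integral_eq_integral(2) set_integrable_lborel_continuous b_path_continuous c) auto
    then show ?thesis
      using eq by simp
  qed
  ultimately have "solves t0 x X"
    unfolding solves_def using Y(1) by (auto simp: X_def)
  then show ?thesis
    by blast
qed

text \<open>The last noise is integrated out first, which replaces \<open>f\<close> by a smoothed
  function; hence the induction over k for arbitrary \<open>f\<close>.\<close>

lemma expectation_euler:
  assumes "0 \<le> t0" "0 < h" "t0 + real k * h \<le> T" and "f \<in> borel_measurable borel" "\<And>x. \<bar>f x\<bar> \<le> K"
  shows "expectation (\<lambda>\<omega>. f (euler t0 h x (\<lambda>t. B t \<omega>) k)) = euler_law t0 h x k f"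
  using assms(3-5)
proof (induction k arbitrary: f)
  case (Suc k)
  let ?p = "t0 + real k * h" and ?q = "t0 + real (Suc k) * h"
  note [measurable] = Suc.prems(2)
  have pq: "?p < ?q" "?q - ?p = h"
    using assms by (auto simp: algebra_simps)
  have em: "(\<lambda>\<omega>. euler t0 h x (\<lambda>t. B t \<omega>) k) \<in> borel_measurable (F ?p)"
    using assms pq Suc.prems by (intro euler_measurable) auto
  have "expectation (\<lambda>\<omega>. f (euler t0 h x (\<lambda>t. B t \<omega>) (Suc k))) =
      expectation (\<lambda>\<omega>. f ((euler t0 h x (\<lambda>t. B t \<omega>) k + h * b ?p (euler t0 h x (\<lambda>t. B t \<omega>) k)) + \<sigma> * (B ?q \<omega> - B ?p \<omega>)))"
    by simp
  also have "\<dots> = expectation (\<lambda>\<omega>. heat (\<sigma> * sqrt (?q - ?p)) f (euler t0 h x (\<lambda>t. B t \<omega>) k + h * b ?p (euler t0 h x (\<lambda>t. B t \<omega>) k)))"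
    using assms pq Suc.prems em
    by (intro markov borel_measurable_add borel_measurable_times borel_measurable_const b_measurable) (auto simp del: of_nat_Suc)
  also have "\<dots> = expectation (\<lambda>\<omega>. (\<lambda>y. heat (\<sigma> * sqrt h) f (y + h * b ?p y)) (euler t0 h x (\<lambda>t. B t \<omega>) k))"
    unfolding pq(2) ..
  also have "\<dots> = euler_law t0 h x k (\<lambda>y. heat (\<sigma> * sqrt h) f (y + h * b ?p y))"
  proof (rule Suc.IH)
    show "?p \<le> T"
      using pq Suc.prems by linarith
    show "\<bar>heat (\<sigma> * sqrt h) f (y + h * b ?p y)\<bar> \<le> K" for y
      using heat_bounds[of f "-K" K] Suc.prems by (auto simp: abs_le_iff minus_le_iff)
  qed measurable
  finally show ?case
    by simp
qed (simp add: prob_space)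

text \<open>The right-hand side mentions neither the space nor X, so solutions on different spaces
  have the same terminal law: weak uniqueness.\<close>

lemma expectation_solution:
  assumes X: "solves t0 x X" and t0: "0 \<le> t0" "t0 < T" and f: "continuous_on UNIV f" "\<And>x. \<bar>f x\<bar> \<le> K"
  shows "expectation (\<lambda>\<omega>. f (X T \<omega>)) =
    lim (\<lambda>m. lim (\<lambda>n. euler_law t0 ((approach t0 m - t0) / real (Suc n)) x (Suc n) f))"
proof -
  have [measurable]: "f \<in> borel_measurable borel"
    using f(1) by (rule borel_measurable_continuous_onI)
  have cont: "isCont f y" for y
    using f(1) by (simp add: continuous_on_eq_continuous_at)
  note u = approach[OF t0(2)]
  have Xm: "X (approach t0 m) \<in> borel_measurable M" for m
    using u(1,2)[of m] t0 by (intro X_measurable_M[OF X t0]) auto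
  have XT: "X T \<in> borel_measurable M"
    using T by (intro X_measurable_M[OF X t0]) auto
  have 1: "(\<lambda>n. euler_law t0 ((approach t0 m - t0) / real (Suc n)) x (Suc n) f) \<longlonglongrightarrow> expectation (\<lambda>\<omega>. f (X (approach t0 m) \<omega>))" for m
  proof -
    let ?E = "\<lambda>n \<omega>. euler t0 ((approach t0 m - t0) / real (Suc n)) x (\<lambda>t. B t \<omega>) (Suc n)"
    have p: "t0 + real (Suc n) * ((approach t0 m - t0) / real (Suc n)) = approach t0 m" for n
      by simp
    have Em: "?E n \<in> borel_measurable M" for n
      using euler_measurable[of t0 "(approach t0 m - t0) / real (Suc n)" "Suc n" x] u(1,2)[of m] t0
      unfolding p by (intro measurable_F[of _ "approach t0 m"]) auto
    have "(\<lambda>n. expectation (\<lambda>\<omega>. f (?E n \<omega>))) \<longlonglongrightarrow> expectation (\<lambda>\<omega>. f (X (approach t0 m) \<omega>))"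
    proof (rule integral_dominated_convergence[where w="\<lambda>_. K"])
      show "AE \<omega> in M. (\<lambda>n. f (?E n \<omega>)) \<longlonglongrightarrow> f (X (approach t0 m) \<omega>)"
        using solves_ode[OF X t0]
      proof eventually_elim
        case (elim \<omega>)
        have "(\<lambda>n. ?E n \<omega>) \<longlonglongrightarrow> X (approach t0 m) \<omega>"
          using elim u(1,2)[of m] by (intro euler_converges) auto
        then show ?case
          by (rule isCont_tendsto_compose[OF cont])
      qed
      show "(\<lambda>\<omega>. f (X (approach t0 m) \<omega>)) \<in> borel_measurable M"
        using Xm by measurable
      fix n
      show "(\<lambda>\<omega>. f (?E n \<omega>)) \<in> borel_measurable M"
        using Em by measurable
      show "AE \<omega> in M. norm (f (?E n \<omega>)) \<le> K"
        using f(2) by simp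
    qed simp
    moreover have "expectation (\<lambda>\<omega>. f (?E n \<omega>)) = euler_law t0 ((approach t0 m - t0) / real (Suc n)) x (Suc n) f" for n
      using u(1,2)[of m] t0 f(2) by (intro expectation_euler) (simp_all only: p, auto)
    ultimately show ?thesis
      by simp
  qed
  have "(\<lambda>m. expectation (\<lambda>\<omega>. f (X (approach t0 m) \<omega>))) \<longlonglongrightarrow> expectation (\<lambda>\<omega>. f (X T \<omega>))"
  proof (rule integral_dominated_convergence[where w="\<lambda>_. K"])
    show "AE \<omega> in M. (\<lambda>m. f (X (approach t0 m) \<omega>)) \<longlonglongrightarrow> f (X T \<omega>)"
    proof (rule AE_I2)
      fix \<omega> assume \<omega>: "\<omega> \<in> space M"
      have "(\<lambda>m. X (approach t0 m) \<omega>) \<longlonglongrightarrow> X T \<omega>"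
        by (rule continuous_on_tendsto_compose[OF X_continuous[OF X t0 \<omega>] u(3)])
          (use T t0 u(1,2) in \<open>auto intro!: always_eventually intro: less_imp_le order_trans[OF t0(1)]\<close>)
      then show "(\<lambda>m. f (X (approach t0 m) \<omega>)) \<longlonglongrightarrow> f (X T \<omega>)"
        by (rule isCont_tendsto_compose[OF cont])
    qed
    show "(\<lambda>\<omega>. f (X T \<omega>)) \<in> borel_measurable M"
      using XT by measurable
    fix m
    show "(\<lambda>\<omega>. f (X (approach t0 m) \<omega>)) \<in> borel_measurable M"
      using Xm by measurable
    show "AE \<omega> in M. norm (f (X (approach t0 m) \<omega>)) \<le> K"
      using f(2) by simp
  qed simp
  then show ?thesis
    using limI[OF 1] limI by (simp add: limI)
qed

lemma path_map_solution:
  assumes X: "solves 0 0 X"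
  shows "AE \<omega> in M. X T \<omega> = path_map (\<lambda>t\<in>{0..T}. B t \<omega>)"
  using solves_ode[OF X order_refl T]
proof (rule AE_mp, intro AE_I2 impI)
  fix \<omega> assume \<omega>: "\<omega> \<in> space M" and *: "\<forall>u\<in>{0..<T}. ode 0 0 (\<lambda>t. B t \<omega>) u (\<lambda>t. X t \<omega>)"
  note u = approach[OF T]
  \<comment> \<open>Restriction to [0, T] makes the path a point of the product space; the scheme
    samples it at grid points in [0, T] and sees no difference.\<close>
  have eq: "euler 0 h 0 (\<lambda>t\<in>{0..T}. B t \<omega>) k = euler 0 h 0 (\<lambda>t. B t \<omega>) k" if "h \<ge> 0" "real k * h \<le> T" for h k
    using that
  proof (induction k)
    case (Suc k)
    have "real k * h \<le> real (Suc k) * h"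
      using Suc by (intro mult_right_mono) auto
    then have "real k * h \<in> {0..T}" "real (Suc k) * h \<in> {0..T}"
      using Suc by auto
    then show ?case
      using Suc by (auto simp del: of_nat_Suc)
  qed simp
  have "(\<lambda>n. euler 0 (approach 0 m / real (Suc n)) 0 (\<lambda>t\<in>{0..T}. B t \<omega>) (Suc n)) \<longlonglongrightarrow> X (approach 0 m) \<omega>" for m
  proof -
    have "euler 0 (approach 0 m / real (Suc n)) 0 (\<lambda>t\<in>{0..T}. B t \<omega>) (Suc n) = euler 0 ((approach 0 m - 0) / real (Suc n)) 0 (\<lambda>t. B t \<omega>) (Suc n)" for n
      using u(1,2)[of m] by (subst eq) auto
    then show ?thesis
      using * u(1,2)[of m] by (simp only:) (intro euler_converges, auto)
  qed
  then have "lim (\<lambda>n. euler 0 (approach 0 m / real (Suc n)) 0 (\<lambda>t\<in>{0..T}. B t \<omega>) (Suc n)) = X (approach 0 m) \<omega>" for m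
    by (rule limI)
  then have "path_map (\<lambda>t\<in>{0..T}. B t \<omega>) = lim (\<lambda>m. X (approach 0 m) \<omega>)"
    by (simp only: path_map_def)
  also have "(\<lambda>m. X (approach 0 m) \<omega>) \<longlonglongrightarrow> X T \<omega>"
    by (rule continuous_on_tendsto_compose[OF X_continuous[OF X order_refl T \<omega>] u(3)])
      (use T u(1,2) in \<open>auto intro!: always_eventually intro: less_imp_le\<close>)
  then have "lim (\<lambda>m. X (approach 0 m) \<omega>) = X T \<omega>"
    by (rule limI)
  finally show "X T \<omega> = path_map (\<lambda>t\<in>{0..T}. B t \<omega>)" ..
qed

end

text \<open>The test functions cos (t x) and sin (t x) determine the characteristic function, and by
  Levy's theorem the law. The two spaces may have different types, as those of the fixed point and
  of the game may.\<close>

lemma distr_eqI_bounded_continuous: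
  fixes M1 :: "'a measure" and M2 :: "'b measure"
  assumes "prob_space M1" "prob_space M2" and [measurable]: "X \<in> borel_measurable M1" "Y \<in> borel_measurable M2"
    and eq: "\<And>f :: real \<Rightarrow> real. continuous_on UNIV f \<Longrightarrow> (\<And>x. \<bar>f x\<bar> \<le> 1) \<Longrightarrow> (\<integral>\<omega>. f (X \<omega>) \<partial>M1) = (\<integral>\<omega>. f (Y \<omega>) \<partial>M2)"
  shows "distr M1 borel X = distr M2 borel Y"
proof -
  interpret M1: prob_space M1 by fact
  interpret M2: prob_space M2 by fact
  have char: "char (distr M borel Z) t = complex_of_real (\<integral>\<omega>. cos (t * Z \<omega>) \<partial>M) + \<i> * complex_of_real (\<integral>\<omega>. sin (t * Z \<omega>) \<partial>M)"
    if "prob_space M" and [measurable]: "Z \<in> borel_measurable M" for M :: "'c measure" and Z t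
  proof -
    interpret prob_space M by fact
    have i: "integrable M (\<lambda>\<omega>. cos (t * Z \<omega>))" "integrable M (\<lambda>\<omega>. sin (t * Z \<omega>))"
      by (auto intro!: integrable_const_bound[where B=1])
    have "char (distr M borel Z) t = (\<integral>\<omega>. iexp (t * Z \<omega>) \<partial>M)"
      unfolding char_def by (subst integral_distr) auto
    also have "\<dots> = (\<integral>\<omega>. complex_of_real (cos (t * Z \<omega>)) + \<i> * complex_of_real (sin (t * Z \<omega>)) \<partial>M)"
      by (intro Bochner_Integration.integral_cong refl) (simp add: exp_Euler cos_of_real sin_of_real flip: of_real_mult)
    also have "\<dots> = complex_of_real (\<integral>\<omega>. cos (t * Z \<omega>) \<partial>M) + \<i> * complex_of_real (\<integral>\<omega>. sin (t * Z \<omega>) \<partial>M)"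
      using i by simp
    finally show ?thesis .
  qed
  show ?thesis
  proof (rule Levy_uniqueness)
    show "real_distribution (distr M1 borel X)" "real_distribution (distr M2 borel Y)"
      by (auto intro!: M1.real_distribution_distr M2.real_distribution_distr)
    show "char (distr M1 borel X) = char (distr M2 borel Y)"
    proof
      fix t
      have "(\<integral>\<omega>. cos (t * X \<omega>) \<partial>M1) = (\<integral>\<omega>. cos (t * Y \<omega>) \<partial>M2)" "(\<integral>\<omega>. sin (t * X \<omega>) \<partial>M1) = (\<integral>\<omega>. sin (t * Y \<omega>) \<partial>M2)"
        by (auto intro!: eq[of "\<lambda>x. cos (t * x)"] eq[of "\<lambda>x. sin (t * x)"] continuous_intros)
      then show "char (distr M1 borel X) t = char (distr M2 borel Y) t"
        by (simp add: char assms(1,2))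
    qed
  qed
qed

section \<open>The empirical distribution function\<close>

text \<open>The inequality (p + q)^2 <= 6 p^2 + (6/5) q^2 used twice; the constants are 6^3 and
  (6/5)^3. The second must be below 2: in \<open>maximal_fourth_moment\<close> two halves, each with
  a quarter of the squared mass, return with the factor (6/5)^3 / 2 < 1.\<close>

lemma fourth_power_add_le: "(x + y) ^ 4 \<le> 216 * x ^ 4 + (216 / 125) * y ^ 4" for x y :: real
proof -
  have 1: "(p + q)\<^sup>2 \<le> 6 * p\<^sup>2 + 6 / 5 * q\<^sup>2" for p q :: real
    using zero_le_power2[of "5 * p - q"] by (simp add: power2_eq_square algebra_simps)
  have "((x + y)\<^sup>2)\<^sup>2 \<le> (6 * x\<^sup>2 + 6 / 5 * y\<^sup>2)\<^sup>2"
    by (intro power_mono 1) auto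
  also have "\<dots> \<le> 6 * (6 * x\<^sup>2)\<^sup>2 + 6 / 5 * (6 / 5 * y\<^sup>2)\<^sup>2"
    by (rule 1)
  finally show ?thesis
    by (simp add: power_mult_distrib power_divide flip: power_mult)
qed

text \<open>After Billingsley; the induction cuts the block at the index where half of its mass is reached.\<close>

lemma (in prob_space) maximal_fourth_moment:
  fixes S :: "nat \<Rightarrow> 'a \<Rightarrow> real" and u :: "nat \<Rightarrow> real"
  assumes S [measurable]: "\<And>k. S k \<in> borel_measurable M" and bd: "\<And>k \<omega>. \<bar>S k \<omega>\<bar> \<le> K"
    and u: "\<And>k. 0 \<le> u k" and A: "A \<ge> 0"
    and incr: "\<And>i j. i \<le> j \<Longrightarrow> expectation (\<lambda>\<omega>. (S j \<omega> - S i \<omega>) ^ 4) \<le> A * (\<Sum>k\<in>{i..<j}. u k)\<^sup>2"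
    and "a \<le> b"
  shows "expectation (\<lambda>\<omega>. Max ((\<lambda>k. \<bar>S k \<omega> - S a \<omega>\<bar>) ` {a..b}) ^ 4) \<le> 1600 * A * (\<Sum>k\<in>{a..<b}. u k)\<^sup>2"
  using \<open>a \<le> b\<close>
proof (induction "b - a" arbitrary: a b rule: less_induct)
  case less
  define D where "D a b \<omega> = Max ((\<lambda>k. \<bar>S k \<omega> - S a \<omega>\<bar>) ` {a..b})" for a b \<omega>
  have D_meas [measurable]: "D a b \<in> borel_measurable M" for a b
    unfolding D_def[abs_def] by measurable
  have diff: "\<bar>S j \<omega> - S i \<omega>\<bar> \<le> 2 * K" for i j \<omega>
    using bd[of j \<omega>] bd[of i \<omega>] by linarith
  have D0: "0 \<le> D a b \<omega>" and DK: "D a b \<omega> \<le> 2 * K" if "a \<le> b" for a b \<omega>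
    using that diff unfolding D_def by (auto simp: Max_ge_iff intro!: exI[of _ a])
  have D_ge: "\<bar>S k \<omega> - S a \<omega>\<bar> \<le> D a b \<omega>" if "a \<le> k" "k \<le> b" for a b k \<omega>
    unfolding D_def using that by (intro Max_ge) auto
  have int: "integrable M (\<lambda>\<omega>. D a b \<omega> ^ 4)" if "a \<le> b" for a b
  proof (rule integrable_const_bound)
    have "norm (D a b \<omega> ^ 4) \<le> (2 * K) ^ 4" for \<omega>
      unfolding real_norm_def power_abs using D0[OF that] DK[OF that] by (intro power_mono) auto
    then show "AE \<omega> in M. norm (D a b \<omega> ^ 4) \<le> (2 * K) ^ 4"
      by simp
  qed measurable
  have intS: "integrable M (\<lambda>\<omega>. (S j \<omega> - S i \<omega>) ^ 4)" for i j
  proof (rule integrable_const_bound[where B="(2 * K) ^ 4"])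
    show "AE \<omega> in M. norm ((S j \<omega> - S i \<omega>) ^ 4) \<le> (2 * K) ^ 4"
      using diff unfolding real_norm_def power_abs by (intro always_eventually allI power_mono) auto
  qed measurable
  define w where "w = (\<Sum>k\<in>{a..<b}. u k)"
  have w0: "w \<ge> 0"
    unfolding w_def using u by (intro sum_nonneg) auto
  show ?case
  proof (cases "a = b")
    case True
    then show ?thesis
      by simp
  next
    case False
    with less.prems have ab: "a < b" by simp
    define m where "m = (LEAST m. a < m \<and> w / 2 \<le> (\<Sum>k\<in>{a..<m}. u k))"
    have b: "a < b \<and> w / 2 \<le> (\<Sum>k\<in>{a..<b}. u k)"
      using ab w0 by (simp add: w_def)
    have "a < m \<and> w / 2 \<le> (\<Sum>k\<in>{a..<m}. u k)"
      unfolding m_def by (rule LeastI) (rule b)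
    then have m: "a < m" "w / 2 \<le> (\<Sum>k\<in>{a..<m}. u k)"
      by auto
    have mb: "m \<le> b"
      unfolding m_def by (rule Least_le) (rule b)
    \<comment> \<open>By minimality of \<open>m\<close>. The left block ends at m - 1 and the right
      one starts at m, so the possibly large weight u (m - 1) lies in neither; the step across it is
      part of S m - S a.\<close>
    have left: "(\<Sum>k\<in>{a..<m - 1}. u k) \<le> w / 2"
    proof (cases "a < m - 1")
      case True
      have "\<not> (a < m - 1 \<and> w / 2 \<le> (\<Sum>k\<in>{a..<m - 1}. u k))"
        using m unfolding m_def by (intro not_less_Least) auto
      then show ?thesis
        using True by auto
    next
      case False
      then show ?thesis
        using w0 by simp
    qed
    have "(\<Sum>k\<in>{a..<m}. u k) + (\<Sum>k\<in>{m..<b}. u k) = w"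
      unfolding w_def using m mb by (intro sum.atLeastLessThan_concat) auto
    then have right: "(\<Sum>k\<in>{m..<b}. u k) \<le> w / 2"
      using m by linarith
    have l0: "(\<Sum>k\<in>{a..<m - 1}. u k) \<ge> 0" "(\<Sum>k\<in>{m..<b}. u k) \<ge> 0"
      using u by (auto intro!: sum_nonneg)
    have am: "a \<le> m - 1"
      using m by simp
    have E1: "expectation (\<lambda>\<omega>. D a (m - 1) \<omega> ^ 4) \<le> 1600 * A * (w / 2)\<^sup>2"
    proof -
      have "expectation (\<lambda>\<omega>. D a (m - 1) \<omega> ^ 4) \<le> 1600 * A * (\<Sum>k\<in>{a..<m - 1}. u k)\<^sup>2"
        unfolding D_def using m mb am by (intro less.hyps) auto
      also have "\<dots> \<le> 1600 * A * (w / 2)\<^sup>2"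
        using left l0 A by (intro mult_left_mono power_mono) auto
      finally show ?thesis .
    qed
    have E2: "expectation (\<lambda>\<omega>. D m b \<omega> ^ 4) \<le> 1600 * A * (w / 2)\<^sup>2"
    proof -
      have "expectation (\<lambda>\<omega>. D m b \<omega> ^ 4) \<le> 1600 * A * (\<Sum>k\<in>{m..<b}. u k)\<^sup>2"
        unfolding D_def using m mb by (intro less.hyps) auto
      also have "\<dots> \<le> 1600 * A * (w / 2)\<^sup>2"
        using right l0 A by (intro mult_left_mono power_mono) auto
      finally show ?thesis .
    qed
    have E3: "expectation (\<lambda>\<omega>. (S m \<omega> - S a \<omega>) ^ 4) \<le> A * w\<^sup>2"
    proof -
      have "expectation (\<lambda>\<omega>. (S m \<omega> - S a \<omega>) ^ 4) \<le> A * (\<Sum>k\<in>{a..<m}. u k)\<^sup>2"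
        using m by (intro incr) auto
      also have "(\<Sum>k\<in>{a..<m}. u k) \<le> w"
        unfolding w_def using mb u by (intro sum_mono2) auto
      then have "A * (\<Sum>k\<in>{a..<m}. u k)\<^sup>2 \<le> A * w\<^sup>2"
        using A u by (intro mult_left_mono power_mono sum_nonneg) auto
      finally show ?thesis .
    qed
    have pw: "D a b \<omega> ^ 4 \<le> 216 * (S m \<omega> - S a \<omega>) ^ 4 + (216 / 125) * (D a (m - 1) \<omega> ^ 4 + D m b \<omega> ^ 4)" for \<omega>
    proof -
      let ?x = "\<bar>S m \<omega> - S a \<omega>\<bar>" and ?y = "max (D a (m - 1) \<omega>) (D m b \<omega>)"
      have "D a b \<omega> \<le> ?x + ?y"
        unfolding D_def[of a b]
      proof (rule Max.boundedI)
        fix q assume "q \<in> (\<lambda>k. \<bar>S k \<omega> - S a \<omega>\<bar>) ` {a..b}"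
        then obtain k where k: "a \<le> k" "k \<le> b" "q = \<bar>S k \<omega> - S a \<omega>\<bar>"
          by auto
        show "q \<le> ?x + ?y"
        proof (cases "k < m")
          case True
          then have "q \<le> D a (m - 1) \<omega>"
            using k by (auto intro!: D_ge)
          then show ?thesis by linarith
        next
          case False
          then have "\<bar>S k \<omega> - S m \<omega>\<bar> \<le> D m b \<omega>"
            using k by (intro D_ge) auto
          then show ?thesis
            using k by linarith
        qed
      qed (use ab in auto)
      then have "D a b \<omega> ^ 4 \<le> (?x + ?y) ^ 4"
        using D0[of a b \<omega>] ab by (intro power_mono) auto
      also have "\<dots> \<le> 216 * ?x ^ 4 + (216 / 125) * ?y ^ 4"
        by (rule fourth_power_add_le)
      also have "?y ^ 4 \<le> D a (m - 1) \<omega> ^ 4 + D m b \<omega> ^ 4"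
        using D0[OF am, of \<omega>] D0[OF mb, of \<omega>] by (auto simp: max_def)
      finally show ?thesis
        by (simp add: power_abs)
    qed
    have "expectation (\<lambda>\<omega>. D a b \<omega> ^ 4) \<le> expectation (\<lambda>\<omega>. 216 * (S m \<omega> - S a \<omega>) ^ 4 + (216 / 125) * (D a (m - 1) \<omega> ^ 4 + D m b \<omega> ^ 4))"
      using ab am mb by (intro integral_mono int pw Bochner_Integration.integrable_add integrable_mult_right intS) auto
    also have "\<dots> = 216 * expectation (\<lambda>\<omega>. (S m \<omega> - S a \<omega>) ^ 4) + (216 / 125) * (expectation (\<lambda>\<omega>. D a (m - 1) \<omega> ^ 4) + expectation (\<lambda>\<omega>. D m b \<omega> ^ 4))"
      using int[OF am] int[OF mb] intS[of m a] by simp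
    also have "\<dots> \<le> 216 * (A * w\<^sup>2) + (216 / 125) * (1600 * A * (w / 2)\<^sup>2 + 1600 * A * (w / 2)\<^sup>2)"
      using E1 E2 E3 by (intro add_mono mult_left_mono) auto
    also have "\<dots> = (216 + 216 / 125 * 800) * (A * w\<^sup>2)"
      by (simp add: power_divide)
    \<comment> \<open>1600 is chosen so that 216 + (108 / 125) * 1600 = 1598.4 stays below it, which
      closes the induction.\<close>
    also have "\<dots> \<le> 1600 * (A * w\<^sup>2)"
      using A by (intro mult_right_mono) auto
    finally show ?thesis
      unfolding D_def w_def by (simp add: mult.assoc)
  qed
qed

section \<open>Moments of centered sums of independent indicators\<close>

lemma (in prob_space) expectation_mult_indep:
  fixes X Y :: "'a \<Rightarrow> real" and f h :: "real \<Rightarrow> real"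
  assumes "indep_var borel X borel Y" "f \<in> borel_measurable borel" "h \<in> borel_measurable borel"
    and "integrable M (\<lambda>\<omega>. f (X \<omega>))" "integrable M (\<lambda>\<omega>. h (Y \<omega>))"
  shows "expectation (\<lambda>\<omega>. f (X \<omega>) * h (Y \<omega>)) = expectation (\<lambda>\<omega>. f (X \<omega>)) * expectation (\<lambda>\<omega>. h (Y \<omega>))"
  using indep_var_lebesgue_integral[OF indep_var_compose[OF assms(1,2,3), unfolded comp_def]] assms(4,5)
  by simp

text \<open>Summands are added one at a time. The new one is independent of the rest, so each mixed
  term with a first power of a centered factor vanishes and only 6 \<eta>^2 S^2 is left. This is why
  the second moment is carried along; 3 k^2 + 6 k <= 3 (k + 1)^2 then closes the induction.\<close>

lemma (in prob_space) centered_indicator_moments: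
  fixes \<xi> :: "'i \<Rightarrow> 'a \<Rightarrow> real" and p :: real and S :: "'i set \<Rightarrow> 'a \<Rightarrow> real"
  assumes ind: "indep_vars (\<lambda>_. borel) \<xi> I" and "finite I"
    and law: "\<And>i. i \<in> I \<Longrightarrow> distr M borel (\<xi> i) = \<mu>" and A: "A \<in> sets borel"
  defines "p \<equiv> measure \<mu> A"
  defines "S \<equiv> \<lambda>J \<omega>. \<Sum>i\<in>J. indicator A (\<xi> i \<omega>) - p"
  assumes "J \<subseteq> I"
  shows "expectation (S J) = 0 \<and> expectation (\<lambda>\<omega>. S J \<omega> ^ 2) \<le> real (card J) * p \<and>
    expectation (\<lambda>\<omega>. S J \<omega> ^ 4) \<le> 3 * (real (card J))\<^sup>2 * p\<^sup>2 + real (card J) * p"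
proof -
  have finJ: "finite J"
    using assms(2,7) finite_subset by blast
  define \<eta> where "\<eta> i \<omega> = indicator A (\<xi> i \<omega>) - p" for i \<omega>
  have \<xi>m [measurable]: "\<xi> i \<in> borel_measurable M" if "i \<in> I" for i
    using ind that by (auto simp: indep_vars_def)
  note A [measurable]
  have \<eta>m: "\<eta> i \<in> borel_measurable M" if "i \<in> I" for i
    unfolding \<eta>_def[abs_def] using \<xi>m[OF that] by measurable
  have Sm: "S J \<in> borel_measurable M" if "J \<subseteq> I" for J
    unfolding S_def \<eta>_def[symmetric] using that by (intro borel_measurable_sum \<eta>m) auto
  have p01: "0 \<le> p" "I \<noteq> {} \<Longrightarrow> p \<le> 1"
  proof -
    show "0 \<le> p"
      by (simp add: p_def)
    assume "I \<noteq> {}"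
    then obtain i where i: "i \<in> I" by blast
    interpret P: prob_space "distr M borel (\<xi> i)"
      by (rule prob_space_distr) (rule \<xi>m[OF i])
    show "p \<le> 1"
      unfolding p_def law[OF i, symmetric] by simp
  qed
  have \<eta>1: "\<bar>\<eta> i \<omega>\<bar> \<le> 1" if "I \<noteq> {}" for i \<omega>
    using p01 that by (auto simp: \<eta>_def indicator_def)
  have Sbd: "\<bar>S J \<omega>\<bar> \<le> card J" if "J \<subseteq> I" for J \<omega>
  proof -
    have "\<bar>S J \<omega>\<bar> \<le> (\<Sum>i\<in>J. \<bar>\<eta> i \<omega>\<bar>)"
      unfolding S_def \<eta>_def by (rule sum_abs)
    also have "\<dots> \<le> (\<Sum>i\<in>J. 1)"
      using that by (intro sum_mono \<eta>1) auto
    finally show ?thesis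
      by simp
  qed
  have Si: "integrable M (\<lambda>\<omega>. S J \<omega> ^ k)" if "J \<subseteq> I" for J k
  proof (rule integrable_const_bound[where B="real (card J) ^ k"])
    show "AE \<omega> in M. norm (S J \<omega> ^ k) \<le> real (card J) ^ k"
      using Sbd[OF that] by (auto simp: power_abs intro!: power_mono)
    show "(\<lambda>\<omega>. S J \<omega> ^ k) \<in> borel_measurable M"
      using Sm[OF that] by measurable
  qed
  have \<eta>i: "integrable M (\<lambda>\<omega>. \<eta> i \<omega> ^ k)" if "i \<in> I" for i k
  proof (rule integrable_const_bound[where B=1])
    show "AE \<omega> in M. norm (\<eta> i \<omega> ^ k) \<le> 1"
      using \<eta>1[of i] that by (intro always_eventually allI) (auto simp: power_abs intro!: power_le_one)
    show "(\<lambda>\<omega>. \<eta> i \<omega> ^ k) \<in> borel_measurable M"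
      using \<eta>m[OF that] by measurable
  qed
  have E_ind: "expectation (\<lambda>\<omega>. indicator A (\<xi> i \<omega>)) = p" if "i \<in> I" for i
  proof -
    have "expectation (\<lambda>\<omega>. indicator A (\<xi> i \<omega>)) = (\<integral>x. (indicator A x :: real) \<partial>distr M borel (\<xi> i))"
      by (subst integral_distr[OF \<xi>m[OF that], of "indicator A :: real \<Rightarrow> real"]) simp_all
    then show ?thesis
      using A by (simp add: p_def law[OF that, symmetric])
  qed
  have ii: "integrable M (\<lambda>\<omega>. indicator A (\<xi> i \<omega>) :: real)" if "i \<in> I" for i
    using \<xi>m[OF that] by (intro integrable_const_bound[where B=1]) auto
  have e1: "expectation (\<eta> i) = 0" if "i \<in> I" for i
    unfolding \<eta>_def[abs_def] using ii[OF that] E_ind[OF that] by (simp add: prob_space)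
  have e2: "expectation (\<lambda>\<omega>. \<eta> i \<omega> ^ 2) \<le> p" if "i \<in> I" for i
  proof -
    have "\<eta> i \<omega> ^ 2 = (1 - 2 * p) * indicator A (\<xi> i \<omega>) + p\<^sup>2" for \<omega>
      by (auto simp: \<eta>_def indicator_def power2_eq_square algebra_simps)
    then have "expectation (\<lambda>\<omega>. \<eta> i \<omega> ^ 2) = (1 - 2 * p) * p + p\<^sup>2"
      using ii[OF that] E_ind[OF that] by (simp add: prob_space)
    also have "\<dots> = p - p\<^sup>2"
      by (simp add: power2_eq_square algebra_simps)
    also have "\<dots> \<le> p"
      by simp
    finally show ?thesis .
  qed
  have e4: "expectation (\<lambda>\<omega>. \<eta> i \<omega> ^ 4) \<le> p" if "i \<in> I" for i
  proof -
    have "expectation (\<lambda>\<omega>. \<eta> i \<omega> ^ 4) \<le> expectation (\<lambda>\<omega>. \<eta> i \<omega> ^ 2)"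
    proof (rule integral_mono)
      fix \<omega>
      have "(\<eta> i \<omega>)\<^sup>2 \<le> 1"
        using \<eta>1[of i \<omega>] that by (auto simp: abs_square_le_1)
      then have "(\<eta> i \<omega>)\<^sup>2 * (\<eta> i \<omega>)\<^sup>2 \<le> 1 * (\<eta> i \<omega>)\<^sup>2"
        by (intro mult_right_mono) auto
      then show "\<eta> i \<omega> ^ 4 \<le> \<eta> i \<omega> ^ 2"
        by (simp flip: power_add)
    qed (use \<eta>i that in auto)
    then show ?thesis
      using e2[OF that] by linarith
  qed
  show ?thesis
    using finJ \<open>J \<subseteq> I\<close>
  proof (induction J rule: finite_induct)
    case empty
    then show ?case
      by (simp add: S_def)
  next
    case (insert j J)
    then have j: "j \<in> I" and J: "J \<subseteq> I" "finite J" "j \<notin> J"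
      by auto
    note IH = insert.IH[OF J(1)]
    have "indep_vars (\<lambda>_. borel) \<eta> (insert j J)"
      using indep_vars_compose2[OF indep_vars_subset[OF ind insert.prems], of "\<lambda>_ x. indicator A x - p" "\<lambda>_. borel"]
      by (simp add: \<eta>_def[abs_def])
    then have jS: "indep_var borel (\<eta> j) borel (S J)"
      using indep_vars_sum[OF J(2,3), of \<eta>] by (simp add: S_def \<eta>_def[abs_def])
    have mult: "expectation (\<lambda>\<omega>. \<eta> j \<omega> ^ a * S J \<omega> ^ b) = expectation (\<lambda>\<omega>. \<eta> j \<omega> ^ a) * expectation (\<lambda>\<omega>. S J \<omega> ^ b)" for a b
      using \<eta>i[OF j, of a] Si[OF J(1), of b] by (intro expectation_mult_indep[OF jS]) auto
    have multi: "integrable M (\<lambda>\<omega>. \<eta> j \<omega> ^ a * S J \<omega> ^ b)" for a b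
    proof (rule integrable_const_bound[where B="real (card J) ^ b"])
      have "\<bar>\<eta> j \<omega>\<bar> ^ a * \<bar>S J \<omega>\<bar> ^ b \<le> 1 * real (card J) ^ b" for \<omega>
        using \<eta>1[of j \<omega>] Sbd[OF J(1), of \<omega>] j by (intro mult_mono power_mono power_le_one) auto
      then show "AE \<omega> in M. norm (\<eta> j \<omega> ^ a * S J \<omega> ^ b) \<le> real (card J) ^ b"
        by (simp add: abs_mult power_abs)
      show "(\<lambda>\<omega>. \<eta> j \<omega> ^ a * S J \<omega> ^ b) \<in> borel_measurable M"
        using \<eta>m[OF j] Sm[OF J(1)] by measurable
    qed
    have SS: "S (insert j J) = (\<lambda>\<omega>. \<eta> j \<omega> + S J \<omega>)"
      using J by (simp add: S_def \<eta>_def fun_eq_iff)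
    have c: "real (card (insert j J)) = real (card J) + 1"
      using J by simp
    have E1: "expectation (S (insert j J)) = 0"
      unfolding SS using \<eta>i[OF j, of 1] Si[OF J(1), of 1] e1[OF j] IH by simp
    have "expectation (\<lambda>\<omega>. S (insert j J) \<omega> ^ 2) =
        expectation (\<lambda>\<omega>. \<eta> j \<omega> ^ 2 + 2 * (\<eta> j \<omega> ^ 1 * S J \<omega> ^ 1) + S J \<omega> ^ 2)"
      unfolding SS by (simp add: power2_sum mult.assoc add_ac mult.commute[of "S J _"])
    also have "\<dots> = expectation (\<lambda>\<omega>. \<eta> j \<omega> ^ 2) + 2 * (expectation (\<lambda>\<omega>. \<eta> j \<omega> ^ 1) * expectation (\<lambda>\<omega>. S J \<omega> ^ 1)) + expectation (\<lambda>\<omega>. S J \<omega> ^ 2)"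
      unfolding mult[symmetric] using \<eta>i[OF j, of 2] Si[OF J(1), of 2] multi[of 1 1] by simp
    also have "\<dots> \<le> p + 0 + real (card J) * p"
      using e1[OF j] e2[OF j] IH by simp
    finally have E2: "expectation (\<lambda>\<omega>. S (insert j J) \<omega> ^ 2) \<le> real (card (insert j J)) * p"
      unfolding c by (simp add: algebra_simps)
    have "(x + y) ^ 4 = x ^ 4 + 4 * (x ^ 3 * y ^ 1) + 6 * (x ^ 2 * y ^ 2) + 4 * (x ^ 1 * y ^ 3) + y ^ 4" for x y :: real
      by (simp add: power4_eq_xxxx power3_eq_cube power2_eq_square algebra_simps)
    then have "expectation (\<lambda>\<omega>. S (insert j J) \<omega> ^ 4) =
        expectation (\<lambda>\<omega>. \<eta> j \<omega> ^ 4 + 4 * (\<eta> j \<omega> ^ 3 * S J \<omega> ^ 1) + 6 * (\<eta> j \<omega> ^ 2 * S J \<omega> ^ 2) + 4 * (\<eta> j \<omega> ^ 1 * S J \<omega> ^ 3) + S J \<omega> ^ 4)"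
      unfolding SS by (simp only:)
    also have "\<dots> = expectation (\<lambda>\<omega>. \<eta> j \<omega> ^ 4) + 4 * (expectation (\<lambda>\<omega>. \<eta> j \<omega> ^ 3) * expectation (\<lambda>\<omega>. S J \<omega> ^ 1))
        + 6 * (expectation (\<lambda>\<omega>. \<eta> j \<omega> ^ 2) * expectation (\<lambda>\<omega>. S J \<omega> ^ 2))
        + 4 * (expectation (\<lambda>\<omega>. \<eta> j \<omega> ^ 1) * expectation (\<lambda>\<omega>. S J \<omega> ^ 3)) + expectation (\<lambda>\<omega>. S J \<omega> ^ 4)"
      unfolding mult[symmetric]
      using \<eta>i[OF j, of 4] Si[OF J(1), of 4] multi[of 3 1] multi[of 2 2] multi[of 1 3]
      by (subst Bochner_Integration.integral_add, simp, simp)+ simp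
    also have "\<dots> \<le> p + 0 + 6 * (p * (real (card J) * p)) + 0 + (3 * (real (card J))\<^sup>2 * p\<^sup>2 + real (card J) * p)"
    proof (intro add_mono mult_left_mono mult_mono)
      show "0 \<le> expectation (\<lambda>\<omega>. S J \<omega> ^ 2)"
        by simp
    qed (use e1[OF j] e2[OF j] e4[OF j] IH p01 in auto)
    also have "\<dots> \<le> 3 * (real (card (insert j J)))\<^sup>2 * p\<^sup>2 + real (card (insert j J)) * p"
      unfolding c by (simp add: power2_eq_square algebra_simps)
    finally show ?case
      using E1 E2 by simp
  qed
qed

text \<open>The cuts are the open and the closed half-lines at the quantiles of level \<open>j / N\<close>, so that an atom of
  \<open>\<mu>\<close> is a cell of its own and the open cells have mass at most \<open>1 / N\<close>.\<close>

lemma half_line_grid: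
  assumes "real_distribution \<mu>" and N: "(N :: nat) \<ge> 1"
  obtains C :: "nat \<Rightarrow> real set" where "\<And>k. C k \<in> sets borel" "mono C" "C 0 = {}"
    "\<And>x. \<exists>j<N. C (2 * j) \<subseteq> {..x} \<and> {..x} \<subseteq> C (2 * j + 1) \<and> measure \<mu> (C (2 * j + 1)) \<le> measure \<mu> (C (2 * j)) + 1 / N"
proof -
  interpret cdf_distribution \<mu>
    using assms(1) by (simp add: cdf_distribution_def)
  define q where "q j = I (real j / real N)" for j
  have q: "real j / real N \<le> cdf \<mu> x \<longleftrightarrow> q j \<le> x" if "0 < j" "j < N" for j x
    unfolding q_def using that by (intro pseudoinverse) auto
  have q_mono: "q i \<le> q j" if "0 < i" "i \<le> j" "j < N" for i j
    using q[of j "q j"] q[of i "q j"] that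
    by (smt (verit) divide_right_mono of_nat_0_le_iff of_nat_mono order_less_le_trans order_le_less_trans)
  define E where "E j = (if j = 0 then {} else if j < N then {..q j} else UNIV)" for j
  \<comment> \<open>If q (j + 1) = q j, the open half-line alone would be smaller than E j; the
    union keeps the chain of cuts increasing.\<close>
  define O' where "O' j = (if j + 1 < N then {..<q (j + 1)} \<union> E j else UNIV)" for j
  define C where "C k = (if even k then E (k div 2) else O' (k div 2))" for k
  have CE: "C (2 * j) = E j" and CO: "C (2 * j + 1) = O' j" for j
    by (simp_all add: C_def)
  have EO: "E j \<subseteq> O' j" and OE: "O' j \<subseteq> E (Suc j)" for j
    using q_mono[of j "Suc j"] by (auto simp: E_def O'_def)
  have "C k \<subseteq> C (Suc k)" for k
  proof (cases "even k")
    case True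
    then obtain j where "k = 2 * j" by blast
    then show ?thesis
      using EO[of j] CE[of j] CO[of j] by simp
  next
    case False
    then obtain j where "k = 2 * j + 1" using oddE by blast
    then show ?thesis
      using OE[of j] CE[of "Suc j"] CO[of j] by simp
  qed
  then have mono: "mono C"
    by (simp add: mono_iff_le_Suc)
  have meas_E: "real j / real N \<le> measure \<mu> (E j)" if "j < N" for j
    using q[of j "q j"] that by (auto simp: E_def cdf_def)
  \<comment> \<open>To the left of the quantile the distribution function stays below j / N, and so
    does its left limit, which does not count an atom at the quantile itself.\<close>
  have meas_lt: "measure \<mu> {..<q j} \<le> real j / real N" if "0 < j" "j < N" for j
  proof (rule tendsto_upperbound[OF cdf_at_left])
    show "\<forall>\<^sub>F x in at_left (q j). cdf \<mu> x \<le> real j / real N"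
      using q[OF that] by (auto simp: eventually_at_filter not_le intro!: always_eventually less_imp_le)
        (meson le_less_trans linorder_not_le not_less_iff_gr_or_eq)
  qed simp
  have resolve: "\<exists>j<N. C (2 * j) \<subseteq> {..x} \<and> {..x} \<subseteq> C (2 * j + 1) \<and> measure \<mu> (C (2 * j + 1)) \<le> measure \<mu> (C (2 * j)) + 1 / N" for x
  proof -
    define P where "P j \<longleftrightarrow> j < N \<and> (j = 0 \<or> q j \<le> x)" for j
    \<comment> \<open>The largest level whose quantile is at most x, so that x lies strictly before
      the next quantile.\<close>
    define j where "j = (GREATEST j. P j)"
    have P0: "P 0"
      using N by (simp add: P_def)
    have bound: "\<And>y. P y \<Longrightarrow> y \<le> N"
      by (simp add: P_def)
    have j: "P j"
      unfolding j_def by (rule GreatestI_nat[of P, OF P0 bound])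
    have nS: "\<not> P (Suc j)"
      using Greatest_le_nat[of P "Suc j" N] bound unfolding j_def[symmetric] by auto
    have 1: "E j \<subseteq> {..x}"
      using j by (auto simp: E_def P_def)
    have step: "real (Suc j) / real N = real j / real N + 1 / real N"
      by (simp add: add_divide_distrib)
    have 2: "{..x} \<subseteq> O' j \<and> measure \<mu> (O' j) \<le> measure \<mu> (E j) + 1 / N"
    proof (cases "j + 1 < N")
      case True
      then have lt: "x < q (j + 1)"
        using nS by (auto simp: P_def not_le)
      then have "O' j = {..<q (j + 1)}"
        using True 1 by (auto simp: O'_def)
      moreover have "{..x} \<subseteq> {..<q (j + 1)}"
        using lt by auto
      moreover have "measure \<mu> {..<q (j + 1)} \<le> measure \<mu> (E j) + 1 / N"
        using meas_lt[of "j + 1"] meas_E[of j] step True by simp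
      ultimately show ?thesis
        by simp
    next
      case False
      then have "j + 1 = N"
        using j by (auto simp: P_def)
      then have "real (Suc j) / real N = 1"
        using N by simp
      then have "1 \<le> measure \<mu> (E j) + 1 / N"
        using meas_E[of j] step j unfolding P_def by linarith
      then have "measure \<mu> UNIV \<le> measure \<mu> (E j) + 1 / N"
        using prob_le_1[of UNIV] by linarith
      then show ?thesis
        using False by (simp add: O'_def)
    qed
    show ?thesis
      unfolding CE CO using 1 2 j by (intro exI[of _ j]) (auto simp: P_def)
  qed
  have "C k \<in> sets borel" for k
    by (auto simp: C_def E_def O'_def)
  then show ?thesis
    using that[OF _ mono _ resolve] CE[of 0] by (simp add: E_def)
qed

text \<open>\<Delta> is a measurable majorant of the supremum over x. It must be free of x, because
  the point at which the empirical function is evaluated later is random and may depend on the whole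
  sample. Monotonicity in x reduces the supremum to the 2 N + 1 cuts, and the maximal inequality
  avoids the logarithm of a union bound.\<close>

theorem (in prob_space) empirical_cdf_deviation:
  fixes \<xi> :: "nat \<Rightarrow> 'a \<Rightarrow> real"
  assumes ind: "indep_vars (\<lambda>_. borel) \<xi> {1..N}" and N: "N \<ge> 1"
    and law: "\<And>i. i \<in> {1..N} \<Longrightarrow> distr M borel (\<xi> i) = \<mu>"
  obtains \<Delta> where "integrable M \<Delta>" "\<And>\<omega>. 0 \<le> \<Delta> \<omega>" "expectation \<Delta> \<le> 16 / sqrt N"
    "\<And>\<omega> x. \<bar>real (card {j\<in>{1..N}. \<xi> j \<omega> \<le> x}) / N - cdf \<mu> x\<bar> \<le> \<Delta> \<omega>"
proof -
  have \<xi>m: "\<xi> i \<in> borel_measurable M" if "i \<in> {1..N}" for i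
    using ind that by (auto simp: indep_vars_def)
  have \<mu>: "real_distribution \<mu>"
    using real_distribution_distr[OF \<xi>m[of 1]] law[of 1] N by simp
  interpret \<mu>: real_distribution \<mu> by fact
  obtain C where C: "\<And>k. C k \<in> sets borel" "mono C" "C 0 = {}"
    and grid: "\<And>x. \<exists>j<N. C (2 * j) \<subseteq> {..x} \<and> {..x} \<subseteq> C (2 * j + 1) \<and> measure \<mu> (C (2 * j + 1)) \<le> measure \<mu> (C (2 * j)) + 1 / N"
    using half_line_grid[OF \<mu> N] by blast
  define S where "S k \<omega> = (\<Sum>i\<in>{1..N}. indicator (C k) (\<xi> i \<omega>) - measure \<mu> (C k))" for k \<omega>
  \<comment> \<open>The summand \<open>1 / N\<close> absorbs the term of the fourth moment that is linear in the mass.\<close>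
  define u where "u k = measure \<mu> (C (Suc k)) - measure \<mu> (C k) + 1 / N" for k
  have Cm: "C i \<subseteq> C j" if "i \<le> j" for i j
    using C(2) that by (rule monoD)
  have Smeas: "S k \<in> borel_measurable M" for k
    unfolding S_def[abs_def] using C(1)[of k] \<xi>m
    by (intro borel_measurable_sum borel_measurable_diff borel_measurable_const
        measurable_compose[OF _ borel_measurable_indicator]) auto
  have Sbd: "\<bar>S k \<omega>\<bar> \<le> N" for k \<omega>
  proof -
    have "\<bar>S k \<omega>\<bar> \<le> (\<Sum>i\<in>{1..N}. \<bar>indicator (C k) (\<xi> i \<omega>) - measure \<mu> (C k)\<bar>)"
      unfolding S_def by (rule sum_abs)
    also have "\<dots> \<le> (\<Sum>i\<in>{1..N}. 1)"
      by (intro sum_mono) (auto simp: indicator_def)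
    finally show ?thesis
      by simp
  qed
  have u0: "0 \<le> u k" for k
    unfolding u_def using \<mu>.finite_measure_mono[OF Cm[of k "Suc k"]] C(1) by simp
  have usum: "(\<Sum>k\<in>{i..<j}. u k) = measure \<mu> (C j) - measure \<mu> (C i) + real (j - i) / N" if "i \<le> j" for i j
    unfolding u_def sum.distrib sum_Suc_diff'[OF that, of "\<lambda>k. measure \<mu> (C k)"] by simp
  \<comment> \<open>The case i = j is set apart because otherwise the sum of the \<open>u k\<close>
    contains at least one summand 1 / N.\<close>
  have incr: "expectation (\<lambda>\<omega>. (S j \<omega> - S i \<omega>) ^ 4) \<le> 3 * (real N)\<^sup>2 * (\<Sum>k\<in>{i..<j}. u k)\<^sup>2" if "i \<le> j" for i j
  proof (cases "i = j")
    case False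
    define p where "p = measure \<mu> (C j - C i)"
    have p: "p = measure \<mu> (C j) - measure \<mu> (C i)"
      unfolding p_def using C(1) Cm[OF that] by (intro \<mu>.finite_measure_Diff) auto
    have p0: "p \<ge> 0"
      by (simp add: p_def)
    have "S j \<omega> - S i \<omega> = (\<Sum>k\<in>{1..N}. indicator (C j - C i) (\<xi> k \<omega>) - p)" for \<omega>
      unfolding S_def sum_subtractf[symmetric] p using Cm[OF that]
      by (intro sum.cong refl) (auto simp: indicator_def)
    then have "expectation (\<lambda>\<omega>. (S j \<omega> - S i \<omega>) ^ 4) \<le> 3 * (real N)\<^sup>2 * p\<^sup>2 + real N * p"
      using centered_indicator_moments[OF ind _ law, of "C j - C i" "{1..N}"] C(1) by (simp add: p_def)
    also have "\<dots> \<le> 3 * (real N)\<^sup>2 * (p + 1 / N)\<^sup>2"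
      using p0 N by (simp add: power2_eq_square field_simps)
    also have "\<dots> \<le> 3 * (real N)\<^sup>2 * (\<Sum>k\<in>{i..<j}. u k)\<^sup>2"
      unfolding usum[OF that] p using p0 False that N unfolding p
      by (intro mult_left_mono power_mono add_mono divide_right_mono) auto
    finally show ?thesis .
  qed simp
  define D where "D \<omega> = Max ((\<lambda>k. \<bar>S k \<omega> - S 0 \<omega>\<bar>) ` {0..2 * N})" for \<omega>
  have D_meas [measurable]: "D \<in> borel_measurable M"
    unfolding D_def[abs_def] using Smeas by measurable
  have S0: "S 0 \<omega> = 0" for \<omega>
    by (simp add: S_def C(3))
  have D_ge: "\<bar>S k \<omega>\<bar> \<le> D \<omega>" if "k \<le> 2 * N" for k \<omega>
    unfolding D_def using that by (intro Max_ge) (auto simp: S0 intro!: image_eqI[where x=k])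
  have D0: "0 \<le> D \<omega>" for \<omega>
    using D_ge[of 0 \<omega>] by simp
  have DN: "D \<omega> \<le> N" for \<omega>
    unfolding D_def S0 using Sbd by (intro Max.boundedI) auto
  have Di: "integrable M (\<lambda>\<omega>. D \<omega> ^ k)" for k
    using D0 DN by (intro integrable_const_bound[where B="real N ^ k"]) (auto intro!: power_mono)
  have "expectation (\<lambda>\<omega>. D \<omega> ^ 4) \<le> 1600 * (3 * (real N)\<^sup>2) * (\<Sum>k\<in>{0..<2 * N}. u k)\<^sup>2"
    unfolding D_def by (rule maximal_fourth_moment[OF Smeas Sbd u0 _ incr]) auto
  also have "\<dots> \<le> 1600 * (3 * (real N)\<^sup>2) * 3\<^sup>2"
  proof (intro mult_left_mono power_mono)
    \<comment> \<open>Mass at most 1, plus 2 N summands 1 / N.\<close>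
    show "(\<Sum>k\<in>{0..<2 * N}. u k) \<le> 3"
      using usum[of 0 "2 * N"] \<mu>.prob_le_1[of "C (2 * N)"] N by (simp add: C(3))
    show "0 \<le> (\<Sum>k\<in>{0..<2 * N}. u k)"
      using u0 by (intro sum_nonneg) auto
  qed auto
  \<comment> \<open>1600 * 3 * 9 = 43200 is rounded up to the fourth power 15^4 = 50625.\<close>
  also have "\<dots> \<le> 15 ^ 4 * (real N)\<^sup>2"
    by simp
  finally have D4: "expectation (\<lambda>\<omega>. D \<omega> ^ 4) \<le> 15 ^ 4 * (real N)\<^sup>2" .
  have D1: "expectation D \<le> 15 * sqrt N"
  proof -
    define m where "m = 15 * sqrt N"
    have m: "m > 0" "m ^ 4 = 15 ^ 4 * (real N)\<^sup>2"
      using N by (auto simp: m_def power_mult_distrib power4_eq_xxxx power2_eq_square)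
    \<comment> \<open>Tangent line of the fourth power at \<open>m\<close>; it replaces Jensen's inequality.\<close>
    have tangent: "4 * m ^ 3 * y \<le> y ^ 4 + 3 * m ^ 4" for y
    proof -
      have "y ^ 4 + 3 * m ^ 4 - 4 * m ^ 3 * y = (y - m)\<^sup>2 * ((y + m)\<^sup>2 + 2 * m\<^sup>2)"
        by (simp add: power4_eq_xxxx power3_eq_cube power2_eq_square algebra_simps)
      also have "\<dots> \<ge> 0"
        by simp
      finally show ?thesis by simp
    qed
    have "4 * m ^ 3 * expectation D = expectation (\<lambda>\<omega>. 4 * m ^ 3 * D \<omega>)"
      by simp
    also have "\<dots> \<le> expectation (\<lambda>\<omega>. D \<omega> ^ 4 + 3 * m ^ 4)"
      using Di[of 1] Di[of 4] by (intro integral_mono tangent) auto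
    also have "\<dots> = expectation (\<lambda>\<omega>. D \<omega> ^ 4) + 3 * m ^ 4"
      using Di[of 4] by (simp add: prob_space)
    also have "\<dots> \<le> 4 * m ^ 3 * m"
      using D4 m by (simp add: power4_eq_xxxx power3_eq_cube)
    finally show ?thesis
      using m by (simp add: m_def[symmetric])
  qed
  define \<Delta> where "\<Delta> \<omega> = (D \<omega> + 1) / N" for \<omega>
  show ?thesis
  proof (rule that)
    show "integrable M \<Delta>"
      unfolding \<Delta>_def[abs_def] using Di[of 1] by simp
    show "0 \<le> \<Delta> \<omega>" for \<omega>
      using D0[of \<omega>] by (simp add: \<Delta>_def)
    have "expectation \<Delta> = (expectation D + 1) / N"
      unfolding \<Delta>_def[abs_def] using Di[of 1] by (simp add: prob_space)
    also have "\<dots> \<le> (15 * sqrt N + sqrt N) / N"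
      using D1 N by (intro divide_right_mono add_mono) auto
    also have "\<dots> = 16 / sqrt N"
      using N by (simp add: field_simps)
    finally show "expectation \<Delta> \<le> 16 / sqrt N" .
    show "\<bar>real (card {j\<in>{1..N}. \<xi> j \<omega> \<le> x}) / N - cdf \<mu> x\<bar> \<le> \<Delta> \<omega>" for \<omega> x
    proof -
      define n where "n A = (\<Sum>i\<in>{1..N}. indicator A (\<xi> i \<omega>) :: real)" for A
      have nS: "n (C k) = S k \<omega> + N * measure \<mu> (C k)" for k
        by (simp add: n_def S_def sum_subtractf)
      have n_mono: "n A \<le> n A'" if "A \<subseteq> A'" for A A'
        unfolding n_def using that by (intro sum_mono) (auto simp: indicator_def)
      have card: "real (card {j\<in>{1..N}. \<xi> j \<omega> \<le> x}) = n {..x}"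
      proof -
        have "n {..x} = (\<Sum>i\<in>{1..N}. if \<xi> i \<omega> \<le> x then 1 else 0)"
          unfolding n_def by (intro sum.cong refl) (simp add: indicator_def)
        also have "\<dots> = (\<Sum>i\<in>{j\<in>{1..N}. \<xi> j \<omega> \<le> x}. 1)"
          by (rule sum.inter_filter[symmetric]) simp
        finally have "n {..x} = (\<Sum>i\<in>{j\<in>{1..N}. \<xi> j \<omega> \<le> x}. 1)" .
        then show ?thesis
          by simp
      qed
      obtain j where j: "j < N" "C (2 * j) \<subseteq> {..x}" "{..x} \<subseteq> C (2 * j + 1)"
        and mj: "measure \<mu> (C (2 * j + 1)) \<le> measure \<mu> (C (2 * j)) + 1 / N"
        using grid[of x] by blast
      have cdf: "measure \<mu> (C (2 * j)) \<le> cdf \<mu> x" "cdf \<mu> x \<le> measure \<mu> (C (2 * j + 1))"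
        unfolding cdf_def using j C(1) by (auto intro!: \<mu>.finite_measure_mono)
      have "N * measure \<mu> (C (2 * j + 1)) \<le> N * (measure \<mu> (C (2 * j)) + 1 / N)"
        using mj by (intro mult_left_mono) auto
      then have mj': "N * measure \<mu> (C (2 * j + 1)) \<le> N * measure \<mu> (C (2 * j)) + 1"
        using N by (simp add: distrib_left)
      have cdf': "N * measure \<mu> (C (2 * j)) \<le> N * cdf \<mu> x" "N * cdf \<mu> x \<le> N * measure \<mu> (C (2 * j + 1))"
        using cdf by (auto intro!: mult_left_mono)
      have "n (C (2 * j)) \<le> n {..x}" "n {..x} \<le> n (C (2 * j + 1))"
        using j by (auto intro!: n_mono)
      moreover have "\<bar>S (2 * j) \<omega>\<bar> \<le> D \<omega>" "\<bar>S (2 * j + 1) \<omega>\<bar> \<le> D \<omega>"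
        using j(1) by (auto intro!: D_ge)
      \<comment> \<open>Between the two cuts around x the mass of \<mu> grows by at most 1 / N;
        multiplied by N this is the summand 1.\<close>
      ultimately have "\<bar>n {..x} - N * cdf \<mu> x\<bar> \<le> D \<omega> + 1"
        unfolding nS abs_le_iff using mj' cdf' by (intro conjI) linarith+
      then have "\<bar>n {..x} - N * cdf \<mu> x\<bar> / N \<le> \<Delta> \<omega>"
        unfolding \<Delta>_def by (intro divide_right_mono) auto
      moreover have "n {..x} / N - cdf \<mu> x = (n {..x} - N * cdf \<mu> x) / N"
        using N by (simp add: field_simps)
      ultimately show ?thesis
        unfolding card by simp
    qed
  qed
qed

section \<open>The mean field drift\<close>

lemma (in filtered_space) admissible_cong:
  assumes "\<And>s \<omega>. s \<in> {0..T} \<Longrightarrow> \<omega> \<in> space M \<Longrightarrow> a s \<omega> = a' s \<omega>"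
  shows "admissible M F T a \<longleftrightarrow> admissible M F T a'"
proof -
  have "(\<lambda>(s, \<omega>). a s \<omega>) \<in> borel_measurable (restrict_space borel {0..t} \<Otimes>\<^sub>M F t) \<longleftrightarrow>
      (\<lambda>(s, \<omega>). a' s \<omega>) \<in> borel_measurable (restrict_space borel {0..t} \<Otimes>\<^sub>M F t)" if "t \<in> {0..T}" for t
    using that assms by (intro measurable_cong) (auto simp: space_pair_measure space_restrict_space)
  moreover have "(\<integral>\<^sup>+ \<omega>. (\<integral>\<^sup>+ s\<in>{0..T}. ennreal \<bar>a s \<omega>\<bar> \<partial>lborel) \<partial>M) = (\<integral>\<^sup>+ \<omega>. (\<integral>\<^sup>+ s\<in>{0..T}. ennreal \<bar>a' s \<omega>\<bar> \<partial>lborel) \<partial>M)"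
    using assms by (intro nn_integral_cong) (auto split: split_indicator)
  ultimately show ?thesis
    by (simp add: admissible_def progressively_measurable_def)
qed

lemma expected_payoff_cong:
  assumes "\<And>s \<omega>. s \<in> {t..T} \<Longrightarrow> \<omega> \<in> space M \<Longrightarrow> a s \<omega> = a' s \<omega>"
    and "AE \<omega> in M. f \<omega> = f' \<omega>" "f \<in> borel_measurable M" "f' \<in> borel_measurable M"
  shows "expected_payoff M c t T f a = expected_payoff M c t T f' a'"
proof -
  have "(\<integral>\<^sup>+ \<omega>. (\<integral>\<^sup>+ s\<in>{t..T}. ennreal (c * (a s \<omega>)\<^sup>2) \<partial>lborel) \<partial>M) = (\<integral>\<^sup>+ \<omega>. (\<integral>\<^sup>+ s\<in>{t..T}. ennreal (c * (a' s \<omega>)\<^sup>2) \<partial>lborel) \<partial>M)"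
    using assms(1) by (intro nn_integral_cong) (auto split: split_indicator)
  moreover have "(\<integral>\<omega>. f \<omega> \<partial>M) = (\<integral>\<omega>. f' \<omega> \<partial>M)"
    using assms(2-4) by (intro integral_cong_AE) auto
  ultimately show ?thesis
    by (simp add: expected_payoff_def)
qed

context controlled
begin

lemma terminal_measurable:
  assumes "admissible M F T a" "0 \<le> t" "t \<le> T"
  shows "(\<lambda>\<omega>. LINT s:{t..T}|lborel. a s \<omega>) \<in> borel_measurable M"
  using assms T by (intro measurable_F[of _ T] measurable_progressive_integral) (auto simp: admissible_def)

lemma solves_payoff:
  assumes X: "solves t x X" and t: "0 \<le> t" "t < T"
  shows "ereal (V t x) \<le> expected_payoff M c t T
    (\<lambda>\<omega>. g (x + (LINT s:{t..T}|lborel. feedback t X s \<omega>) + \<sigma> * (B T \<omega> - B t \<omega>))) (feedback t X)"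
proof -
  have "expected_payoff M c t T (\<lambda>\<omega>. g (X T \<omega>)) (feedback t X) = expected_payoff M c t T
    (\<lambda>\<omega>. g (x + (LINT s:{t..T}|lborel. feedback t X s \<omega>) + \<sigma> * (B T \<omega> - B t \<omega>))) (feedback t X)"
  proof (rule expected_payoff_cong)
    show "AE \<omega> in M. g (X T \<omega>) = g (x + (LINT s:{t..T}|lborel. feedback t X s \<omega>) + \<sigma> * (B T \<omega> - B t \<omega>))"
      using X_equation[OF X t]
    proof eventually_elim
      case (elim \<omega>)
      then show ?case
        using t bspec[OF elim, of T] by (simp add: feedback_integral[OF X t])
    qed
    show "(\<lambda>\<omega>. g (X T \<omega>)) \<in> borel_measurable M"
      using T by (intro measurable_compose[OF _ g_measurable] X_measurable_M[OF X t]) auto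
    show "(\<lambda>\<omega>. g (x + (LINT s:{t..T}|lborel. feedback t X s \<omega>) + \<sigma> * (B T \<omega> - B t \<omega>))) \<in> borel_measurable M"
      using t by (intro measurable_compose[OF _ g_measurable] borel_measurable_add borel_measurable_const
          borel_measurable_times borel_measurable_diff B_measurable_M terminal_measurable feedback_admissible[OF X t]) auto
  qed simp
  then show ?thesis
    using payoff_ge_V[OF X t] by simp
qed

text \<open>The two halves of the verification meet: the supremum is attained by the feedback along
  a solution from (t, x). As V knows no probability space, a drift computed on one space can steer
  the players on another.\<close>

lemma mfg_value_eq:
  assumes g: "g = rank_reward R \<mu>" and t: "0 \<le> t" "t < T"
  shows "mfg_value M F B T c \<sigma> R \<mu> t x = V t x"
proof -
  have "(SUP a\<in>{a. admissible M F T a}. expected_payoff M c t T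
       (\<lambda>\<omega>. g (x + (LINT s:{t..T}|lborel. a s \<omega>) + \<sigma> * (B T \<omega> - B t \<omega>))) a) = ereal (V t x)"
  proof (rule antisym)
    obtain X where X: "solves t x X"
      using solution_exists[OF t] by blast
    show "ereal (V t x) \<le> (SUP a\<in>{a. admissible M F T a}. expected_payoff M c t T
       (\<lambda>\<omega>. g (x + (LINT s:{t..T}|lborel. a s \<omega>) + \<sigma> * (B T \<omega> - B t \<omega>))) a)"
    proof (rule SUP_upper2)
      show "feedback t X \<in> {a. admissible M F T a}"
        using feedback_admissible[OF X t] by simp
    qed (rule solves_payoff[OF X t])
    show "(SUP a\<in>{a. admissible M F T a}. expected_payoff M c t T
       (\<lambda>\<omega>. g (x + (LINT s:{t..T}|lborel. a s \<omega>) + \<sigma> * (B T \<omega> - B t \<omega>))) a) \<le> ereal (V t x)"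
      by (rule SUP_least, rule payoff_le_V[OF _ t]) simp
  qed
  then show ?thesis
    by (simp add: mfg_value_def g)
qed

lemma mfg_drift_eq:
  assumes g: "g = rank_reward R \<mu>" and t: "t \<in> {0..T}"
  shows "mfg_drift M F B T c \<sigma> R \<mu> t x = b t x"
proof (cases "t < T")
  case True
  have "mfg_value M F B T c \<sigma> R \<mu> t = V t"
    using mfg_value_eq[OF g _ True] t by auto
  then show ?thesis
    using DERIV_imp_deriv[OF V_DERIV[OF True, of x]] True c by (simp add: mfg_drift_def)
qed (simp add: mfg_drift_def b_def)

text \<open>\<open>d\<close> will be \<open>mfg_drift\<close>, which is known to agree with
  \<open>b\<close> on [0, T] only. The two equations differ by B 0, which is almost surely 0, and
  integrability before T is automatic along continuous paths.\<close>

lemma strong_solution_iff_solves: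
  assumes d: "\<And>t x. t \<in> {0..T} \<Longrightarrow> d t x = b t x"
  shows "strong_solution M F B T \<sigma> d X \<longleftrightarrow> solves 0 0 X"
proof -
  have "(AE \<omega> in M. \<forall>t\<in>{0..<T}. set_integrable lborel {0..t} (\<lambda>s. d s (X s \<omega>)) \<and>
        X t \<omega> = (LINT s:{0..t}|lborel. d s (X s \<omega>)) + \<sigma> * B t \<omega>) \<longleftrightarrow>
      (AE \<omega> in M. \<forall>t\<in>{0..<T}. X t \<omega> = 0 + (LINT s:{0..t}|lborel. b s (X s \<omega>)) + \<sigma> * (B t \<omega> - B 0 \<omega>))"
    if cont: "\<forall>\<omega>\<in>space M. continuous_on {0..T} (\<lambda>t. X t \<omega>)"
  proof -
    have "AE \<omega> in M. (\<forall>t\<in>{0..<T}. set_integrable lborel {0..t} (\<lambda>s. d s (X s \<omega>)) \<and>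
        X t \<omega> = (LINT s:{0..t}|lborel. d s (X s \<omega>)) + \<sigma> * B t \<omega>) \<longleftrightarrow>
      (\<forall>t\<in>{0..<T}. X t \<omega> = 0 + (LINT s:{0..t}|lborel. b s (X s \<omega>)) + \<sigma> * (B t \<omega> - B 0 \<omega>))"
      using B_0
    proof (rule AE_mp, intro AE_I2 impI)
      fix \<omega> assume \<omega>: "\<omega> \<in> space M" and B0: "B 0 \<omega> = 0"
      have 1: "(LINT s:{0..t}|lborel. d s (X s \<omega>)) = (LINT s:{0..t}|lborel. b s (X s \<omega>))"
        and 2: "set_integrable lborel {0..t} (\<lambda>s. d s (X s \<omega>))" if t: "t \<in> {0..<T}" for t
      proof -
        show "(LINT s:{0..t}|lborel. d s (X s \<omega>)) = (LINT s:{0..t}|lborel. b s (X s \<omega>))"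
          using t by (intro set_lebesgue_integral_cong) (auto simp: d)
        have "set_integrable lborel {0..t} (\<lambda>s. b s (X s \<omega>))"
          using t by (intro set_integrable_lborel_continuous b_path_continuous continuous_on_subset[OF bspec[OF cont \<omega>]]) auto
        then show "set_integrable lborel {0..t} (\<lambda>s. d s (X s \<omega>))"
          using t by (subst set_integrable_cong[OF refl refl, where f'="\<lambda>s. b s (X s \<omega>)"]) (auto simp: d)
      qed
      show "(\<forall>t\<in>{0..<T}. set_integrable lborel {0..t} (\<lambda>s. d s (X s \<omega>)) \<and>
        X t \<omega> = (LINT s:{0..t}|lborel. d s (X s \<omega>)) + \<sigma> * B t \<omega>) \<longleftrightarrow>
        (\<forall>t\<in>{0..<T}. X t \<omega> = 0 + (LINT s:{0..t}|lborel. b s (X s \<omega>)) + \<sigma> * (B t \<omega> - B 0 \<omega>))"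
        using 1 2 B0 by simp
    qed
    then show ?thesis
      by (rule eventually_subst)
  qed
  then show ?thesis
    unfolding strong_solution_def solves_def by blast
qed

end

text \<open>In place of Jensen's inequality, y powr \<alpha> <= 1 + y at the scale y = D / m; the
  constant becomes 1 + K instead of K powr \<alpha>.\<close>

lemma expectation_powr_le:
  fixes D :: "'a \<Rightarrow> real"
  assumes "prob_space M" and D: "integrable M D" "\<And>\<omega>. 0 \<le> D \<omega>" and E: "(\<integral>\<omega>. D \<omega> \<partial>M) \<le> K * m"
    and m: "m > 0" and \<alpha>: "0 < \<alpha>" "\<alpha> \<le> 1"
  shows "integrable M (\<lambda>\<omega>. D \<omega> powr \<alpha>)" "(\<integral>\<omega>. D \<omega> powr \<alpha> \<partial>M) \<le> (1 + K) * m powr \<alpha>"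
proof -
  interpret prob_space M by fact
  have [measurable]: "D \<in> borel_measurable M"
    using D(1) by (rule borel_measurable_integrable)
  have le: "D \<omega> powr \<alpha> \<le> m powr \<alpha> * (1 + D \<omega> / m)" for \<omega>
  proof -
    have "y powr \<alpha> \<le> 1 + y" if "y \<ge> 0" for y :: real
    proof (cases "y \<le> 1")
      case True
      then have "y powr \<alpha> \<le> 1"
        using that \<alpha> by (intro powr_le1) auto
      then show ?thesis
        using that by linarith
    next
      case False
      then have "y powr \<alpha> \<le> y powr 1"
        using \<alpha> by (intro powr_mono) auto
      then show ?thesis
        using that by simp
    qed
    from this[of "D \<omega> / m"] have "m powr \<alpha> * (D \<omega> / m) powr \<alpha> \<le> m powr \<alpha> * (1 + D \<omega> / m)"
      using D(2)[of \<omega>] m by (intro mult_left_mono) auto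
    moreover have "m powr \<alpha> * (D \<omega> / m) powr \<alpha> = D \<omega> powr \<alpha>"
      using D(2)[of \<omega>] m by (simp add: powr_mult[symmetric])
    ultimately show ?thesis
      by simp
  qed
  have i: "integrable M (\<lambda>\<omega>. m powr \<alpha> * (1 + D \<omega> / m))"
    using D(1) by simp
  show 1: "integrable M (\<lambda>\<omega>. D \<omega> powr \<alpha>)"
    using le D(2) by (intro Bochner_Integration.integrable_bound[OF i]) (auto intro!: always_eventually order_trans[OF le abs_ge_self])
  have "(\<integral>\<omega>. D \<omega> powr \<alpha> \<partial>M) \<le> (\<integral>\<omega>. m powr \<alpha> * (1 + D \<omega> / m) \<partial>M)"
    using 1 i le by (rule integral_mono)
  also have "\<dots> = m powr \<alpha> * (1 + expectation D / m)"
    using D(1) by (simp add: prob_space)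
  also have "\<dots> \<le> m powr \<alpha> * (1 + K)"
    using E m by (intro mult_left_mono add_left_mono) (auto simp: divide_le_eq)
  finally show "(\<integral>\<omega>. D \<omega> powr \<alpha> \<partial>M) \<le> (1 + K) * m powr \<alpha>"
    by (simp add: mult.commute)
qed

lemma card_diff_le_1:
  assumes "finite A" "finite A'" "A - {i} = A' - {i}"
  shows "\<bar>real (card A) - real (card A')\<bar> \<le> 1"
proof -
  have "card A = card (A - {i}) + (if i \<in> A then 1 else 0)" if "finite A" for A :: "'a set"
    using that card_Suc_Diff1[of A i] by auto
  from this[OF assms(1)] this[OF assms(2)] show ?thesis
    unfolding assms(3) by auto
qed

section \<open>Approximate equilibria of the finite game\<close>

text \<open>One estimate, \<open>key\<close>, compares the game with the mean field reward for an
  arbitrary control of player i. Inserting her own feedback gives the lower side and any deviation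
  the upper side; hence twice the error.\<close>

theorem (in monotone_reward) eps_nash_feedback:
  fixes M :: "'a measure" and R :: "real \<Rightarrow> real \<Rightarrow> real" and B X :: "nat \<Rightarrow> real \<Rightarrow> 'a \<Rightarrow> real"
  assumes g: "g = rank_reward R \<mu>" and N: "N \<ge> 1"
    and R_bound: "\<And>x r. r \<in> {0..1} \<Longrightarrow> \<bar>R x r\<bar> \<le> C"
    and R_cont: "continuous_on (UNIV \<times> {0..1}) (\<lambda>(x, r). R x r)"
    and L: "L \<ge> 0" and \<alpha>: "0 < \<alpha>" "\<alpha> \<le> 1"
    and R_Holder: "\<And>x r r'. r \<in> {0..1} \<Longrightarrow> r' \<in> {0..1} \<Longrightarrow> \<bar>R x r - R x r'\<bar> \<le> L * \<bar>r - r'\<bar> powr \<alpha>"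
    and \<mu>: "real_distribution \<mu>" and filt: "filtered_prob_space M F"
    and BM: "independent_brownian_motions M F T N B"
    and d: "\<And>t x. t \<in> {0..T} \<Longrightarrow> d t x = b t x"
    and X: "\<And>i. i \<in> {1..N} \<Longrightarrow> strong_solution M F (B i) T \<sigma> d (X i)"
    and law: "\<And>i. i \<in> {1..N} \<Longrightarrow> distr M borel (X i T) = \<mu>"
  shows "eps_nash M F T c \<sigma> R N B (\<lambda>i t \<omega>. d t (X i t \<omega>)) (36 * L * real N powr (- (\<alpha> / 2)))"
proof -
  interpret filtered_space M F
    by standard (rule filt)
  interpret \<mu>: real_distribution \<mu> by fact
  have ctrl: "controlled T c \<sigma> C g M F (B i)" if "i \<in> {1..N}" for i
    using BM that by unfold_locales (auto simp: independent_brownian_motions_def)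
  define a where "a = (\<lambda>i t \<omega>. d t (X i t \<omega>))"
  \<comment> \<open>A fixed functional of the player's own Brownian path, almost surely equal to her
    terminal state: independence is inherited directly from the paths.\<close>
  define \<xi> where "\<xi> i \<omega> = path_map (\<lambda>t\<in>{0..T}. B i t \<omega>)" for i \<omega>
  have adm: "admissible M F T (a i)"
    and term_eq: "AE \<omega> in M. (LINT s:{0..T}|lborel. a i s \<omega>) + \<sigma> * B i T \<omega> = X i T \<omega>"
    and path: "AE \<omega> in M. X i T \<omega> = \<xi> i \<omega>"
    and XT: "X i T \<in> borel_measurable M" and BT: "B i T \<in> borel_measurable M"
    and lower: "ereal (V 0 0) \<le> expected_payoff M c 0 T (\<lambda>\<omega>. g ((LINT s:{0..T}|lborel. a i s \<omega>) + \<sigma> * B i T \<omega>)) (a i)"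
    and upper: "\<And>\<beta>. admissible M F T \<beta> \<Longrightarrow> expected_payoff M c 0 T (\<lambda>\<omega>. g ((LINT s:{0..T}|lborel. \<beta> s \<omega>) + \<sigma> * B i T \<omega>)) \<beta> \<le> ereal (V 0 0)"
    if i: "i \<in> {1..N}" for i
  proof -
    interpret controlled T c \<sigma> C g M F "B i"
      by (rule ctrl[OF i])
    have Xi: "solves 0 0 (X i)"
      using X[OF i] strong_solution_iff_solves[OF d] by blast
    have af: "a i s \<omega> = feedback 0 (X i) s \<omega>" if "s \<in> {0..T}" for s \<omega>
      using that by (simp add: a_def d feedback_def[OF Xi order_refl T])
    have aI: "(LINT s:{0..T}|lborel. a i s \<omega>) = (LINT s:{0..T}|lborel. feedback 0 (X i) s \<omega>)" for \<omega>
      by (intro set_lebesgue_integral_cong) (auto simp: af)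
    show adm: "admissible M F T (a i)"
      using feedback_admissible[OF Xi order_refl T] admissible_cong[of T "a i", OF af] by blast
    show "X i T \<in> borel_measurable M"
      using T by (intro X_measurable_M[OF Xi]) auto
    show BT: "B i T \<in> borel_measurable M"
      using T by (intro B_measurable_M) auto
    show "AE \<omega> in M. (LINT s:{0..T}|lborel. a i s \<omega>) + \<sigma> * B i T \<omega> = X i T \<omega>"
      using X_equation[OF Xi order_refl T] B_0
    proof eventually_elim
      case (elim \<omega>)
      then show ?case
        using bspec[OF elim(1), of T] T by (simp add: aI feedback_integral[OF Xi order_refl T])
    qed
    show "AE \<omega> in M. X i T \<omega> = \<xi> i \<omega>"
      unfolding \<xi>_def by (rule path_map_solution[OF Xi])
    have shift: "expected_payoff M c 0 T (\<lambda>\<omega>. g (0 + (LINT s:{0..T}|lborel. \<beta> s \<omega>) + \<sigma> * (B i T \<omega> - B i 0 \<omega>))) \<beta>' =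
        expected_payoff M c 0 T (\<lambda>\<omega>. g ((LINT s:{0..T}|lborel. \<beta> s \<omega>) + \<sigma> * B i T \<omega>)) \<beta>"
      if \<beta>: "admissible M F T \<beta>" and eq: "\<And>s \<omega>. s \<in> {0..T} \<Longrightarrow> \<beta>' s \<omega> = \<beta> s \<omega>" for \<beta> \<beta>'
    proof (rule expected_payoff_cong)
      show "AE \<omega> in M. g (0 + (LINT s:{0..T}|lborel. \<beta> s \<omega>) + \<sigma> * (B i T \<omega> - B i 0 \<omega>)) =
          g ((LINT s:{0..T}|lborel. \<beta> s \<omega>) + \<sigma> * B i T \<omega>)"
        using B_0 by eventually_elim simp
    qed (use T eq in \<open>auto intro!: measurable_compose[OF _ g_measurable] borel_measurable_add
          borel_measurable_times borel_measurable_diff B_measurable_M terminal_measurable[OF \<beta>]\<close>)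
    show "ereal (V 0 0) \<le> expected_payoff M c 0 T (\<lambda>\<omega>. g ((LINT s:{0..T}|lborel. a i s \<omega>) + \<sigma> * B i T \<omega>)) (a i)"
      using solves_payoff[OF Xi order_refl T] unfolding aI[symmetric] by (subst (asm) shift[OF adm]) (auto simp: af)
    show "expected_payoff M c 0 T (\<lambda>\<omega>. g ((LINT s:{0..T}|lborel. \<beta> s \<omega>) + \<sigma> * B i T \<omega>)) \<beta> \<le> ereal (V 0 0)"
      if \<beta>: "admissible M F T \<beta>" for \<beta>
      using payoff_le_V[OF \<beta> order_refl T, of 0] unfolding shift[OF \<beta> refl] .
  qed
  have ind_B: "indep_vars (\<lambda>_. PiM {0..T} (\<lambda>_. borel)) (\<lambda>i \<omega>. \<lambda>t\<in>{0..T}. B i t \<omega>) {1..N}"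
    using BM by (simp add: independent_brownian_motions_def)
  have ind: "indep_vars (\<lambda>_. borel) \<xi> {1..N}"
    unfolding \<xi>_def[abs_def] by (rule indep_vars_compose2[OF ind_B]) measurable
  have \<xi>m: "\<xi> i \<in> borel_measurable M" if "i \<in> {1..N}" for i
    using ind that by (auto simp: indep_vars_def)
  have \<xi>law: "distr M borel (\<xi> i) = \<mu>" if i: "i \<in> {1..N}" for i
    unfolding law[OF i, symmetric]
  proof (rule distr_cong_AE)
    show "AE \<omega> in M. \<xi> i \<omega> = X i T \<omega>"
      using path[OF i] by eventually_elim simp
  qed (use \<xi>m[OF i] XT[OF i] in auto)
  obtain \<Delta> where \<Delta>: "integrable M \<Delta>" "\<And>\<omega>. 0 \<le> \<Delta> \<omega>" "expectation \<Delta> \<le> 16 / sqrt N"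
    "\<And>\<omega> x. \<bar>real (card {j\<in>{1..N}. \<xi> j \<omega> \<le> x}) / N - cdf \<mu> x\<bar> \<le> \<Delta> \<omega>"
    using empirical_cdf_deviation[OF ind N \<xi>law] by blast
  define H where "H \<omega> = (\<Delta> \<omega> + 1 / N) powr \<alpha>" for \<omega>
  \<comment> \<open>18 = 1 + 17 by \<open>expectation_powr_le\<close>, where 17 = 16 + 1 accounts
    for \<Delta> and for the replaced player.\<close>
  define e where "e = 18 * L * real N powr (- (\<alpha> / 2))"
  have m: "1 / sqrt N > 0" "(1 / sqrt N) powr \<alpha> = real N powr (- (\<alpha> / 2))"
    using N by (simp_all add: powr_half_sqrt[symmetric] powr_minus_divide[symmetric] powr_powr)
  have "expectation (\<lambda>\<omega>. \<Delta> \<omega> + 1 / N) \<le> 17 * (1 / sqrt N)"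
  proof -
    have "1 / real N \<le> 1 / sqrt N"
      using N by (intro divide_left_mono) (auto simp: sqrt_le_D real_sqrt_le_iff intro!: real_le_lsqrt self_le_power)
    then show ?thesis
      using \<Delta>(1,3) by (simp add: prob_space)
  qed
  from expectation_powr_le[OF prob_space_axioms _ _ this m(1) \<alpha>]
  have Hi: "integrable M H" and EH: "expectation H \<le> 18 * real N powr (- (\<alpha> / 2))"
    unfolding H_def[abs_def] m(2) using \<Delta>(1,2) by (auto simp: add_nonneg_nonneg)
  \<comment> \<open>Since \<Delta> bounds the deviation at every x simultaneously, it may be
    evaluated at the random point Z i \<omega>, however \<beta> depends on the noise of the other
    players.\<close>
  have key: "\<bar>expectation (\<lambda>\<omega>. rank_reward R (empirical_measure N (\<lambda>j. terminal_state T \<sigma> B (a(i := \<beta>)) j \<omega>))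
        (terminal_state T \<sigma> B (a(i := \<beta>)) i \<omega>)) - expectation (\<lambda>\<omega>. g ((LINT s:{0..T}|lborel. \<beta> s \<omega>) + \<sigma> * B i T \<omega>))\<bar> \<le> e"
    if i: "i \<in> {1..N}" and \<beta>: "admissible M F T \<beta>" for i \<beta>
  proof -
    define Z where "Z j \<omega> = terminal_state T \<sigma> B (a(i := \<beta>)) j \<omega>" for j \<omega>
    have Zi: "Z i \<omega> = (LINT s:{0..T}|lborel. \<beta> s \<omega>) + \<sigma> * B i T \<omega>" for \<omega>
      by (simp add: Z_def terminal_state_def)
    have Zm: "Z j \<in> borel_measurable M" if j: "j \<in> {1..N}" for j
    proof -
      interpret controlled T c \<sigma> C g M F "B j"
        by (rule ctrl[OF j])
      show ?thesis
        unfolding Z_def[abs_def] terminal_state_def using T \<beta> adm[OF j] BT[OF i] BT[OF j]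
        by (auto intro!: borel_measurable_add borel_measurable_times terminal_measurable)
    qed
    define q where "q \<omega> = real (card {j\<in>{1..N}. Z j \<omega> \<le> Z i \<omega>}) / N" for \<omega>
    have q01: "q \<omega> \<in> {0..1}" for \<omega>
    proof -
      have "card {j\<in>{1..N}. Z j \<omega> \<le> Z i \<omega>} \<le> card {1..N}"
        by (intro card_mono) auto
      then show ?thesis
        using N by (simp add: q_def)
    qed
    have qm: "q \<in> borel_measurable M"
    proof -
      have "q \<omega> = (\<Sum>j\<in>{1..N}. if Z j \<omega> \<le> Z i \<omega> then 1 else 0) / N" for \<omega>
        unfolding q_def by (subst sum.inter_filter[symmetric]) auto
      then show ?thesis
        using Zm i by (simp add: measurable_If borel_measurable_le cong: measurable_cong)
    qed
    have F01: "cdf \<mu> x \<in> {0..1}" for x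
      using \<mu>.cdf_bounded_prob[of x] by (simp add: \<mu>.cdf_nonneg)
    have Rm: "(\<lambda>\<omega>. R (Z i \<omega>) (q \<omega>)) \<in> borel_measurable M"
    proof -
      have "(\<lambda>p. if p \<in> UNIV \<times> {0..1} then (\<lambda>(x, r). R x r) p else 0) \<in> borel_measurable borel"
        using R_cont by (intro borel_measurable_continuous_on_if) (auto intro!: borel_closed closed_Times)
      from measurable_compose[OF borel_measurable_Pair[OF Zm[OF i] qm] this] show ?thesis
        using q01 by (simp del: atLeastAtMost_iff)
    qed
    have rew: "rank_reward R (empirical_measure N (\<lambda>j. Z j \<omega>)) (Z i \<omega>) = R (Z i \<omega>) (q \<omega>)" for \<omega>
      by (simp add: rank_reward_def cdf_empirical_measure q_def)
    have Ri: "integrable M (\<lambda>\<omega>. R (Z i \<omega>) (q \<omega>))"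
      using R_bound[OF q01] Rm by (intro integrable_const_bound[where B=C]) auto
    have gi: "integrable M (\<lambda>\<omega>. g (Z i \<omega>))"
      using g_bound Zm[OF i] by (intro integrable_const_bound[where B=C]) (auto intro: measurable_compose[OF _ g_measurable])
    have "AE \<omega> in M. \<forall>j\<in>{1..N}. j \<noteq> i \<longrightarrow> Z j \<omega> = \<xi> j \<omega>"
    proof (rule AE_finite_allI)
      fix j assume j: "j \<in> {1..N}"
      show "AE \<omega> in M. j \<noteq> i \<longrightarrow> Z j \<omega> = \<xi> j \<omega>"
        using term_eq[OF j] path[OF j] by eventually_elim (simp add: Z_def terminal_state_def)
    qed simp
    then have close: "AE \<omega> in M. \<bar>R (Z i \<omega>) (q \<omega>) - g (Z i \<omega>)\<bar> \<le> L * H \<omega>"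
    proof eventually_elim
      case (elim \<omega>)
      let ?A = "{j\<in>{1..N}. Z j \<omega> \<le> Z i \<omega>}" and ?A' = "{j\<in>{1..N}. \<xi> j \<omega> \<le> Z i \<omega>}"
      \<comment> \<open>The sample of the \<xi> j still contains the entry of player i, so the two
        index sets can differ at i only.\<close>
      have "\<bar>real (card ?A) - real (card ?A')\<bar> \<le> 1"
        using elim by (intro card_diff_le_1[where i=i]) auto
      then have "\<bar>real (card ?A) - real (card ?A')\<bar> / N \<le> 1 / N"
        by (intro divide_right_mono) auto
      then have "\<bar>q \<omega> - real (card ?A') / N\<bar> \<le> 1 / N"
        by (simp add: q_def flip: diff_divide_distrib)
      then have "\<bar>q \<omega> - cdf \<mu> (Z i \<omega>)\<bar> \<le> \<Delta> \<omega> + 1 / N"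
        using \<Delta>(4)[of \<omega> "Z i \<omega>"] by linarith
      then have "\<bar>q \<omega> - cdf \<mu> (Z i \<omega>)\<bar> powr \<alpha> \<le> H \<omega>"
        unfolding H_def using \<alpha> by (intro powr_mono2) auto
      then have "L * \<bar>q \<omega> - cdf \<mu> (Z i \<omega>)\<bar> powr \<alpha> \<le> L * H \<omega>"
        using L by (intro mult_left_mono)
      then show ?case
        using R_Holder[OF q01 F01, of "Z i \<omega>" \<omega> "Z i \<omega>"] by (simp add: g rank_reward_def)
    qed
    have "\<bar>expectation (\<lambda>\<omega>. R (Z i \<omega>) (q \<omega>)) - expectation (\<lambda>\<omega>. g (Z i \<omega>))\<bar> = \<bar>expectation (\<lambda>\<omega>. R (Z i \<omega>) (q \<omega>) - g (Z i \<omega>))\<bar>"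
      using Ri gi by simp
    also have "\<dots> \<le> expectation (\<lambda>\<omega>. \<bar>R (Z i \<omega>) (q \<omega>) - g (Z i \<omega>)\<bar>)"
      by (rule integral_abs_bound)
    also have "\<dots> \<le> expectation (\<lambda>\<omega>. L * H \<omega>)"
      using Ri gi Hi close by (intro integral_mono_AE) auto
    also have "\<dots> \<le> e"
      using mult_left_mono[OF EH L] by (simp add: e_def mult_ac)
    finally show ?thesis
      unfolding Z_def[symmetric] rew Zi[symmetric] .
  qed
  have payoff: "game_payoff M T c \<sigma> R N B (a(i := \<beta>)) i \<le> expected_payoff M c 0 T (\<lambda>\<omega>. g ((LINT s:{0..T}|lborel. \<beta> s \<omega>) + \<sigma> * B i T \<omega>)) \<beta> + ereal e"
    "expected_payoff M c 0 T (\<lambda>\<omega>. g ((LINT s:{0..T}|lborel. \<beta> s \<omega>) + \<sigma> * B i T \<omega>)) \<beta> \<le> game_payoff M T c \<sigma> R N B (a(i := \<beta>)) i + ereal e"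
    if i: "i \<in> {1..N}" and \<beta>: "admissible M F T \<beta>" for i \<beta>
  proof -
    \<comment> \<open>\<open>w\<close> is the cost, possibly infinite; it is the same on both sides,
      so only the rewards are compared.\<close>
    have "ereal p - w \<le> ereal p' - w + ereal e" if "p \<le> p' + e" for p p' w
      using that by (cases w) auto
    then show "game_payoff M T c \<sigma> R N B (a(i := \<beta>)) i \<le> expected_payoff M c 0 T (\<lambda>\<omega>. g ((LINT s:{0..T}|lborel. \<beta> s \<omega>) + \<sigma> * B i T \<omega>)) \<beta> + ereal e"
      "expected_payoff M c 0 T (\<lambda>\<omega>. g ((LINT s:{0..T}|lborel. \<beta> s \<omega>) + \<sigma> * B i T \<omega>)) \<beta> \<le> game_payoff M T c \<sigma> R N B (a(i := \<beta>)) i + ereal e"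
      using key[OF i \<beta>] unfolding game_payoff_def expected_payoff_def fun_upd_same abs_le_iff by auto
  qed
  show ?thesis
    unfolding eps_nash_def a_def[symmetric]
  proof (intro conjI ballI allI impI)
    show "admissible M F T (a i)" if "i \<in> {1..N}" for i
      using adm that .
    fix i \<beta> assume i: "i \<in> {1..N}" and \<beta>: "admissible M F T \<beta>"
    have "game_payoff M T c \<sigma> R N B (a(i := \<beta>)) i \<le> ereal (V 0 0) + ereal e"
      by (rule order_trans[OF payoff(1)[OF i \<beta>] add_right_mono[OF upper[OF i \<beta>]]])
    also have "ereal (V 0 0) \<le> game_payoff M T c \<sigma> R N B a i + ereal e"
      using order_trans[OF lower[OF i] payoff(2)[OF i adm[OF i]]] by (simp only: fun_upd_triv)
    then have "ereal (V 0 0) + ereal e \<le> game_payoff M T c \<sigma> R N B a i + ereal e + ereal e"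
      by (rule add_right_mono)
    also have "\<dots> = game_payoff M T c \<sigma> R N B a i + ereal (36 * L * real N powr (- (\<alpha> / 2)))"
      unfolding add.assoc by (simp add: e_def mult_ac)
    finally show "game_payoff M T c \<sigma> R N B (a(i := \<beta>)) i \<le> game_payoff M T c \<sigma> R N B a i + ereal (36 * L * real N powr (- (\<alpha> / 2)))" .
  qed
qed

text \<open>Right continuity is inherited from the distribution function through the joint
  continuity of R; at an atom of \<mu> the reward may jump.\<close>

lemma rank_reward_monotone_reward:
  fixes R :: "real \<Rightarrow> real \<Rightarrow> real"
  assumes "T > 0" "c > 0" "\<sigma> > 0" and \<mu>: "real_distribution \<mu>"
    and bound: "\<And>x r. r \<in> {0..1} \<Longrightarrow> \<bar>R x r\<bar> \<le> C"
    and cont: "continuous_on (UNIV \<times> {0..1}) (\<lambda>(x, r). R x r)"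
    and mono1: "\<And>r. r \<in> {0..1} \<Longrightarrow> mono (\<lambda>x. R x r)" and mono2: "\<And>x. mono_on {0..1} (R x)"
  shows "monotone_reward T c \<sigma> C (rank_reward R \<mu>)"
proof
  interpret real_distribution \<mu> by fact
  have F01: "cdf \<mu> x \<in> {0..1}" for x
    using cdf_bounded_prob[of x] by (simp add: cdf_nonneg)
  show "mono (rank_reward R \<mu>)"
  proof (rule monoI)
    fix x y :: real assume "x \<le> y"
    have "R x (cdf \<mu> x) \<le> R x (cdf \<mu> y)"
      using F01 \<open>x \<le> y\<close> by (intro mono_onD[OF mono2] cdf_nondecreasing)
    also have "\<dots> \<le> R y (cdf \<mu> y)"
      using monoD[OF mono1[OF F01] \<open>x \<le> y\<close>] .
    finally show "rank_reward R \<mu> x \<le> rank_reward R \<mu> y"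
      by (simp add: rank_reward_def)
  qed
  show "continuous (at_right x) (rank_reward R \<mu>)" for x
  proof -
    have "((\<lambda>y. (y, cdf \<mu> y)) \<longlongrightarrow> (x, cdf \<mu> x)) (at_right x)"
      using cdf_is_right_cont[of x] by (intro tendsto_Pair tendsto_ident_at) (simp add: continuous_within)
    then have "((\<lambda>y. (\<lambda>(x, r). R x r) (y, cdf \<mu> y)) \<longlongrightarrow> (\<lambda>(x, r). R x r) (x, cdf \<mu> x)) (at_right x)"
      using F01 by (intro continuous_on_tendsto_compose[OF cont]) (auto intro!: always_eventually simp del: atLeastAtMost_iff)
    then show ?thesis
      by (simp add: continuous_within rank_reward_def[abs_def])
  qed
  show "\<bar>rank_reward R \<mu> x\<bar> \<le> C" for x
    unfolding rank_reward_def by (intro bound F01)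
qed (use assms in auto)

theorem theorem3p8:
  fixes T c \<sigma> L \<alpha> :: real
    and R :: "real \<Rightarrow> real \<Rightarrow> real"
    and M\<^sub>0 :: "'a measure" and F\<^sub>0 :: "real \<Rightarrow> 'a measure" and B\<^sub>0 :: "real \<Rightarrow> 'a \<Rightarrow> real"
    and \<mu> :: "real measure"
  assumes "T > 0" and "c > 0" and "\<sigma> > 0"
    and "\<exists>C. \<forall>x. \<forall>r\<in>{0..1}. \<bar>R x r\<bar> \<le> C"
    and "continuous_on (UNIV \<times> {0..1}) (\<lambda>(x, r). R x r)"
    and "\<forall>r\<in>{0..1}. mono (\<lambda>x. R x r)"
    and "\<forall>x. mono_on {0..1} (R x)"
    and "L > 0" and "0 < \<alpha>" and "\<alpha> \<le> 1"
    and "\<forall>x. \<forall>r\<^sub>1\<in>{0..1}. \<forall>r\<^sub>2\<in>{0..1}. \<bar>R x r\<^sub>1 - R x r\<^sub>2\<bar> \<le> L * \<bar>r\<^sub>1 - r\<^sub>2\<bar> powr \<alpha>"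
    and "filtered_prob_space M\<^sub>0 F\<^sub>0" and "brownian_motion M\<^sub>0 F\<^sub>0 T B\<^sub>0"
    and "real_distribution \<mu>"
    and "mfg_Phi M\<^sub>0 F\<^sub>0 B\<^sub>0 T c \<sigma> R \<mu> = \<mu>"
  shows "\<exists>K>0. \<exists>N\<^sub>0::nat. \<forall>N\<ge>N\<^sub>0.
    \<forall>(M :: 'b measure) F (B :: nat \<Rightarrow> real \<Rightarrow> 'b \<Rightarrow> real) (X :: nat \<Rightarrow> real \<Rightarrow> 'b \<Rightarrow> real).
      filtered_prob_space M F \<longrightarrow>
      independent_brownian_motions M F T N B \<longrightarrow>
      (\<forall>i\<in>{1..N}. strong_solution M F (B i) T \<sigma> (mfg_drift M\<^sub>0 F\<^sub>0 B\<^sub>0 T c \<sigma> R \<mu>) (X i)) \<longrightarrow>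
      eps_nash M F T c \<sigma> R N B
        (\<lambda>i t \<omega>. mfg_drift M\<^sub>0 F\<^sub>0 B\<^sub>0 T c \<sigma> R \<mu> t (X i t \<omega>))
        (K * real N powr (- (\<alpha> / 2)))"
proof -
  obtain C where R_bound: "\<And>x r. r \<in> {0..1} \<Longrightarrow> \<bar>R x r\<bar> \<le> C"
    using assms(4) by blast
  interpret monotone_reward T c \<sigma> C "rank_reward R \<mu>"
    using assms R_bound by (intro rank_reward_monotone_reward) auto
  interpret MF: controlled T c \<sigma> C "rank_reward R \<mu>" M\<^sub>0 F\<^sub>0 B\<^sub>0
    by unfold_locales (use assms in auto)
  let ?d = "mfg_drift M\<^sub>0 F\<^sub>0 B\<^sub>0 T c \<sigma> R \<mu>"
  have d: "?d t x = b t x" if "t \<in> {0..T}" for t x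
    using MF.mfg_drift_eq[OF refl that] .
  \<comment> \<open>The process that SOME selects in the definition of the fixed-point map;
    \<open>solution_exists\<close> ensures that it is a solution.\<close>
  define Y where "Y = mfg_state M\<^sub>0 F\<^sub>0 B\<^sub>0 T c \<sigma> R \<mu>"
  have "\<exists>X. strong_solution M\<^sub>0 F\<^sub>0 B\<^sub>0 T \<sigma> ?d X"
    using MF.solution_exists[of 0 0] MF.strong_solution_iff_solves[OF d] T by blast
  then have "strong_solution M\<^sub>0 F\<^sub>0 B\<^sub>0 T \<sigma> ?d Y"
    unfolding Y_def mfg_state_def by (rule someI_ex)
  then have Y: "MF.solves 0 0 Y"
    using MF.strong_solution_iff_solves[OF d] by blast
  have Y_law: "distr M\<^sub>0 borel (Y T) = \<mu>"
    using assms(15) by (simp add: mfg_Phi_def Y_def)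
  have nash: "eps_nash M F T c \<sigma> R N B (\<lambda>i t \<omega>. ?d t (X i t \<omega>)) (36 * L * real N powr (- (\<alpha> / 2)))"
    if N: "N \<ge> 1" and M: "filtered_prob_space M F" and B: "independent_brownian_motions M F T N B"
      and X: "\<forall>i\<in>{1..N}. strong_solution M F (B i) T \<sigma> ?d (X i)"
    for N and M :: "'b measure" and F and B X :: "nat \<Rightarrow> real \<Rightarrow> 'b \<Rightarrow> real"
  proof (rule eps_nash_feedback[where d="?d" and X=X, OF refl N])
    show "distr M borel (X i T) = \<mu>" if i: "i \<in> {1..N}" for i
    proof -
      interpret P: controlled T c \<sigma> C "rank_reward R \<mu>" M F "B i"
        by unfold_locales (use M B i in \<open>auto simp: independent_brownian_motions_def\<close>)
      have Xi: "P.solves 0 0 (X i)"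
        using X i P.strong_solution_iff_solves[OF d] by blast
      \<comment> \<open>Weak uniqueness carries the fixed-point property to the space of the game:
        both expectations equal the same iterated limit of Euler kernels.\<close>
      have "distr M borel (X i T) = distr M\<^sub>0 borel (Y T)"
      proof (rule distr_eqI_bounded_continuous)
        show "X i T \<in> borel_measurable M" "Y T \<in> borel_measurable M\<^sub>0"
          using T by (auto intro!: P.X_measurable_M[OF Xi] MF.X_measurable_M[OF Y])
        show "(\<integral>\<omega>. f (X i T \<omega>) \<partial>M) = (\<integral>\<omega>. f (Y T \<omega>) \<partial>M\<^sub>0)"
          if "continuous_on UNIV f" "\<And>x. \<bar>f x\<bar> \<le> 1" for f :: "real \<Rightarrow> real"
          using P.expectation_solution[OF Xi order_refl T that] MF.expectation_solution[OF Y order_refl T that] by simp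
      qed (rule P.prob_space_axioms MF.prob_space_axioms)+
      then show ?thesis
        by (simp add: Y_law)
    qed
  qed (use assms R_bound M B X d in auto)
  \<comment> \<open>The constant 36 L depends on L alone, so it serves all spaces and all N >=
    1.\<close>
  show ?thesis
    using nash assms(8) by (intro exI[of _ "36 * L"] exI[of _ 1] conjI allI impI) auto
qed

end
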